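(* Let $K/F$ be a cyclic Galois extension of local nonarchimedean fields of degree $n$ with $\mathrm{Gal}(K/F)=\langle\tau\rangle$, and let $D=(K/F,\tau,c)$ be a cyclic division algebra over $F$ of degree $n$ with $0\neq c\in\mathcal{O}_F$. Let $\mathcal{D}=(\mathcal{O}_K/\mathcal{O}_F,\tau,c)=\mathcal{O}_K\oplus\mathcal{O}_Ke\oplus\dots\oplus\mathcal{O}_Ke^{n-1}$ be its natural $\mathcal{O}_F$-order. Let $\sigma\in\mathrm{Aut}(D)$ be such that $\sigma|_F$ has finite order $m$ and $\sigma(\mathcal{D})\subset\mathcal{D}$, and suppose that $F_0=F\cap\mathrm{Fix}(\sigma)$ is a local nonarchimedean field and that $F/F_0$ is an unramified Galois extension. Let $\mathfrak{p}$ be the maximal ideal of $\mathcal{O}_{F_0}$. Let $f(t)=t^m-d\in\mathcal{D}[t;\sigma]$ be irreducible in $D[t;\sigma]$, and let $\Lambda=\mathcal{D}[t;\sigma]/\mathcal{D}[t;\sigma]f$ be the natural order in $S_f=D[t;\sigma]/D[t;\sigma]f$. Let $\Psi$ be the reduction map from $\Lambda$ to $S_{\overline f}=(\mathcal{D}/\mathfrak{p}\mathcal{D})[t;\overline\sigma]/(\mathcal{D}/\mathfrak{p}\mathcal{D})[t;\overline\sigma]\overline f$, also regarded as a map on $\Lambda/\mathfrak{p}\Lambda$, and let $\rho:\Lambda\to\Lambda/\mathfrak{p}\Lambda\to\Psi(\Lambda/\mathfrak{p}\Lambda)$ be the canonical projection composed with $\Psi$. Let $\mathcal{I}=\Lambda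 g$ be a principal left ideal of $\Lambda$ generated by a monic polynomial $g$, such that $\mathfrak{p}\subset\mathcal{I}\cap\mathcal{O}_{F_0}$. Then $\Psi(\mathcal{I}/\mathfrak{p}\Lambda)$ is a principal left ideal of $S_{\overline f}$ generated by the monic polynomial $\overline g$. Let $\mathcal{C}$ be the code corresponding to $\Psi(\mathcal{I}/\mathfrak{p}\Lambda)$, and put $L=\rho^{-1}(\mathcal{C})$. Then: (i) If the fields are $p$-adic (finite extensions of $\mathbb{Q}_p$), then $L$ is a $\mathbb{Z}_p$-lattice in $S_f\cong\mathbb{Q}_p^N$, of rank $N=n^2m[\mathcal{O}_F:\mathbb{Z}_p]$. (ii) If $F_0=\mathbb{F}_q(\!(u)\!)$ is a field of Laurent series over a finite field, then $L$ is an $\mathbb{F}_q[\![u]\!]$-lattice in $S_f$, of rank $N=n^2m[\mathcal{O}_F:\mathbb{F}_q[\![u]\!]]$.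
   Context: $\mathcal{O}_E$ denotes the ring of integers of a local nonarchimedean field $E$. The cyclic algebra $(K/F,\tau,c)$ is $K\oplus Ke\oplus\dots\oplus Ke^{n-1}$ with $e^n=c$ and $ex=\tau(x)e$ for $x\in K$; $\mathcal{D}$ is the subring with coefficients in $\mathcal{O}_K$. Skew polynomials: for a unital associative ring $S$ and an injective ring endomorphism $\sigma$ of $S$, $S[t;\sigma]$ is the ring of polynomials $\sum a_it^i$ with $a_i\in S$, termwise addition, and multiplication determined by $ta=\sigma(a)t$. An element is irreducible if it is not a unit and is not a product $gh$ of two skew polynomials of strictly smaller degree. Petit algebras: let $f\in S[t;\sigma]$ be monic of degree $m$. Every $h\in S[t;\sigma]$ can be written uniquely as $h=qf+r$ with $\deg r<m$; write $r=h\bmod_r f$. The set of skew polynomials of degree less than $m$ with multiplication $g\circ h=(gh)\bmod_r f$ is a unital, in general nonassociative, ring, denoted $S[t;\sigma]/S[t;\sigma]f$. In particular $\Lambda$ is the subring of $S_f$ of elements with coefficients in $\mathcal{D}$; as a left $\mathcal{O}_K$-module it is free with basis $e^it^j$, $0\le i<n$, $0\le j<m$. Reduction: $\overline\sigma$ is the ring endomorphism of $\mathcal{D}/\mathfrak{p}\mathcal{D}$ induced by $\sigma$; for $g=\sum a_it^i\in\mathcal{D}[t;\sigma]$, $\overline g=\sum\overline{a_i}t^i$ with $\overline{a_i}=a_i+\mathfrak{p}\mathcal{D}$. The map $\Psi:\Lambda\to S_{\overline f}$, $g\mapsto\overline g$, is surjective with kernel $\mathfrak{p}\Lambda$ and induces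 an isomorphism $\Lambda/\mathfrak{p}\Lambda\cong S_{\overline f}$, also denoted $\Psi$. A left ideal of a nonassociative ring $\Lambda$ is an additive subgroup $\mathcal{I}$ with $\Lambda\mathcal{I}\subset\mathcal{I}$; a principal left ideal generated by $g\in\Lambda$ is a left ideal of the form $\Lambda g=\{h\circ g:h\in\Lambda\}$. The code $\mathcal{C}$ corresponding to $\Psi(\mathcal{I}/\mathfrak{p}\Lambda)$ is the set of coefficient vectors of the elements of $\Psi(\mathcal{I}/\mathfrak{p}\Lambda)$; under this identification $\rho^{-1}(\mathcal{C})$ is the set of $x\in\Lambda$ with $\rho(x)\in\Psi(\mathcal{I}/\mathfrak{p}\Lambda)$. Lattices: for an integral domain $R$ with quotient field $E$ and a finite-dimensional $E$-algebra $A$, an $R$-lattice in $A$ is a finitely generated $R$-submodule of $A$ containing an $E$-basis of $A$. For rings $R\subset R'$ with $R'$ free of finite rank over $R$, $[R':R]$ denotes that rank. *)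

theory Defs
  imports
    "HOL-Computational_Algebra.Formal_Laurent_Series"
    "HOL-Algebra.UnivPoly"
    "HOL-Algebra.Bij"
    "HOL-Algebra.Generated_Groups"
    "HOL-Algebra.Embedded_Algebras"
    "HOL-Algebra.Ideal_Product"
begin

section \<open>Valued fields\<close>

text \<open>
  Fields carry their absolute value, and subfields carry the restricted one.  Subfields are
  subsets \<open>F\<close> of \<^term>\<open>carrier K\<close>, turned into rings as \<open>K\<lparr>carrier := F\<rparr>\<close>.
\<close>

locale valued_field = field K for K :: "'a ring" (structure) +
  fixes nv :: "'a \<Rightarrow> real"
  assumes nv_nonneg: "x \<in> carrier K \<Longrightarrow> 0 \<le> nv x"
    and nv_eq_0_iff: "x \<in> carrier K \<Longrightarrow> nv x = 0 \<longleftrightarrow> x = \<zero>"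
    and nv_mult: "\<lbrakk>x \<in> carrier K; y \<in> carrier K\<rbrakk> \<Longrightarrow> nv (x \<otimes> y) = nv x * nv y"
    and nv_ultrametric: "\<lbrakk>x \<in> carrier K; y \<in> carrier K\<rbrakk> \<Longrightarrow> nv (x \<oplus> y) \<le> max (nv x) (nv y)"

definition complete_valued :: "'a ring \<Rightarrow> ('a \<Rightarrow> real) \<Rightarrow> bool" where
  "complete_valued K nv \<longleftrightarrow>
    (\<forall>s \<in> (UNIV :: nat set) \<rightarrow> carrier K.
      (\<forall>\<epsilon>>0. \<exists>M. \<forall>i\<ge>M. \<forall>j\<ge>M. nv (s i \<ominus>\<^bsub>K\<^esub> s j) < \<epsilon>) \<longrightarrow>
      (\<exists>l \<in> carrier K. (\<lambda>i. nv (s i \<ominus>\<^bsub>K\<^esub> l)) \<longlonglongrightarrow> 0))"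

definition integers_of :: "'a ring \<Rightarrow> ('a \<Rightarrow> real) \<Rightarrow> 'a set" where
  "integers_of K nv = {x \<in> carrier K. nv x \<le> 1}"

definition max_ideal_of :: "'a ring \<Rightarrow> ('a \<Rightarrow> real) \<Rightarrow> 'a set" where
  "max_ideal_of K nv = {x \<in> carrier K. nv x < 1}"

locale local_nonarch_field = valued_field +
  assumes discrete: "\<exists>\<pi> \<in> carrier K. 0 < nv \<pi> \<and> nv \<pi> < 1 \<and>
      (\<forall>x \<in> carrier K - {\<zero>}. \<exists>k :: int. nv x = nv \<pi> powi k)"
    and complete: "complete_valued K nv"
    and finite_residue_field:
      "finite (carrier (K\<lparr>carrier := integers_of K nv\<rparr> Quot max_ideal_of K nv))"

text \<open>
  Ramification index one.  Separability of the residue extension need not be required, since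
  the residue fields of the fields to which this is applied are finite.
\<close>

definition unramified :: "'a set \<Rightarrow> 'a ring \<Rightarrow> ('a \<Rightarrow> real) \<Rightarrow> bool" where
  "unramified F K nv \<longleftrightarrow>
    max_ideal_of K nv =
      Idl\<^bsub>K\<lparr>carrier := integers_of K nv\<rparr>\<^esub> (max_ideal_of (K\<lparr>carrier := F\<rparr>) nv)"


section \<open>Galois extensions\<close>

definition gal_group :: "'a set \<Rightarrow> 'a ring \<Rightarrow> ('a \<Rightarrow> 'a) monoid" where
  "gal_group F K = (BijGroup (carrier K))
     \<lparr>carrier := {\<phi> \<in> Bij (carrier K) \<inter> ring_hom K K. \<forall>x \<in> F. \<phi> x = x}\<rparr>"

definition galois_extension :: "'a set \<Rightarrow> 'a ring \<Rightarrow> bool" where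
  "galois_extension F K \<longleftrightarrow>
    subfield F K \<and> ring.finite_dimension K F (carrier K) \<and>
    {x \<in> carrier K. \<forall>\<phi> \<in> carrier (gal_group F K). \<phi> x = x} = F"


section \<open>The fields of p-adic numbers and of Laurent series\<close>

definition field_ring :: "'b::field ring" where
  "field_ring = \<lparr>carrier = UNIV, mult = (*), one = 1, zero = 0, add = (+)\<rparr>"

definition padic_abs :: "nat \<Rightarrow> rat \<Rightarrow> real" where
  "padic_abs p q = (if q = 0 then 0 else
     real p powi (int (multiplicity (int p) (snd (quotient_of q)))
                - int (multiplicity (int p) (fst (quotient_of q)))))"

text \<open>
  \<open>E\<close> is the completion of the rationals with respect to the p-adic absolute value, that is,
  \<open>E\<close> is (isomorphic to) the field of p-adic numbers.  The exponent \<open>s\<close> leaves the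
  normalisation of the absolute value of \<open>E\<close> free.
\<close>

definition padic_numbers :: "nat \<Rightarrow> 'a ring \<Rightarrow> ('a \<Rightarrow> real) \<Rightarrow> bool" where
  "padic_numbers p E nv \<longleftrightarrow>
    valued_field E nv \<and> complete_valued E nv \<and>
    (\<exists>\<iota> \<in> ring_hom (field_ring :: rat ring) E.
      (\<exists>s>0. \<forall>q. nv (\<iota> q) = padic_abs p q powr s) \<and>
      (\<forall>x \<in> carrier E. \<forall>\<epsilon>>0. \<exists>q. nv (x \<ominus>\<^bsub>E\<^esub> \<iota> q) < \<epsilon>))"

text \<open>An isomorphism onto the field of Laurent series over \<open>'q\<close>.\<close>

definition laurent_iso :: "'a ring \<Rightarrow> ('a \<Rightarrow> ('q::field) fls) \<Rightarrow> bool" where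
  "laurent_iso E \<phi> \<longleftrightarrow> \<phi> \<in> ring_iso E field_ring"

text \<open>The subring of \<open>E\<close> corresponding to the ring of formal power series.\<close>

definition power_series_in :: "'a ring \<Rightarrow> ('a \<Rightarrow> ('q::field) fls) \<Rightarrow> 'a set" where
  "power_series_in E \<phi> = {x \<in> carrier E. \<phi> x \<in> range fps_to_fls}"


section \<open>Cyclic algebras\<close>

text \<open>The element \<open>a\<close> as a constant sequence of coefficients, i.e. \<open>a e^0\<close> or \<open>a t^0\<close>.\<close>

definition const_seq :: "'a ring \<Rightarrow> 'a \<Rightarrow> nat \<Rightarrow> 'a" where
  "const_seq R a = (\<lambda>i. if i = 0 then a else \<zero>\<^bsub>R\<^esub>)"

text \<open>
  The element \<open>x\<close> stands for the sum of the \<open>x i e^i\<close>, \<open>i < n\<close>; coefficients beyond are zero.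
  Since \<open>c\<close> is fixed by \<open>\<tau>\<close>, the product of \<open>a e^i\<close> and \<open>b e^j\<close> is \<open>a (\<tau>^i b) e^(i+j)\<close>,
  where \<open>e^(i+j) = c e^(i+j-n)\<close> if \<open>i + j \<ge> n\<close>.
\<close>

definition cyclic_algebra ::
    "'a ring \<Rightarrow> nat \<Rightarrow> ('a \<Rightarrow> 'a) \<Rightarrow> 'a \<Rightarrow> (nat \<Rightarrow> 'a) ring" where
  "cyclic_algebra K n \<tau> c =
    \<lparr>carrier = {x \<in> UNIV \<rightarrow> carrier K. \<forall>i\<ge>n. x i = \<zero>\<^bsub>K\<^esub>},
     mult = (\<lambda>x y k. \<Oplus>\<^bsub>K\<^esub>i\<in>{..<n}. \<Oplus>\<^bsub>K\<^esub>j\<in>{..<n}.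
        if (i + j) mod n = k
        then x i \<otimes>\<^bsub>K\<^esub> (\<tau> ^^ i) (y j) \<otimes>\<^bsub>K\<^esub> (if i + j < n then \<one>\<^bsub>K\<^esub> else c)
        else \<zero>\<^bsub>K\<^esub>),
     one = const_seq K \<one>\<^bsub>K\<^esub>,
     zero = (\<lambda>i. \<zero>\<^bsub>K\<^esub>),
     add = (\<lambda>x y i. x i \<oplus>\<^bsub>K\<^esub> y i)\<rparr>"

definition natural_order :: "'a set \<Rightarrow> (nat \<Rightarrow> 'a) ring \<Rightarrow> (nat \<Rightarrow> 'a) ring" where
  "natural_order O\<^sub>K D = D\<lparr>carrier := {x \<in> carrier D. \<forall>i. x i \<in> O\<^sub>K}\<rparr>"

definition division_ring :: "'a ring \<Rightarrow> bool" where
  "division_ring D \<longleftrightarrow> ring D \<and> \<one>\<^bsub>D\<^esub> \<noteq> \<zero>\<^bsub>D\<^esub> \<and> carrier D - {\<zero>\<^bsub>D\<^esub>} \<subseteq> Units D"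


section \<open>Skew polynomials and Petit algebras\<close>

definition skew_poly :: "'a ring \<Rightarrow> ('a \<Rightarrow> 'a) \<Rightarrow> (nat \<Rightarrow> 'a) ring" where
  "skew_poly S \<sigma> =
    \<lparr>carrier = up S,
     mult = (\<lambda>g h k. \<Oplus>\<^bsub>S\<^esub>i\<in>{..k}. g i \<otimes>\<^bsub>S\<^esub> (\<sigma> ^^ i) (h (k - i))),
     one = const_seq S \<one>\<^bsub>S\<^esub>,
     zero = (\<lambda>i. \<zero>\<^bsub>S\<^esub>),
     add = (\<lambda>g h i. g i \<oplus>\<^bsub>S\<^esub> h i)\<rparr>"

definition monic :: "'a ring \<Rightarrow> (nat \<Rightarrow> 'a) \<Rightarrow> bool" where
  "monic S g \<longleftrightarrow> g \<in> up S \<and> g (deg S g) = \<one>\<^bsub>S\<^esub>"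

definition skew_irreducible :: "'a ring \<Rightarrow> ('a \<Rightarrow> 'a) \<Rightarrow> (nat \<Rightarrow> 'a) \<Rightarrow> bool" where
  "skew_irreducible S \<sigma> f \<longleftrightarrow>
    f \<in> carrier (skew_poly S \<sigma>) \<and> f \<notin> Units (skew_poly S \<sigma>) \<and>
    \<not> (\<exists>g \<in> carrier (skew_poly S \<sigma>). \<exists>h \<in> carrier (skew_poly S \<sigma>).
        deg S g < deg S f \<and> deg S h < deg S f \<and> f = g \<otimes>\<^bsub>skew_poly S \<sigma>\<^esub> h)"

definition deg_below :: "'a ring \<Rightarrow> nat \<Rightarrow> (nat \<Rightarrow> 'a) set" where
  "deg_below S m = {g \<in> up S. \<forall>i\<ge>m. g i = \<zero>\<^bsub>S\<^esub>}"

definition right_mod ::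
    "'a ring \<Rightarrow> ('a \<Rightarrow> 'a) \<Rightarrow> (nat \<Rightarrow> 'a) \<Rightarrow> (nat \<Rightarrow> 'a) \<Rightarrow> nat \<Rightarrow> 'a" where
  "right_mod S \<sigma> f h = (THE r. r \<in> deg_below S (deg S f) \<and>
     (\<exists>q \<in> carrier (skew_poly S \<sigma>).
        h = q \<otimes>\<^bsub>skew_poly S \<sigma>\<^esub> f \<oplus>\<^bsub>skew_poly S \<sigma>\<^esub> r))"

text \<open>
  The record type \<^typ>\<open>'a ring\<close> does not impose any laws, so it also serves for the
  nonassociative rings below, including the coset construction \<^const>\<open>FactRing\<close>.
\<close>

definition petit :: "'a ring \<Rightarrow> ('a \<Rightarrow> 'a) \<Rightarrow> (nat \<Rightarrow> 'a) \<Rightarrow> (nat \<Rightarrow> 'a) ring" where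
  "petit S \<sigma> f =
    \<lparr>carrier = deg_below S (deg S f),
     mult = (\<lambda>g h. right_mod S \<sigma> f (g \<otimes>\<^bsub>skew_poly S \<sigma>\<^esub> h)),
     one = \<one>\<^bsub>skew_poly S \<sigma>\<^esub>,
     zero = \<zero>\<^bsub>skew_poly S \<sigma>\<^esub>,
     add = add (skew_poly S \<sigma>)\<rparr>"

text \<open>The polynomial \<open>t^m - d\<close>.\<close>

definition binomial_poly :: "'a ring \<Rightarrow> nat \<Rightarrow> 'a \<Rightarrow> nat \<Rightarrow> 'a" where
  "binomial_poly S m d =
    (\<lambda>i. if i = m then \<one>\<^bsub>S\<^esub> else if i = 0 then \<ominus>\<^bsub>S\<^esub> d else \<zero>\<^bsub>S\<^esub>)"

definition left_ideal :: "'a ring \<Rightarrow> 'a set \<Rightarrow> bool" where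
  "left_ideal A I \<longleftrightarrow>
    additive_subgroup I A \<and> (\<forall>h \<in> carrier A. \<forall>x \<in> I. h \<otimes>\<^bsub>A\<^esub> x \<in> I)"

definition principal_left :: "'a ring \<Rightarrow> 'a \<Rightarrow> 'a set" where
  "principal_left A g = {h \<otimes>\<^bsub>A\<^esub> g | h. h \<in> carrier A}"


section \<open>Reduction\<close>

text \<open>The map on cosets of \<open>J\<close> induced by an endomorphism of \<open>R\<close>.\<close>

definition coset_map :: "'a ring \<Rightarrow> 'a set \<Rightarrow> ('a \<Rightarrow> 'a) \<Rightarrow> 'a set \<Rightarrow> 'a set" where
  "coset_map R J \<sigma> X = the_elem ((\<lambda>x. J +>\<^bsub>R\<^esub> \<sigma> x) ` X)"

definition reduce :: "'a ring \<Rightarrow> 'a set \<Rightarrow> (nat \<Rightarrow> 'a) \<Rightarrow> nat \<Rightarrow> 'a set" where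
  "reduce R J g = (\<lambda>i. J +>\<^bsub>R\<^esub> g i)"

text \<open>The value on a coset of a map that is constant on cosets.\<close>

definition on_coset :: "('a \<Rightarrow> 'b) \<Rightarrow> 'a set \<Rightarrow> 'b" where
  "on_coset h X = the_elem (h ` X)"

definition coeff_vector :: "nat \<Rightarrow> (nat \<Rightarrow> 'b) \<Rightarrow> 'b list" where
  "coeff_vector m h = map h [0..<m]"


section \<open>Lattices\<close>

text \<open>A ring \<open>A\<close> as a module over a ring that is mapped into it by \<open>\<iota>\<close>.\<close>

definition as_module :: "('e \<Rightarrow> 'a) \<Rightarrow> 'a ring \<Rightarrow> ('e, 'a) module" where
  "as_module \<iota> A =
    \<lparr>carrier = carrier A, mult = mult A, one = one A, zero = zero A, add = add A,
     smult = (\<lambda>a x. \<iota> a \<otimes>\<^bsub>A\<^esub> x)\<rparr>"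

definition module_span :: "'e ring \<Rightarrow> ('e, 'a) module \<Rightarrow> 'a set \<Rightarrow> 'a set" where
  "module_span R M B =
    {\<Oplus>\<^bsub>M\<^esub>b\<in>X. a b \<odot>\<^bsub>M\<^esub> b | a X. finite X \<and> X \<subseteq> B \<and> a \<in> X \<rightarrow> carrier R}"

definition module_indep :: "'e ring \<Rightarrow> ('e, 'a) module \<Rightarrow> 'a set \<Rightarrow> bool" where
  "module_indep R M B \<longleftrightarrow>
    (\<forall>a X. finite X \<and> X \<subseteq> B \<and> a \<in> X \<rightarrow> carrier R \<and>
        (\<Oplus>\<^bsub>M\<^esub>b\<in>X. a b \<odot>\<^bsub>M\<^esub> b) = \<zero>\<^bsub>M\<^esub> \<longrightarrow> (\<forall>b \<in> X. a b = \<zero>\<^bsub>R\<^esub>))"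

definition module_basis :: "'e ring \<Rightarrow> ('e, 'a) module \<Rightarrow> 'a set \<Rightarrow> bool" where
  "module_basis R M B \<longleftrightarrow>
    B \<subseteq> carrier M \<and> module_indep R M B \<and> module_span R M B = carrier M"

text \<open>\<open>M\<close> is isomorphic to \<open>R^N\<close> as an \<open>R\<close>-module.\<close>

definition free_of_rank :: "'e ring \<Rightarrow> ('e, 'a) module \<Rightarrow> nat \<Rightarrow> bool" where
  "free_of_rank R M N \<longleftrightarrow>
    (\<exists>\<phi>. bij_betw \<phi> (carrier M) ({..<N} \<rightarrow>\<^sub>E carrier R) \<and>
      (\<forall>x \<in> carrier M. \<forall>y \<in> carrier M. \<forall>i<N. \<phi> (x \<oplus>\<^bsub>M\<^esub> y) i = \<phi> x i \<oplus>\<^bsub>R\<^esub> \<phi> y i) \<and>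
      (\<forall>a \<in> carrier R. \<forall>x \<in> carrier M. \<forall>i<N. \<phi> (a \<odot>\<^bsub>M\<^esub> x) i = a \<otimes>\<^bsub>R\<^esub> \<phi> x i))"

definition module_rank :: "'e ring \<Rightarrow> ('e, 'a) module \<Rightarrow> nat" where
  "module_rank R M = (THE N. free_of_rank R M N)"

text \<open>\<open>R\<close> is a subring of \<open>E\<close>, with quotient field \<open>E\<close>, and \<open>A\<close> is an \<open>E\<close>-algebra.\<close>

definition is_lattice ::
    "'e ring \<Rightarrow> 'e ring \<Rightarrow> ('e, 'a) module \<Rightarrow> 'a set \<Rightarrow> bool" where
  "is_lattice R E A L \<longleftrightarrow>
    L \<subseteq> carrier A \<and> submodule L R A \<and>
    (\<exists>B. finite B \<and> B \<subseteq> L \<and> module_span R A B = L) \<and>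
    (\<exists>B. B \<subseteq> L \<and> module_basis E A B)"

end

(*
  The code C determines the ideal I up to p Lambda, and p Lambda is contained in I, so L consists of
  integral elements, is closed under the action of the integers of F_0, and contains all elements of
  S_f whose coefficients are small enough.  Over a complete valuation ring R with quotient field E
  such a set L is a lattice: the integers of K are totally bounded, so L is generated by finitely
  many elements modulo a multiple of itself, hence generated by them (successive approximation), and
  a minimal generating set is a basis.  This basis of L over R is also a basis of S_f over E, so its
  length is dim_E S_f = m n [K:F] [F:E], and [F:E] is the rank of O_F by the same argument.

  That tau preserves the integers of K, and that an abstract isomorphism of F_0 with a field of
  Laurent series matches the integers of F_0 with the power series, holds because an isomorphism
  between complete discretely valued fields automatically respects the valuations.
*)
theory Submission
  imports Defs
begin

section \<open>Valued fields\<close>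

text \<open>Multiplication in \<open>S\<^sub>f\<close> need not be associative, so its module
  structure is checked on coefficients: left multiplication by \<open>\<kappa> a\<close> acts
  entrywise on the m by n array of coefficients in K, and the largest absolute value of an entry
  serves as a norm. A left ideal containing \<open>\<kappa> a\<close> contains the products of y
  with \<open>\<kappa> a\<close> on the right, the wrong side for a scalar. For a in F_0 the factor
  can be moved to the left, since \<tau> fixes F and \<sigma> fixes F_0 pointwise; this puts the
  small elements into the ideal, and it is why the lattices are taken over subfields of F_0. The
  lattice argument works with two bounds, coordinates at most one on L and a ball inside L, and so
  covers O_F in F as well as L in \<open>S\<^sub>f\<close>. A generating set shrinks to a basis
  because over a valuation ring one coefficient of each relation divides the others. The absolute
  value is recovered from the ring structure by the equation y^2 + y = z: the derivative 2y + 1 is a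
  unit for |y| < 1 in every residue characteristic, so the equation is solvable for all z in the
  open unit disc.\<close>

context valued_field
begin

section \<open>Elementary properties of ultrametric absolute values\<close>

lemma nv_zero [simp]: "nv \<zero> = 0"
  by (simp add: nv_eq_0_iff)

lemma nv_pos: "\<lbrakk>x \<in> carrier K; x \<noteq> \<zero>\<rbrakk> \<Longrightarrow> 0 < nv x"
  using nv_nonneg nv_eq_0_iff by fastforce

lemma nv_one [simp]: "nv \<one> = 1"
  using nv_mult[of \<one> \<one>] nv_eq_0_iff[of \<one>] by simp

text \<open>The absolute value of -1 is nonnegative and squares to one, hence equals one.\<close>

lemma nv_minus: assumes "x \<in> carrier K" shows "nv (\<ominus> x) = nv x"
proof -
  have "nv (\<ominus> \<one>) * nv (\<ominus> \<one>) = 1"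
    using nv_mult[of "\<ominus> \<one>" "\<ominus> \<one>"] by (simp add: l_minus)
  then have "nv (\<ominus> \<one>) = 1"
    using nv_nonneg[of "\<ominus> \<one>"] square_eq_1_iff[of "nv (\<ominus> \<one>)"] by simp
  then show ?thesis
    using nv_mult[of "\<ominus> \<one>" x] assms by (simp add: l_minus)
qed

lemma nv_diff: "\<lbrakk>x \<in> carrier K; y \<in> carrier K\<rbrakk> \<Longrightarrow> nv (x \<ominus> y) \<le> max (nv x) (nv y)"
  using nv_ultrametric[of x "\<ominus> y"] by (simp add: a_minus_def nv_minus)

lemma nv_diff_commute: "\<lbrakk>x \<in> carrier K; y \<in> carrier K\<rbrakk> \<Longrightarrow> nv (x \<ominus> y) = nv (y \<ominus> x)"
  using nv_minus[of "x \<ominus> y"] by (simp add: a_minus_def minus_add a_comm)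

lemma nv_triangle:
  assumes "x \<in> carrier K" "y \<in> carrier K" "z \<in> carrier K"
  shows "nv (x \<ominus> z) \<le> max (nv (x \<ominus> y)) (nv (y \<ominus> z))"
proof -
  have "x \<ominus> z = (x \<ominus> y) \<oplus> (y \<ominus> z)"
    using assms by algebra
  then show ?thesis
    using nv_ultrametric[of "x \<ominus> y" "y \<ominus> z"] assms by simp
qed

lemma nv_pow: "x \<in> carrier K \<Longrightarrow> nv (x [^] (k::nat)) = nv x ^ k"
  by (induction k) (simp_all add: nv_mult)

lemma nonzero_inv:
  assumes "x \<in> carrier K" "x \<noteq> \<zero>"
  shows "inv x \<in> carrier K" "x \<otimes> inv x = \<one>" "inv x \<otimes> x = \<one>" "inv x \<noteq> \<zero>"
proof -
  have "x \<in> Units K" using assms field_Units by blast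
  then show "inv x \<in> carrier K" "x \<otimes> inv x = \<one>" "inv x \<otimes> x = \<one>" by auto
  then show "inv x \<noteq> \<zero>" using assms by force
qed

lemma nv_inv:
  assumes "x \<in> carrier K" "x \<noteq> \<zero>"
  shows "nv (inv x) = inverse (nv x)"
  using nv_mult[of x "inv x"] nonzero_inv[OF assms] assms
  by (simp add: inverse_unique)

lemma nv_finsum_le:
  assumes "finite A" "f \<in> A \<rightarrow> carrier K" "\<And>i. i \<in> A \<Longrightarrow> nv (f i) \<le> B" "0 \<le> B"
  shows "nv (\<Oplus>i\<in>A. f i) \<le> B"
  using assms
proof (induction A rule: finite_induct)
  case (insert x A)
  then have "nv (\<Oplus>i\<in>A. f i) \<le> B" by auto
  moreover have "(\<Oplus>i\<in>A. f i) \<in> carrier K" using insert by (intro finsum_closed) auto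
  moreover have "(\<Oplus>i\<in>insert x A. f i) = f x \<oplus> (\<Oplus>i\<in>A. f i)"
    using insert by (intro finsum_insert) auto
  ultimately show ?case
    using nv_ultrametric[of "f x" "\<Oplus>i\<in>A. f i"] insert by force
qed simp

text \<open>An arbitrary subring \<open>E\<close> is allowed because the rings of integers of
  several subfields of \<open>K\<close> occur side by side: that of the base field of the lattice
  and that of \<open>F\<close>.\<close>

lemma integers_subring:
  assumes "subring E K"
  shows "subring {x \<in> E. nv x \<le> 1} K"
proof (rule subringI)
  note E = subringE[OF assms]
  show "{x \<in> E. nv x \<le> 1} \<subseteq> carrier K" "\<one> \<in> {x \<in> E. nv x \<le> 1}" using E by auto
  fix x assume x: "x \<in> {x \<in> E. nv x \<le> 1}"
  then show "\<ominus> x \<in> {x \<in> E. nv x \<le> 1}" using E nv_minus by auto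
  fix y assume y: "y \<in> {x \<in> E. nv x \<le> 1}"
  show "x \<otimes> y \<in> {x \<in> E. nv x \<le> 1}"
    using x y E nv_mult[of x y] nv_nonneg[of x] nv_nonneg[of y] mult_le_one[of "nv x" "nv y"]
    by (simp add: subset_iff)
  show "x \<oplus> y \<in> {x \<in> E. nv x \<le> 1}"
    using x y E nv_ultrametric[of x y] by fastforce
qed

text \<open>Negation is defined by a description over the carrier, so the two differences agree only
  because \<open>E\<close> is closed under negatives. This allows completeness of a subfield to be
  used with the operations of \<open>K\<close>.\<close>

lemma subring_minus:
  assumes "subring E K" "x \<in> E" "y \<in> E"
  shows "x \<ominus>\<^bsub>K\<lparr>carrier := E\<rparr>\<^esub> y = x \<ominus> y"
proof -
  have "subgroup E (add_monoid K)" using assms(1) by (simp add: subring_def)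
  from add.m_inv_consistent[OF this assms(3)] show ?thesis
    by (simp add: a_minus_def a_inv_def)
qed

text \<open>By the ultrametric inequality all terms from the k-th on stay within q^k of it, so the
  limit does too; no geometric series has to be summed.\<close>

lemma geometric_limit:
  assumes E: "subring E K" "complete_valued (K\<lparr>carrier := E\<rparr>) nv"
    and s: "\<And>k. s k \<in> E" and q: "0 \<le> q" "q < 1"
    and step: "\<And>k. nv (s (Suc k) \<ominus> s k) \<le> q ^ k"
  shows "\<exists>l \<in> E. \<forall>k. nv (l \<ominus> s k) \<le> q ^ k"
proof -
  have EK: "E \<subseteq> carrier K" using subringE(1)[OF E(1)] .
  then have sK: "s k \<in> carrier K" for k using s by blast
  have far: "nv (s (k + d) \<ominus> s k) \<le> q ^ k" for k d
  proof (induction d)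
    case 0
    then show ?case using sK q by (simp add: a_minus_def r_neg)
  next
    case (Suc d)
    have "nv (s (Suc (k + d)) \<ominus> s (k + d)) \<le> q ^ k"
      using step[of "k + d"] q power_decreasing[of k "k + d" q] by simp
    then show ?case
      using nv_triangle[of "s (Suc (k + d))" "s (k + d)" "s k"] Suc sK by simp
  qed
  then have far': "nv (s i \<ominus> s k) \<le> q ^ k" if "k \<le> i" for i k
    using that by (metis le_add_diff_inverse)
  have near: "nv (s i \<ominus> s j) \<le> q ^ M" if "M \<le> i" "M \<le> j" for i j M
    using nv_triangle[of "s i" "s M" "s j"] far'[OF that(1)] far'[OF that(2)]
      nv_diff_commute[of "s M" "s j"] sK by simp
  have cauchy: "\<exists>M. \<forall>i\<ge>M. \<forall>j\<ge>M. nv (s i \<ominus>\<^bsub>K\<lparr>carrier := E\<rparr>\<^esub> s j) < \<epsilon>" if eps: "0 < \<epsilon>" for \<epsilon>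
  proof -
    obtain M where "q ^ M < \<epsilon>" using real_arch_pow_inv[OF eps q(2)] by blast
    then show ?thesis
      using near subring_minus[OF E(1) s s] by (metis order.strict_trans1)
  qed
  have "s \<in> (UNIV :: nat set) \<rightarrow> carrier (K\<lparr>carrier := E\<rparr>)" using s by simp
  with E(2) cauchy obtain l where l: "l \<in> E"
      "(\<lambda>i. nv (s i \<ominus>\<^bsub>K\<lparr>carrier := E\<rparr>\<^esub> l)) \<longlonglongrightarrow> 0"
    unfolding complete_valued_def by fastforce
  then have lim: "(\<lambda>i. nv (s i \<ominus> l)) \<longlonglongrightarrow> 0" using subring_minus[OF E(1) s l(1)] by simp
  have "nv (l \<ominus> s k) \<le> q ^ k" for k
  proof (rule ccontr)
    \<comment> \<open>A late term would be closer to \<open>l\<close> than \<open>s k\<close> is,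
      while lying within q^k of \<open>s k\<close>; the ultrametric inequality excludes
      this.\<close>
    assume neg: "\<not> nv (l \<ominus> s k) \<le> q ^ k"
    then have "0 < nv (l \<ominus> s k)" using zero_le_power[OF q(1), of k] by linarith
    then have "\<forall>\<^sub>F i in sequentially. nv (s i \<ominus> l) < nv (l \<ominus> s k)"
      using lim order_tendstoD(2) by blast
    then obtain i where i: "i \<ge> k" "nv (s i \<ominus> l) < nv (l \<ominus> s k)"
      unfolding eventually_sequentially by (meson nat_le_linear)
    then show False
      using nv_triangle[of l "s i" "s k"] far'[OF i(1)] neg nv_diff_commute[of l "s i"] sK EK l(1)
      by fastforce
  qed
  then show ?thesis using l(1) by blast
qed

section \<open>Recovering the unit ball from the ring structure\<close>

lemma solve_artin_schreier:
  assumes "complete_valued K nv" "z \<in> carrier K" "nv z < 1"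
  shows "\<exists>y \<in> carrier K. y \<otimes> y \<oplus> y = z"
proof -
  \<comment> \<open>Iterates from zero of the map taking y to z - y^2, whose fixed points are the
    solutions. On the disc of radius |z| this map contracts distances by the factor |z|.\<close>
  define s where "s k = ((\<lambda>y. z \<ominus> y \<otimes> y) ^^ k) \<zero>" for k
  have s0: "s 0 = \<zero>" and sSuc: "s (Suc k) = z \<ominus> s k \<otimes> s k" for k
    by (simp_all add: s_def)
  have sK: "s k \<in> carrier K" for k
    by (induction k) (simp_all add: s0 sSuc assms)
  define q where "q = nv z"
  have q: "0 \<le> q" "q < 1" using assms nv_nonneg by (simp_all add: q_def)
  have sle: "nv (s k) \<le> q" for k
  proof (induction k)
    case (Suc k)
    have "nv (s k \<otimes> s k) \<le> q"
      using nv_mult[of "s k" "s k"] sK[of k] Suc q nv_nonneg[OF sK[of k]]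
        mult_left_le_one_le[of q "nv (s k)"] mult_mono[of "nv (s k)" "nv (s k)" q q]
      by (smt (verit) mult_left_le)
    then show ?case using nv_diff[of z "s k \<otimes> s k"] assms sK[of k] by (simp add: sSuc q_def)
  qed (simp add: s0 q)
  have step: "nv (s (Suc k) \<ominus> s k) \<le> q ^ k" for k
  proof (induction k)
    case 0
    then show ?case using s0 sle[of "Suc 0"] q nv_diff[of "s (Suc 0)" "\<zero>"] sK[of "Suc 0"] by (simp del: sSuc)
  next
    case (Suc k)
    \<comment> \<open>A difference of squares: the factor \<open>s k \<oplus> s (Suc k)\<close> has
      absolute value at most q and provides the contraction.\<close>
    have "s (Suc (Suc k)) \<ominus> s (Suc k) = (z \<ominus> s (Suc k) \<otimes> s (Suc k)) \<ominus> (z \<ominus> s k \<otimes> s k)"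
      by (simp only: sSuc)
    also have "\<dots> = (s k \<ominus> s (Suc k)) \<otimes> (s k \<oplus> s (Suc k))"
      using assms(2) sK[of k] sK[of "Suc k"] by algebra
    finally have "nv (s (Suc (Suc k)) \<ominus> s (Suc k)) = nv (s (Suc k) \<ominus> s k) * nv (s k \<oplus> s (Suc k))"
      using sK[of k] sK[of "Suc k"] nv_diff_commute[of "s k" "s (Suc k)"] by (simp add: nv_mult)
    also have "\<dots> \<le> q ^ k * q"
      using Suc nv_ultrametric[of "s k" "s (Suc k)"] sK sle[of k] sle[of "Suc k"] q
      by (intro mult_mono) (auto intro: nv_nonneg order_trans)
    finally show ?case by (simp add: mult.commute)
  qed
  obtain y where y: "y \<in> carrier K" "\<And>k. nv (y \<ominus> s k) \<le> q ^ k"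
    using geometric_limit[OF carrier_is_subring _ sK q step] assms(1) by auto
  have small: "nv (y \<otimes> y \<oplus> y \<ominus> z) \<le> q ^ k" for k
  proof -
    have yle: "nv (y \<oplus> s k) \<le> 1"
    proof -
      \<comment> \<open>The limit is controlled through its distance to the iterates, which are
        themselves small.\<close>
      have "y \<oplus> s k = (y \<ominus> s k) \<oplus> (s k \<oplus> s k)" using y(1) sK[of k] by algebra
      then have "nv (y \<oplus> s k) \<le> max (nv (y \<ominus> s k)) (nv (s k \<oplus> s k))"
        using nv_ultrametric[of "y \<ominus> s k" "s k \<oplus> s k"] y(1) sK[of k] by simp
      moreover have "nv (y \<ominus> s k) \<le> 1" using y(2)[of k] q power_le_one[of q k] by linarith
      moreover have "nv (s k \<oplus> s k) \<le> 1"
        using nv_ultrametric[of "s k" "s k"] sK[of k] sle[of k] q by simp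
      ultimately show ?thesis by simp
    qed
    \<comment> \<open>Replacing y^2 by the square of \<open>s k\<close> costs the product of y - s_k
      and y + s_k; what remains is the distance from y to the next iterate.\<close>
    have "y \<otimes> y \<oplus> y \<ominus> z = (y \<ominus> (z \<ominus> s k \<otimes> s k)) \<oplus> (y \<ominus> s k) \<otimes> (y \<oplus> s k)"
      using y(1) sK[of k] assms(2) by algebra
    then have "y \<otimes> y \<oplus> y \<ominus> z = (y \<ominus> s (Suc k)) \<oplus> (y \<ominus> s k) \<otimes> (y \<oplus> s k)"
      by (simp only: sSuc)
    then have "nv (y \<otimes> y \<oplus> y \<ominus> z) \<le> max (nv (y \<ominus> s (Suc k))) (nv (y \<ominus> s k) * nv (y \<oplus> s k))"
      using nv_ultrametric[of "y \<ominus> s (Suc k)" "(y \<ominus> s k) \<otimes> (y \<oplus> s k)"]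
        nv_mult[of "y \<ominus> s k" "y \<oplus> s k"] y(1) sK by simp
    moreover have "nv (y \<ominus> s (Suc k)) \<le> q ^ k"
      using y(2)[of "Suc k"] q power_decreasing[of k "Suc k" q] by linarith
    moreover have "nv (y \<ominus> s k) * nv (y \<oplus> s k) \<le> q ^ k * 1"
      using y sK[of k] yle q by (intro mult_mono) (auto intro: nv_nonneg)
    ultimately show ?thesis by simp
  qed
  have "nv (y \<otimes> y \<oplus> y \<ominus> z) = 0"
  proof (rule ccontr)
    assume "nv (y \<otimes> y \<oplus> y \<ominus> z) \<noteq> 0"
    then have "0 < nv (y \<otimes> y \<oplus> y \<ominus> z)" using nv_nonneg[of "y \<otimes> y \<oplus> y \<ominus> z"] y assms by simp
    then obtain k where "q ^ k < nv (y \<otimes> y \<oplus> y \<ominus> z)" using real_arch_pow_inv q(2) by blast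
    then show False using small[of k] by simp
  qed
  then have "y \<otimes> y \<oplus> y = z" using nv_eq_0_iff[of "y \<otimes> y \<oplus> y \<ominus> z"] y assms r_right_minus_eq by simp
  then show ?thesis using y by blast
qed

text \<open>A value above one forces |y| > 1, and then the square strictly dominates the linear
  term.\<close>

lemma artin_schreier_square_value:
  assumes "y \<in> carrier K" "1 < nv (y \<otimes> y \<oplus> y)"
  shows "nv (y \<otimes> y \<oplus> y) = (nv y)\<^sup>2"
proof -
  have y1: "1 < nv y"
  proof (rule ccontr)
    assume "\<not> 1 < nv y"
    then have "nv (y \<otimes> y) \<le> 1" using nv_mult[of y y] nv_nonneg[of y] assms(1) mult_le_one[of "nv y" "nv y"] by simp
    then show False using nv_ultrametric[of "y \<otimes> y" y] assms \<open>\<not> 1 < nv y\<close> by simp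
  qed
  then have lt: "nv y < nv (y \<otimes> y)" using nv_mult[of y y] assms(1) by simp
  have "y \<otimes> y = (y \<otimes> y \<oplus> y) \<ominus> y" using assms(1) by algebra
  then have "nv (y \<otimes> y) \<le> max (nv (y \<otimes> y \<oplus> y)) (nv y)"
    using nv_diff[of "y \<otimes> y \<oplus> y" y] assms(1) by simp
  moreover have "nv (y \<otimes> y \<oplus> y) \<le> max (nv (y \<otimes> y)) (nv y)"
    using nv_ultrametric[of "y \<otimes> y" y] assms(1) by simp
  ultimately show ?thesis using lt nv_mult[of y y] assms(1) by (simp add: power2_eq_square)
qed

end

text \<open>Supplies the exponent for the comparison of two absolute values: a factor that is small
  for one of them and large for the other outweighs fixed constants when raised to a high power. The
  exponent is even so that it does not change the parity of an order.\<close>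

lemma even_power_separates:
  fixes a b c B :: real
  assumes "0 \<le> a" "a < 1" "1 < B" "0 \<le> b" "0 < c"
  shows "\<exists>i. b * a ^ (2 * i) < 1 \<and> 1 < c * B ^ (2 * i)"
proof -
  \<comment> \<open>With b + 1 in place of b the threshold is defined for b = 0, and b / (b + 1) is
    still below one.\<close>
  obtain j where j: "a ^ j < 1 / (b + 1)"
    using real_arch_pow_inv[of "1 / (b + 1)" a] assms by auto
  obtain k where k: "inverse c < B ^ k"
    using real_arch_pow assms by blast
  define i where "i = max j k"
  have "a ^ (2 * i) \<le> a ^ j"
    using assms by (intro power_decreasing) (auto simp: i_def)
  then have "b * a ^ (2 * i) \<le> b * (1 / (b + 1))"
    using j assms by (intro mult_left_mono) auto
  also have "\<dots> < 1" using assms by (simp add: divide_simps)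
  finally have 1: "b * a ^ (2 * i) < 1" .
  have "B ^ k \<le> B ^ (2 * i)"
    using assms by (intro power_increasing) (auto simp: i_def)
  then have "inverse c < B ^ (2 * i)" using k by simp
  then have "c * inverse c < c * B ^ (2 * i)" using assms by (intro mult_strict_left_mono) auto
  then show ?thesis using 1 assms by auto
qed

text \<open>
  Elements \<open>z\<close> with \<open>|z| < 1\<close> have the form \<open>y\<^sup>2 + y\<close>.  If \<open>\<psi>\<close> mapped one of them to an element of
  absolute value greater than one, then it would map one to an element of odd negative order; but
  \<open>y\<^sup>2 + y\<close> has even order if its order is negative.
\<close>

lemma iso_maps_integers_to_integers:
  assumes K: "valued_field K nv" "complete_valued K nv"
    and nontriv: "t \<in> carrier K" "0 < nv t" "nv t < 1"
    and K': "valued_field K' nv'"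
    and pi: "\<pi> \<in> carrier K'" "0 < nv' \<pi>" "nv' \<pi> < 1"
      "\<And>x. x \<in> carrier K' \<Longrightarrow> x \<noteq> \<zero>\<^bsub>K'\<^esub> \<Longrightarrow> \<exists>k::int. nv' x = nv' \<pi> powi k"
    and psi: "\<psi> \<in> ring_hom K K'" "\<psi> ` carrier K = carrier K'"
    and x: "x \<in> carrier K" "nv x \<le> 1"
  shows "nv' (\<psi> x) \<le> 1"
proof -
  interpret K: valued_field K nv by fact
  interpret K': valued_field K' nv' by fact
  interpret hom: ring_hom_ring K K' \<psi>
    by (rule ring_hom_ringI2[OF K.ring_axioms K'.ring_axioms psi(1)])
  have square: "\<exists>y \<in> carrier K'. nv' (\<psi> z) = (nv' y)\<^sup>2"
    if z: "z \<in> carrier K" "nv z < 1" "1 < nv' (\<psi> z)" for z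
  proof -
    obtain y where "y \<in> carrier K" "y \<otimes>\<^bsub>K\<^esub> y \<oplus>\<^bsub>K\<^esub> y = z"
      using K.solve_artin_schreier[OF K(2) z(1,2)] by blast
    then have "\<psi> z = \<psi> y \<otimes>\<^bsub>K'\<^esub> \<psi> y \<oplus>\<^bsub>K'\<^esub> \<psi> y" "\<psi> y \<in> carrier K'"
      using hom.hom_add[of "y \<otimes>\<^bsub>K\<^esub> y" y] hom.hom_mult[of y y] by auto
    then show ?thesis
      using K'.artin_schreier_square_value[of "\<psi> y"] z(3) by metis
  qed
  have small: "nv' (\<psi> z) \<le> 1" if z: "z \<in> carrier K" "nv z < 1" for z
  proof (rule ccontr)
    assume "\<not> nv' (\<psi> z) \<le> 1"
    then have gt: "1 < nv' (\<psi> z)" by simp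
    obtain p where p: "p \<in> carrier K" "\<psi> p = \<pi>" using psi(2) pi(1) by (metis imageE)
    have z0: "0 \<le> nv z" using z K.nv_nonneg by simp
    obtain i where i: "nv p * nv z ^ (2 * i) < 1" "1 < nv' \<pi> * nv' (\<psi> z) ^ (2 * i)"
      using even_power_separates[OF z0 z(2) gt K.nv_nonneg[OF p(1)] pi(2)] by blast
    \<comment> \<open>Since \<open>p\<close> is the preimage of a uniformizer and 2i is even, the
      image of \<open>w\<close> has odd order; yet |w| < 1 makes \<open>w\<close> of the form y^2 +
      y, which forces an even order on an image of absolute value above one.\<close>
    define w where "w = p \<otimes>\<^bsub>K\<^esub> z [^]\<^bsub>K\<^esub> (2 * i)"
    have wK: "w \<in> carrier K" using p z by (simp add: w_def)
    have w1: "nv w < 1"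
      using p z i(1) by (simp add: w_def K.nv_mult K.nv_pow)
    have psiw: "\<psi> w = \<pi> \<otimes>\<^bsub>K'\<^esub> \<psi> z [^]\<^bsub>K'\<^esub> (2 * i)"
      using p z by (simp add: w_def hom.hom_nat_pow)
    have psiz: "\<psi> z \<in> carrier K'" "\<psi> z \<noteq> \<zero>\<^bsub>K'\<^esub>" using z gt by auto
    have nvw: "nv' (\<psi> w) = nv' \<pi> * nv' (\<psi> z) ^ (2 * i)"
      using psiz pi(1) by (simp add: psiw K'.nv_mult K'.nv_pow)
    then have "1 < nv' (\<psi> w)" using i(2) by simp
    then obtain y where y: "y \<in> carrier K'" "nv' (\<psi> w) = (nv' y)\<^sup>2" using square wK w1 by blast
    \<comment> \<open>Dividing by the i-th power of \<open>\<psi> z\<close> cancels the even part,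
      so |u|^2 = |\<pi>|. This is impossible, as |\<pi>| generates the value group.\<close>
    define u where "u = y \<otimes>\<^bsub>K'\<^esub> inv\<^bsub>K'\<^esub> (\<psi> z [^]\<^bsub>K'\<^esub> i)"
    have pz: "\<psi> z [^]\<^bsub>K'\<^esub> i \<in> carrier K'" "\<psi> z [^]\<^bsub>K'\<^esub> i \<noteq> \<zero>\<^bsub>K'\<^esub>"
      using psiz K'.nv_pow[of "\<psi> z" i] gt by (auto simp flip: K'.nv_eq_0_iff)
    have uK: "u \<in> carrier K'" using y K'.nonzero_inv[OF pz] by (simp add: u_def)
    have "nv' u = nv' y * inverse (nv' (\<psi> z) ^ i)"
      using y pz psiz K'.nonzero_inv[OF pz] by (simp add: u_def K'.nv_mult K'.nv_inv K'.nv_pow)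
    then have "nv' u * nv' (\<psi> z) ^ i = nv' y" using gt by simp
    then have "(nv' u)^2 * nv' (\<psi> z) ^ (2 * i) = (nv' y)^2"
      by (metis power_mult_distrib power_mult mult.commute)
    then have "(nv' u)^2 = nv' \<pi>"
      using y(2) nvw gt mult_right_cancel[of "nv' (\<psi> z) ^ (2 * i)" "(nv' u)^2" "nv' \<pi>"] by simp
    moreover have "u \<noteq> \<zero>\<^bsub>K'\<^esub>" using calculation pi(2) by auto
    then obtain k :: int where "nv' u = nv' \<pi> powi k" using pi(4) uK by blast
    ultimately have "nv' \<pi> powi (2 * k) = nv' \<pi> powi 1"
      by (simp add: power_int_mult mult.commute[of 2])
    then have "ln (nv' \<pi> powi (2 * k)) = ln (nv' \<pi> powi 1)" by simp
    then have "real_of_int (2 * k) * ln (nv' \<pi>) = ln (nv' \<pi>)"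
      using pi(2) by (simp flip: powr_real_of_int' add: ln_powr)
    moreover have "ln (nv' \<pi>) \<noteq> 0" using pi(2,3) by simp
    ultimately have "real_of_int (2 * k) = 1" by simp
    then have "2 * k = 1" by linarith
    then show False by presburger
  qed
  \<comment> \<open>Passage from the open to the closed disc: the elements t x^j all lie in the open
    disc, but their images would be unbounded if the image of \<open>x\<close> had absolute value
    above one.\<close>
  show ?thesis
  proof (rule ccontr)
    assume "\<not> nv' (\<psi> x) \<le> 1"
    then have gt: "1 < nv' (\<psi> x)" by simp
    have "\<psi> t \<noteq> \<zero>\<^bsub>K'\<^esub>"
    proof
      assume "\<psi> t = \<zero>\<^bsub>K'\<^esub>"
      moreover have "t \<otimes>\<^bsub>K\<^esub> inv\<^bsub>K\<^esub> t = \<one>\<^bsub>K\<^esub>" "inv\<^bsub>K\<^esub> t \<in> carrier K"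
        using K.nonzero_inv[of t] nontriv K.nv_zero by (metis less_irrefl)+
      ultimately show False using nontriv(1) hom.hom_mult[of t "inv\<^bsub>K\<^esub> t"] K'.one_not_zero by simp
    qed
    then have pos: "0 < nv' (\<psi> t)" using K'.nv_pos nontriv by simp
    obtain j where j: "inverse (nv' (\<psi> t)) < nv' (\<psi> x) ^ j" using real_arch_pow gt by blast
    define z where "z = t \<otimes>\<^bsub>K\<^esub> x [^]\<^bsub>K\<^esub> j"
    have "nv x ^ j \<le> 1" using x K.nv_nonneg power_le_one by blast
    then have "nv t * nv x ^ j \<le> nv t * 1"
      using nontriv(2) by (intro mult_left_mono) auto
    then have "nv t * nv x ^ j < 1" using nontriv(3) by linarith
    then have "nv z < 1"
      using x nontriv by (simp add: z_def K.nv_mult K.nv_pow)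
    moreover have "z \<in> carrier K" using x nontriv by (simp add: z_def)
    ultimately have "nv' (\<psi> z) \<le> 1" using small by blast
    moreover have "nv' (\<psi> z) = nv' (\<psi> t) * nv' (\<psi> x) ^ j"
      using x nontriv by (simp add: z_def hom.hom_nat_pow K'.nv_mult K'.nv_pow)
    ultimately show False using j pos by (simp add: field_simps)
  qed
qed

text \<open>An integer has a \<pi>-adic expansion with digits in a finite set of representatives of
  the residue field, and its first k digits determine it up to |\<pi>|^k.\<close>

lemma (in local_nonarch_field) integers_totally_bounded:
  assumes "0 < \<epsilon>"
  shows "\<exists>T. finite T \<and> T \<subseteq> carrier K \<and>
    (\<forall>x \<in> carrier K. nv x \<le> 1 \<longrightarrow> (\<exists>t \<in> T. nv (x \<ominus> t) < \<epsilon>))"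
proof -
  let ?O = "integers_of K nv" and ?m = "max_ideal_of K nv"
  let ?OK = "K\<lparr>carrier := ?O\<rparr>"
  have "finite ((\<lambda>x. ?m +>\<^bsub>?OK\<^esub> x) ` ?O)"
  proof (rule finite_subset[OF _ finite_residue_field])
    show "(\<lambda>x. ?m +>\<^bsub>?OK\<^esub> x) ` ?O \<subseteq> carrier (?OK Quot ?m)"
      by (auto simp: FactRing_def A_RCOSETS_def')
  qed
  then obtain T where T: "T \<subseteq> ?O" "finite T"
      "(\<lambda>x. ?m +>\<^bsub>?OK\<^esub> x) ` ?O = (\<lambda>x. ?m +>\<^bsub>?OK\<^esub> x) ` T"
    using finite_subset_image[of "(\<lambda>x. ?m +>\<^bsub>?OK\<^esub> x) ` ?O" "\<lambda>x. ?m +>\<^bsub>?OK\<^esub> x" ?O] by auto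
  have base: "\<exists>t \<in> T. nv (x \<ominus> t) < 1" if x: "x \<in> carrier K" "nv x \<le> 1" for x
  proof -
    have "?m +>\<^bsub>?OK\<^esub> x \<in> (\<lambda>x. ?m +>\<^bsub>?OK\<^esub> x) ` T"
      using T(3) x by (auto simp: integers_of_def)
    then obtain t where t: "t \<in> T" "?m +>\<^bsub>?OK\<^esub> x = ?m +>\<^bsub>?OK\<^esub> t" by blast
    have "x \<in> ?m +>\<^bsub>?OK\<^esub> x"
      using x by (auto simp: a_r_coset_def' max_ideal_of_def intro!: bexI[of _ \<zero>])
    then obtain h where h: "h \<in> ?m" "x = h \<oplus> t"
      unfolding t(2) by (auto simp: a_r_coset_def')
    have "t \<in> carrier K" using t T by (auto simp: integers_of_def)
    moreover have "h \<in> carrier K" "nv h < 1" using h by (auto simp: max_ideal_of_def)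
    moreover have "(h \<oplus> t) \<ominus> t = h" using calculation by algebra
    ultimately show ?thesis using t(1) h(2) by metis
  qed
  obtain \<pi> where pi: "\<pi> \<in> carrier K" "0 < nv \<pi>" "nv \<pi> < 1"
      "\<And>x. x \<in> carrier K - {\<zero>} \<Longrightarrow> \<exists>k :: int. nv x = nv \<pi> powi k"
    using discrete by blast
  \<comment> \<open>By discreteness no absolute value lies strictly between |\<pi>| and 1, so an
    error below one is an error of at most |\<pi>|.\<close>
  have gap: "nv x \<le> nv \<pi>" if x: "x \<in> carrier K" "nv x < 1" for x
  proof (cases "x = \<zero>")
    case False
    then obtain k :: int where k: "nv x = nv \<pi> powi k" using pi(4)[of x] x by auto
    have "1 \<le> k"
    proof (rule ccontr)
      assume "\<not> 1 \<le> k"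
      then have "nv \<pi> powi 0 \<le> nv \<pi> powi k"
        using pi by (intro power_int_decreasing) auto
      then show False using k x by simp
    qed
    then have "nv \<pi> powi k \<le> nv \<pi> powi 1"
      using pi by (intro power_int_decreasing) auto
    then show ?thesis using k by simp
  qed (use pi in simp)
  have "\<exists>U. finite U \<and> U \<subseteq> carrier K \<and>
    (\<forall>x \<in> carrier K. nv x \<le> 1 \<longrightarrow> (\<exists>t \<in> U. nv (x \<ominus> t) \<le> nv \<pi> ^ k))" for k
  proof (induction k)
    case 0
    have "\<forall>x \<in> carrier K. nv x \<le> 1 \<longrightarrow> nv (x \<ominus> \<zero>) \<le> 1"
      by (auto simp: a_minus_def)
    then show ?case by (intro exI[of _ "{\<zero>}"]) auto
  next
    case (Suc k)
    then obtain U where U: "finite U" "U \<subseteq> carrier K"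
      "\<And>x. x \<in> carrier K \<Longrightarrow> nv x \<le> 1 \<Longrightarrow> \<exists>t \<in> U. nv (x \<ominus> t) \<le> nv \<pi> ^ k" by blast
    let ?p = "\<pi> [^] k"
    have TK: "T \<subseteq> carrier K" using T by (auto simp: integers_of_def)
    have p: "?p \<in> carrier K" "?p \<noteq> \<zero>" "nv ?p = nv \<pi> ^ k"
      using pi nv_pow[of \<pi> k] by (auto simp flip: nv_eq_0_iff)
    have "\<exists>t \<in> (\<lambda>(u, s). u \<oplus> ?p \<otimes> s) ` (U \<times> T). nv (x \<ominus> t) \<le> nv \<pi> ^ Suc k"
      if x: "x \<in> carrier K" "nv x \<le> 1" for x
    proof -
      obtain u where u: "u \<in> U" "nv (x \<ominus> u) \<le> nv \<pi> ^ k" using U(3) x by blast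
      \<comment> \<open>The error of the first k digits is rescaled to an integer, whose residue
        class gives the next digit \<open>s\<close>.\<close>
      define y where "y = (x \<ominus> u) \<otimes> inv ?p"
      have uK: "u \<in> carrier K" using u U by blast
      have y: "y \<in> carrier K" using x uK nonzero_inv[OF p(1,2)] by (simp add: y_def)
      have "nv y = nv (x \<ominus> u) * inverse (nv \<pi> ^ k)"
        using x uK nonzero_inv[OF p(1,2)] p nv_inv[OF p(1,2)] by (simp add: y_def nv_mult)
      moreover have "0 < nv \<pi> ^ k" using pi(2) by simp
      ultimately have "nv y \<le> 1"
        using u(2) by (simp add: divide_le_eq_1_pos flip: divide_inverse)
      then obtain s where s: "s \<in> T" "nv (y \<ominus> s) < 1" using base y by blast
      have sK: "s \<in> carrier K" using s TK by blast
      have "?p \<otimes> y = x \<ominus> u"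
        using x uK nonzero_inv[OF p(1,2)] p(1) by (simp add: y_def m_lcomm[of ?p "x \<ominus> u"])
      moreover have "x \<ominus> (u \<oplus> ?p \<otimes> s) = (x \<ominus> u) \<ominus> ?p \<otimes> s" using x uK p(1) sK by algebra
      moreover have "?p \<otimes> y \<ominus> ?p \<otimes> s = ?p \<otimes> (y \<ominus> s)" using y p(1) sK by algebra
      ultimately have "nv (x \<ominus> (u \<oplus> ?p \<otimes> s)) = nv \<pi> ^ k * nv (y \<ominus> s)"
        using y p sK by (simp add: nv_mult)
      also have "\<dots> \<le> nv \<pi> ^ k * nv \<pi>"
        using gap[of "y \<ominus> s"] s y sK pi by (intro mult_left_mono) auto
      finally show ?thesis using u s by (force simp: mult.commute)
    qed
    moreover have "finite ((\<lambda>(u, s). u \<oplus> ?p \<otimes> s) ` (U \<times> T))" using U T by simp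
    moreover have "(\<lambda>(u, s). u \<oplus> ?p \<otimes> s) ` (U \<times> T) \<subseteq> carrier K"
      using U(2) TK p(1) by auto
    ultimately show ?case by blast
  qed
  moreover obtain k where "nv \<pi> ^ k < \<epsilon>" using real_arch_pow_inv[OF assms pi(3)] by blast
  ultimately show ?thesis by (meson order.strict_trans1)
qed

section \<open>Laurent series and p-adic numbers as valued fields\<close>

lemma field_field_ring: "field (field_ring :: 'b::field ring)"
proof (rule cring.cring_fieldI2)
  show "cring (field_ring :: 'b ring)"
  proof (rule cringI)
    show "abelian_group (field_ring :: 'b ring)"
      by (rule abelian_groupI) (auto simp: field_ring_def algebra_simps intro: exI[of _ "- _"])
    show "comm_monoid (field_ring :: 'b ring)"
      by (rule comm_monoidI) (auto simp: field_ring_def algebra_simps)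
  qed (auto simp: field_ring_def algebra_simps)
  show "\<zero>\<^bsub>(field_ring :: 'b ring)\<^esub> \<noteq> \<one>\<^bsub>(field_ring :: 'b ring)\<^esub>"
    by (simp add: field_ring_def)
  fix a :: 'b
  assume "a \<in> carrier field_ring" "a \<noteq> \<zero>\<^bsub>field_ring\<^esub>"
  then show "\<exists>b \<in> carrier (field_ring :: 'b ring). a \<otimes>\<^bsub>field_ring\<^esub> b = \<one>\<^bsub>field_ring\<^esub>"
    by (auto simp: field_ring_def intro: exI[of _ "inverse a"])
qed

text \<open>Any base strictly between 0 and 1 gives the same unit ball; 1/2 is a choice.\<close>

definition fls_abs :: "'q::field fls \<Rightarrow> real" where
  "fls_abs x = (if x = 0 then 0 else (1 / 2) powi fls_subdegree x)"

lemma fls_abs_le_iff: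
  "x \<noteq> 0 \<Longrightarrow> y \<noteq> 0 \<Longrightarrow> fls_abs x \<le> fls_abs y \<longleftrightarrow> fls_subdegree y \<le> fls_subdegree x"
  using power_int_decreasing[of "fls_subdegree y" "fls_subdegree x" "1 / 2 :: real"]
    power_int_strict_decreasing[of "fls_subdegree x" "fls_subdegree y" "1 / 2 :: real"]
  by (force simp: fls_abs_def)

lemma fls_abs_le_1_iff: "fls_abs x \<le> 1 \<longleftrightarrow> x \<in> range fps_to_fls"
proof -
  have "fls_abs x \<le> 1 \<longleftrightarrow> 0 \<le> fls_subdegree x"
    using fls_abs_le_iff[of x 1] by (cases "x = 0") (auto simp: fls_abs_def)
  also have "\<dots> \<longleftrightarrow> x \<in> range fps_to_fls"
    using fls_regpart_to_fls_trivial[of x] fls_subdegree_fls_to_fps_gt0 by (metis rangeE rangeI)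
  finally show ?thesis .
qed

lemma valued_field_fls: "valued_field (field_ring :: 'q::field fls ring) fls_abs"
proof (intro valued_field.intro valued_field_axioms.intro field_field_ring)
  fix x y :: "'q fls"
  show "0 \<le> fls_abs x" by (simp add: fls_abs_def)
  show "fls_abs x = 0 \<longleftrightarrow> x = \<zero>\<^bsub>field_ring\<^esub>" by (simp add: fls_abs_def field_ring_def)
  show "fls_abs (x \<otimes>\<^bsub>field_ring\<^esub> y) = fls_abs x * fls_abs y"
    by (simp add: fls_abs_def field_ring_def power_int_add)
  have "fls_abs (x + y) \<le> max (fls_abs x) (fls_abs y)"
  proof (cases "x = 0 \<or> y = 0 \<or> x + y = 0")
    case False
    then show ?thesis
      using fls_plus_subdegree[of x y] fls_abs_le_iff[of "x + y"]
      by (metis le_max_iff_disj min_le_iff_disj)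
  qed (auto simp: fls_abs_def le_max_iff_disj)
  then show "fls_abs (x \<oplus>\<^bsub>field_ring\<^esub> y) \<le> max (fls_abs x) (fls_abs y)"
    by (simp add: field_ring_def)
qed

text \<open>The transfer of integers along \<open>\<phi>\<close> gives one inclusion, and the other
  follows from it. If |x| > 1, every y is z x^j with z integral and j large; were
  \<open>\<phi> x\<close> a power series, every element of the Laurent series field would be one, in
  particular X^(-1).\<close>

lemma power_series_in_eq_integers:
  fixes \<phi> :: "'a \<Rightarrow> 'q::field fls"
  assumes E: "valued_field E nv" "complete_valued E nv"
    and t: "t \<in> carrier E" "0 < nv t" "nv t < 1"
    and iso: "laurent_iso E \<phi>"
  shows "power_series_in E \<phi> = integers_of E nv"
proof -
  interpret E: valued_field E nv by fact
  interpret L: valued_field "field_ring :: 'q fls ring" fls_abs by (rule valued_field_fls)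
  have hom: "\<phi> \<in> ring_hom E field_ring" and surj: "\<phi> ` carrier E = carrier field_ring"
    using iso by (auto simp: laurent_iso_def ring_iso_def bij_betw_def)
  interpret hom: ring_hom_ring E field_ring \<phi>
    by (rule ring_hom_ringI2[OF E.ring_axioms L.ring_axioms hom])
  have le: "fls_abs (\<phi> x) \<le> 1" if x: "x \<in> carrier E" "nv x \<le> 1" for x
  proof (rule iso_maps_integers_to_integers[OF E t valued_field_fls _ _ _ _ hom surj x])
    show "(fls_X :: 'q fls) \<in> carrier field_ring" by (simp add: field_ring_def)
    show "0 < fls_abs (fls_X :: 'q fls)" "fls_abs (fls_X :: 'q fls) < 1" by (auto simp: fls_abs_def)
    fix x :: "'q fls"
    assume "x \<noteq> \<zero>\<^bsub>field_ring\<^esub>"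
    then show "\<exists>k::int. fls_abs x = fls_abs (fls_X :: 'q fls) powi k"
      by (intro exI[of _ "fls_subdegree x"]) (simp add: fls_abs_def field_ring_def)
  qed
  have "nv x \<le> 1" if x: "x \<in> carrier E" "fls_abs (\<phi> x) \<le> 1" for x
  proof (rule ccontr)
    assume "\<not> nv x \<le> 1"
    then have gt: "1 < nv x" by simp
    have x0: "x \<noteq> \<zero>\<^bsub>E\<^esub>" using gt by auto
    have "fls_X_inv \<in> \<phi> ` carrier E" by (simp add: surj field_ring_def)
    then obtain y where y: "y \<in> carrier E" "\<phi> y = fls_X_inv" by (metis imageE)
    obtain j where j: "nv y < nv x ^ j" using real_arch_pow gt by blast
    let ?xj = "x [^]\<^bsub>E\<^esub> j"
    have xj: "?xj \<in> carrier E" "?xj \<noteq> \<zero>\<^bsub>E\<^esub>"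
      using x gt E.nv_pow[of x j] by (auto simp flip: E.nv_eq_0_iff)
    let ?z = "y \<otimes>\<^bsub>E\<^esub> inv\<^bsub>E\<^esub> ?xj"
    have z: "?z \<in> carrier E" using y E.nonzero_inv[OF xj] by simp
    have "nv ?z = nv y * inverse (nv x ^ j)"
      using y xj x E.nonzero_inv[OF xj] E.nv_inv[OF xj] by (simp add: E.nv_mult E.nv_pow)
    moreover have "0 < nv x ^ j" using gt by simp
    ultimately have "nv ?z \<le> 1"
      using j by (simp add: divide_le_eq_1_pos flip: divide_inverse)
    then have "fls_abs (\<phi> ?z) \<le> 1" using le z by blast
    moreover have "?z \<otimes>\<^bsub>E\<^esub> ?xj = y"
      using y xj E.nonzero_inv[OF xj] by (simp add: E.m_assoc)
    then have "fls_abs (\<phi> y) = fls_abs (\<phi> ?z) * fls_abs (\<phi> x) ^ j"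
      using hom.hom_mult[OF z xj(1)] L.nv_mult[of "\<phi> ?z" "\<phi> ?xj"] L.nv_pow[of "\<phi> x" j]
        hom.hom_nat_pow[OF x(1), of j] z xj x by simp
    ultimately have "fls_abs (\<phi> y) \<le> 1"
      using x(2) L.nv_nonneg[of "\<phi> x"] x(1) power_le_one[of "fls_abs (\<phi> x)" j]
        L.nv_nonneg[of "\<phi> ?z"] z by (simp add: mult_le_one)
    then show False by (simp add: y(2) fls_abs_def)
  qed
  then show ?thesis
    using le by (auto simp: power_series_in_def integers_of_def simp flip: fls_abs_le_1_iff)
qed

text \<open>The witness is the image of p, of absolute value p^(-s), where s > 0 is the normalising
  exponent.\<close>

lemma padic_numbers_nontrivial:
  assumes "Factorial_Ring.prime p" "padic_numbers p E nv"
  shows "\<exists>t \<in> carrier E. 0 < nv t \<and> nv t < 1"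
proof -
  obtain \<iota> s where iota: "\<iota> \<in> ring_hom (field_ring :: rat ring) E" "0 < s"
      "\<And>q. nv (\<iota> q) = padic_abs p q powr s"
    using assms(2) unfolding padic_numbers_def by blast
  have "\<iota> (of_nat p) \<in> carrier E"
    using ring_hom_closed[OF iota(1)] by (simp add: field_ring_def)
  moreover have p1: "1 < p" using assms(1) prime_gt_1_nat by blast
  have "quotient_of (of_nat p) = (int p, 1)"
    using quotient_of_int[of "int p"] by simp
  then have "padic_abs p (of_nat p) = inverse (real p)"
    using p1 by (simp add: padic_abs_def power_int_minus multiplicity_self)
  then have "nv (\<iota> (of_nat p)) = inverse (real p) powr s" using iota(3) by simp
  moreover have "inverse (real p) powr s < 1 powr s"
    using p1 iota(2) by (intro powr_less_mono2) (auto simp: inverse_less_1_iff)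
  moreover have "0 < inverse (real p) powr s" using p1 by simp
  ultimately show ?thesis by (intro bexI[of _ "\<iota> (of_nat p)"]) auto
qed

section \<open>Bases over subrings of a field\<close>

lemma (in ring) subring_minus_closed:
  "subring S R \<Longrightarrow> x \<in> S \<Longrightarrow> y \<in> S \<Longrightarrow> x \<ominus> y \<in> S"
  by (simp add: a_minus_def subringE)

lemma (in ring) subring_finsum_closed:
  assumes "subring S R" "finite A" "\<And>i. i \<in> A \<Longrightarrow> f i \<in> S"
  shows "(\<Oplus>i\<in>A. f i) \<in> S"
  using assms(2,3)
proof (induction A rule: finite_induct)
  case (insert y A)
  then have "(\<Oplus>i\<in>insert y A. f i) = f y \<oplus> (\<Oplus>i\<in>A. f i)"
    using subringE(1)[OF assms(1)] by (intro finsum_insert) auto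
  then show ?case using insert subringE(7)[OF assms(1)] by simp
qed (simp add: subringE(2)[OF assms(1)])

lemma (in abelian_monoid) finsum_cartesian:
  assumes "finite A" "finite B" "f \<in> A \<times> B \<rightarrow> carrier G"
  shows "(\<Oplus>p\<in>A \<times> B. f p) = (\<Oplus>a\<in>A. \<Oplus>b\<in>B. f (a, b))"
proof -
  have fG: "a \<in> A \<Longrightarrow> b \<in> B \<Longrightarrow> f (a, b) \<in> carrier G" for a b using assms(3) by blast
  have "(\<Oplus>p\<in>A \<times> B. f p) = (\<Oplus>p\<in>(\<Union>a\<in>A. Pair a ` B). f p)"
  proof -
    have "A \<times> B = (\<Union>a\<in>A. Pair a ` B)" by blast
    then show ?thesis by (rule arg_cong)
  qed
  also have "\<dots> = (\<Oplus>a\<in>A. \<Oplus>p\<in>Pair a ` B. f p)"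
  proof (rule add.finprod_UN_disjoint[OF assms(1)])
    show "pairwise (\<lambda>i j. disjnt (Pair i ` B) (Pair j ` B)) A"
      unfolding pairwise_def disjnt_def by blast
    show "f x \<in> carrier G" if "i \<in> A" "x \<in> Pair i ` B" for i x
      using assms(3) that by blast
  qed (use assms(2) in simp)
  also have "\<dots> = (\<Oplus>a\<in>A. \<Oplus>b\<in>B. f (a, b))"
  proof (rule finsum_cong'[OF refl])
    show "(\<lambda>a. \<Oplus>b\<in>B. f (a, b)) \<in> A \<rightarrow> carrier G"
      using fG by (intro funcsetI finsum_closed) simp
    show "(\<Oplus>p\<in>Pair a ` B. f p) = (\<Oplus>b\<in>B. f (a, b))" if "a \<in> A" for a
    proof -
      have "f \<in> Pair a ` B \<rightarrow> carrier G" using fG that by auto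
      then show ?thesis using finsum_reindex[of f "Pair a" B] by (simp add: inj_on_def)
    qed
  qed
  finally show ?thesis .
qed

lemma (in abelian_monoid) finsum_swap:
  assumes "finite A" "finite B" "\<And>a b. a \<in> A \<Longrightarrow> b \<in> B \<Longrightarrow> f a b \<in> carrier G"
  shows "(\<Oplus>a\<in>A. \<Oplus>b\<in>B. f a b) = (\<Oplus>b\<in>B. \<Oplus>a\<in>A. f a b)"
proof -
  let ?g = "\<lambda>p. f (fst p) (snd p)"
  have "(\<Oplus>a\<in>A. \<Oplus>b\<in>B. f a b) = (\<Oplus>p\<in>A \<times> B. ?g p)"
    using finsum_cartesian[of A B ?g] assms by (simp add: Pi_def)
  also have "\<dots> = (\<Oplus>p\<in>prod.swap ` (B \<times> A). ?g p)"
    by (simp only: product_swap)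
  also have "\<dots> = (\<Oplus>p\<in>B \<times> A. ?g (prod.swap p))"
    using assms by (intro finsum_reindex) (auto simp: inj_on_def)
  also have "\<dots> = (\<Oplus>b\<in>B. \<Oplus>a\<in>A. f a b)"
    using finsum_cartesian[of B A "\<lambda>p. ?g (prod.swap p)"] assms by (simp add: Pi_def)
  finally show ?thesis .
qed

text \<open>Induction on the number of equations, by fraction-free elimination.\<close>

lemma (in domain) nontrivial_solution:
  assumes "subring S R" "finite J" "finite I" "card J < card I"
    and "\<And>i j. i \<in> I \<Longrightarrow> j \<in> J \<Longrightarrow> v i j \<in> S"
  shows "\<exists>a \<in> I \<rightarrow> S. (\<exists>i\<in>I. a i \<noteq> \<zero>) \<and> (\<forall>j\<in>J. (\<Oplus>i\<in>I. a i \<otimes> v i j) = \<zero>)"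
  using assms(2-5)
proof (induction J arbitrary: I v rule: finite_induct)
  case empty
  note S = subringE[OF assms(1)]
  have "I \<noteq> {}" using empty by auto
  then show ?case using S by (intro bexI[of _ "\<lambda>_. \<one>"]) auto
next
  case (insert j0 J)
  note S = subringE[OF assms(1)]
  have SR: "x \<in> S \<Longrightarrow> x \<in> carrier R" for x using S(1) by blast
  show ?case
  proof (cases "\<forall>i\<in>I. v i j0 = \<zero>")
    case True
    have "card J < card I" using insert by simp
    then obtain a where a: "a \<in> I \<rightarrow> S" "\<exists>i\<in>I. a i \<noteq> \<zero>"
        "\<forall>j\<in>J. (\<Oplus>i\<in>I. a i \<otimes> v i j) = \<zero>"
      using insert.IH[of I v] insert.prems by blast
    have "(\<Oplus>i\<in>I. a i \<otimes> v i j0) = \<zero>"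
      using a(1) True SR by (intro add.finprod_one_eqI) (auto simp: Pi_def)
    then show ?thesis using a by blast
  next
    case False
    then obtain k where k: "k \<in> I" "v k j0 \<noteq> \<zero>" by blast
    define p where "p = v k j0"
    define I' where "I' = I - {k}"
    \<comment> \<open>Cross multiplication with the pivot \<open>p\<close> removes the unknown k
      from the equations without dividing, so the coefficients remain in \<open>S\<close>.\<close>
    define w where "w i j = p \<otimes> v i j \<ominus> v i j0 \<otimes> v k j" for i j
    have vS: "v i j \<in> S" if "i \<in> I" "j \<in> insert j0 J" for i j using insert.prems that by blast
    have pS: "p \<in> S" using vS k by (simp add: p_def)
    have wS: "w i j \<in> S" if "i \<in> I'" "j \<in> J" for i j
      using vS[of i j] vS[of i j0] vS[of k j] that k pS S
      by (auto simp: w_def I'_def a_minus_def)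
    have "finite I'" "I = insert k I'" "k \<notin> I'" using insert.prems k by (auto simp: I'_def)
    note I' = this
    have "card J < card I'" using insert.prems insert.hyps I' by simp
    then obtain a where a: "a \<in> I' \<rightarrow> S" "\<exists>i\<in>I'. a i \<noteq> \<zero>"
        "\<And>j. j \<in> J \<Longrightarrow> (\<Oplus>i\<in>I'. a i \<otimes> w i j) = \<zero>"
      using insert.IH[of I' w] I'(1) wS by blast
    have aS: "a i \<in> S" if "i \<in> I'" for i using a that by blast
    define r where "r = (\<Oplus>i\<in>I'. a i \<otimes> v i j0)"
    have rS: "r \<in> S" using I' aS vS S unfolding r_def by (intro subring_finsum_closed[OF assms(1)]) auto
    define a' where "a' i = (if i = k then \<ominus> r else p \<otimes> a i)" for i
    have a'S: "a' \<in> I \<rightarrow> S" using rS pS aS S I' by (auto simp: a'_def)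
    have split: "(\<Oplus>i\<in>I. a' i \<otimes> v i j) = (\<ominus> r) \<otimes> v k j \<oplus> p \<otimes> (\<Oplus>i\<in>I'. a i \<otimes> v i j)"
      if j: "j \<in> insert j0 J" for j
    proof -
      have "(\<Oplus>i\<in>I. a' i \<otimes> v i j) = a' k \<otimes> v k j \<oplus> (\<Oplus>i\<in>I'. a' i \<otimes> v i j)"
        unfolding I'(2) using I' a'S vS j k SR by (intro finsum_insert) (auto simp: Pi_def)
      also have "(\<Oplus>i\<in>I'. a' i \<otimes> v i j) = (\<Oplus>i\<in>I'. p \<otimes> (a i \<otimes> v i j))"
        using I' vS j aS pS SR by (intro finsum_cong') (auto simp: a'_def m_assoc)
      also have "\<dots> = p \<otimes> (\<Oplus>i\<in>I'. a i \<otimes> v i j)"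
        using I' vS j aS pS SR by (intro finsum_rdistr[symmetric]) auto
      finally show ?thesis by (simp add: a'_def)
    qed
    have "(\<Oplus>i\<in>I. a' i \<otimes> v i j0) = \<zero>"
      using split[of j0] rS pS SR by (simp add: r_def[symmetric] p_def[symmetric] l_minus m_comm[of r p] l_neg)
    moreover have "(\<Oplus>i\<in>I. a' i \<otimes> v i j) = \<zero>" if j: "j \<in> J" for j
    proof -
      have jj: "j \<in> insert j0 J" using j by blast
      have sums: "(\<Oplus>i\<in>I'. a i \<otimes> v i j) \<in> S" using I' aS vS jj S by (intro subring_finsum_closed[OF assms(1)]) auto
      have "(\<Oplus>i\<in>I'. a i \<otimes> w i j) \<oplus> (\<Oplus>i\<in>I'. (a i \<otimes> v i j0) \<otimes> v k j) =
          (\<Oplus>i\<in>I'. a i \<otimes> w i j \<oplus> (a i \<otimes> v i j0) \<otimes> v k j)"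
        using I' aS vS jj wS j k SR by (intro finsum_addf[symmetric]) auto
      also have "\<dots> = (\<Oplus>i\<in>I'. p \<otimes> (a i \<otimes> v i j))"
      proof (rule finsum_cong'[OF refl])
        show "(\<lambda>i. p \<otimes> (a i \<otimes> v i j)) \<in> I' \<rightarrow> carrier R" using I' aS vS jj pS SR by auto
        fix i assume i: "i \<in> I'"
        have "a i \<in> carrier R" "v i j \<in> carrier R" "v i j0 \<in> carrier R" "v k j \<in> carrier R" "p \<in> carrier R"
          using i I' aS[OF i] vS jj pS SR k by auto
        then show "a i \<otimes> w i j \<oplus> (a i \<otimes> v i j0) \<otimes> v k j = p \<otimes> (a i \<otimes> v i j)"
          unfolding w_def by algebra
      qed
      also have "\<dots> = p \<otimes> (\<Oplus>i\<in>I'. a i \<otimes> v i j)"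
        using I' vS jj aS pS SR by (intro finsum_rdistr[symmetric]) auto
      also have "(\<Oplus>i\<in>I'. (a i \<otimes> v i j0) \<otimes> v k j) = r \<otimes> v k j"
        unfolding r_def using I' vS jj aS k SR by (intro finsum_ldistr[symmetric]) auto
      finally have "p \<otimes> (\<Oplus>i\<in>I'. a i \<otimes> v i j) = r \<otimes> v k j"
        using a(3)[OF j] rS vS[OF k(1) jj] SR by simp
      then show ?thesis
        using split[OF jj] rS vS[OF k(1) jj] SR by (simp add: l_minus l_neg)
    qed
    moreover have "\<exists>i\<in>I. a' i \<noteq> \<zero>"
    proof -
      obtain i where i: "i \<in> I'" "a i \<noteq> \<zero>" using a(2) by blast
      have "p \<otimes> a i \<noteq> \<zero>"
      proof
        assume "p \<otimes> a i = \<zero>"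
        then have "p = \<zero> \<or> a i = \<zero>"
          by (rule integral[OF _ SR[OF pS] SR[OF aS[OF i(1)]]])
        then show False using k(2) i(2) by (simp add: p_def)
      qed
      then show ?thesis using i I' by (auto simp: a'_def)
    qed
    ultimately show ?thesis using a'S by blast
  qed
qed

section \<open>Linear combinations and bases with coefficients in a subring\<close>

locale vector_module = R?: field K + module K V
  for K :: "'a ring" (structure) and V :: "('a, 'b) module"
begin

abbreviation lin :: "'i set \<Rightarrow> ('i \<Rightarrow> 'a) \<Rightarrow> ('i \<Rightarrow> 'b) \<Rightarrow> 'b" where
  "lin I a b \<equiv> \<Oplus>\<^bsub>V\<^esub>i\<in>I. a i \<odot>\<^bsub>V\<^esub> b i"

text \<open>The coefficients range over a subset \<open>S\<close> of the field, so bases over a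
  field and over its valuation ring are compared inside one space. A family rather than a set of
  vectors lets the index sets be restricted, multiplied and counted.\<close>

definition basis_on :: "'a set \<Rightarrow> 'b set \<Rightarrow> 'i set \<Rightarrow> ('i \<Rightarrow> 'b) \<Rightarrow> bool" where
  "basis_on S L I b \<longleftrightarrow> finite I \<and> b \<in> I \<rightarrow> carrier V \<and> L = {lin I a b | a. a \<in> I \<rightarrow> S} \<and>
    (\<forall>a \<in> I \<rightarrow> S. lin I a b = \<zero>\<^bsub>V\<^esub> \<longrightarrow> (\<forall>i\<in>I. a i = \<zero>))"

text \<open>If \<open>S\<close> is a subring, the scalar -1 provides the negatives.\<close>

definition subspace :: "'a set \<Rightarrow> 'b set \<Rightarrow> bool" where
  "subspace S L \<longleftrightarrow> L \<subseteq> carrier V \<and> \<zero>\<^bsub>V\<^esub> \<in> L \<and>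
    (\<forall>x\<in>L. \<forall>y\<in>L. x \<oplus>\<^bsub>V\<^esub> y \<in> L) \<and> (\<forall>s\<in>S. \<forall>x\<in>L. s \<odot>\<^bsub>V\<^esub> x \<in> L)"

lemma lin_closed [intro, simp]:
  "a \<in> I \<rightarrow> carrier K \<Longrightarrow> b \<in> I \<rightarrow> carrier V \<Longrightarrow> lin I a b \<in> carrier V"
  by (intro M.finsum_closed) auto

lemma lin_cong:
  assumes "a' \<in> I \<rightarrow> carrier K" "b' \<in> I \<rightarrow> carrier V"
    and "\<And>i. i \<in> I \<Longrightarrow> a i = a' i" "\<And>i. i \<in> I \<Longrightarrow> b i = b' i"
  shows "lin I a b = lin I a' b'"
  using assms by (intro M.finsum_cong') auto

lemma lin_add:
  assumes "a \<in> I \<rightarrow> carrier K" "a' \<in> I \<rightarrow> carrier K" "b \<in> I \<rightarrow> carrier V"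
  shows "lin I (\<lambda>i. a i \<oplus> a' i) b = lin I a b \<oplus>\<^bsub>V\<^esub> lin I a' b"
proof -
  have "lin I (\<lambda>i. a i \<oplus> a' i) b = (\<Oplus>\<^bsub>V\<^esub>i\<in>I. a i \<odot>\<^bsub>V\<^esub> b i \<oplus>\<^bsub>V\<^esub> a' i \<odot>\<^bsub>V\<^esub> b i)"
    using assms by (intro M.finsum_cong') (auto simp: smult_l_distr Pi_def)
  also have "\<dots> = lin I a b \<oplus>\<^bsub>V\<^esub> lin I a' b"
    using assms by (intro M.finsum_addf) auto
  finally show ?thesis .
qed

lemma lin_smult:
  assumes "finite I" "r \<in> carrier K" "a \<in> I \<rightarrow> carrier K" "b \<in> I \<rightarrow> carrier V"
  shows "lin I (\<lambda>i. r \<otimes> a i) b = r \<odot>\<^bsub>V\<^esub> lin I a b"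
proof -
  have "lin I (\<lambda>i. r \<otimes> a i) b = (\<Oplus>\<^bsub>V\<^esub>i\<in>I. r \<odot>\<^bsub>V\<^esub> (a i \<odot>\<^bsub>V\<^esub> b i))"
    using assms by (intro M.finsum_cong') (auto simp: smult_assoc1 Pi_def)
  moreover have "(\<lambda>i. a i \<odot>\<^bsub>V\<^esub> b i) \<in> I \<rightarrow> carrier V" using assms by auto
  ultimately show ?thesis using finsum_smult_ldistr[of I r "\<lambda>i. a i \<odot>\<^bsub>V\<^esub> b i"] assms by simp
qed

lemma lin_diff:
  assumes "finite I" "a \<in> I \<rightarrow> carrier K" "a' \<in> I \<rightarrow> carrier K" "b \<in> I \<rightarrow> carrier V"
  shows "lin I (\<lambda>i. a i \<ominus> a' i) b = lin I a b \<ominus>\<^bsub>V\<^esub> lin I a' b"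
proof -
  have "lin I a b = lin I (\<lambda>i. (a i \<ominus> a' i) \<oplus> a' i) b"
  proof (rule lin_cong)
    show "a i = (a i \<ominus> a' i) \<oplus> a' i" if "i \<in> I" for i
    proof -
      have "a i \<in> carrier K" "a' i \<in> carrier K" using that assms by auto
      then show ?thesis by algebra
    qed
  qed (use assms in auto)
  also have "\<dots> = lin I (\<lambda>i. a i \<ominus> a' i) b \<oplus>\<^bsub>V\<^esub> lin I a' b"
    using assms by (intro lin_add) auto
  finally have "lin I a b = lin I (\<lambda>i. a i \<ominus> a' i) b \<oplus>\<^bsub>V\<^esub> lin I a' b" .
  moreover have "lin I (\<lambda>i. a i \<ominus> a' i) b \<in> carrier V" "lin I a' b \<in> carrier V"
    using assms by (auto intro!: lin_closed)
  ultimately show ?thesis by (simp add: a_minus_def M.a_assoc M.r_neg)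
qed

lemma lin_zero:
  assumes "\<And>i. i \<in> I \<Longrightarrow> a i = \<zero>" "b \<in> I \<rightarrow> carrier V"
  shows "lin I a b = \<zero>\<^bsub>V\<^esub>"
proof (rule M.add.finprod_one_eqI)
  show "a i \<odot>\<^bsub>V\<^esub> b i = \<zero>\<^bsub>V\<^esub>" if "i \<in> I" for i
    using assms(1)[OF that] funcset_mem[OF assms(2) that] by simp
qed

lemma lin_insert:
  assumes "finite I" "j \<notin> I" "a \<in> insert j I \<rightarrow> carrier K" "b \<in> insert j I \<rightarrow> carrier V"
  shows "lin (insert j I) a b = a j \<odot>\<^bsub>V\<^esub> b j \<oplus>\<^bsub>V\<^esub> lin I a b"
  using assms by (intro M.finsum_insert) auto

lemma lin_delta:
  assumes "finite I" "j \<in> I" "r \<in> carrier K" "b \<in> I \<rightarrow> carrier V"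
  shows "lin I (\<lambda>i. if i = j then r else \<zero>) b = r \<odot>\<^bsub>V\<^esub> b j"
proof -
  have "lin (insert j (I - {j})) (\<lambda>i. if i = j then r else \<zero>) b =
      r \<odot>\<^bsub>V\<^esub> b j \<oplus>\<^bsub>V\<^esub> lin (I - {j}) (\<lambda>i. if i = j then r else \<zero>) b"
    using assms by (subst lin_insert) auto
  moreover have "lin (I - {j}) (\<lambda>i. if i = j then r else \<zero>) b = \<zero>\<^bsub>V\<^esub>"
    using assms by (intro lin_zero) auto
  moreover have "r \<odot>\<^bsub>V\<^esub> b j \<in> carrier V" using assms by auto
  ultimately show ?thesis using assms by (simp add: insert_absorb)
qed

lemma lin_extend:
  assumes "finite I" "J \<subseteq> I" "a \<in> J \<rightarrow> carrier K" "b \<in> I \<rightarrow> carrier V"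
  shows "lin I (\<lambda>i. if i \<in> J then a i else \<zero>) b = lin J a b"
proof (rule M.add.finprod_mono_neutral_cong_right[OF assms(1,2)])
  have *: "a i \<in> carrier K" if "i \<in> J" for i using assms(3) that by blast
  have **: "b i \<in> carrier V" if "i \<in> I" for i using assms(4) that by blast
  show "(if i \<in> J then a i else \<zero>) \<odot>\<^bsub>V\<^esub> b i = \<zero>\<^bsub>V\<^esub>" if "i \<in> I - J" for i
    using ** that by simp
  show "(\<lambda>i. (if i \<in> J then a i else \<zero>) \<odot>\<^bsub>V\<^esub> b i) \<in> I \<rightarrow> carrier V"
    using * ** by simp
qed simp

lemma smult_finsum_left:
  assumes "finite I" "a \<in> I \<rightarrow> carrier K" "x \<in> carrier V"
  shows "(\<Oplus>i\<in>I. a i) \<odot>\<^bsub>V\<^esub> x = (\<Oplus>\<^bsub>V\<^esub>i\<in>I. a i \<odot>\<^bsub>V\<^esub> x)"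
  using assms
proof (induction I rule: finite_induct)
  case (insert j I)
  have "(\<Oplus>i\<in>insert j I. a i) = a j \<oplus> (\<Oplus>i\<in>I. a i)"
    using insert by (intro R.finsum_insert) auto
  moreover have "(\<Oplus>\<^bsub>V\<^esub>i\<in>insert j I. a i \<odot>\<^bsub>V\<^esub> x) = a j \<odot>\<^bsub>V\<^esub> x \<oplus>\<^bsub>V\<^esub> (\<Oplus>\<^bsub>V\<^esub>i\<in>I. a i \<odot>\<^bsub>V\<^esub> x)"
    using insert by (intro M.finsum_insert) auto
  moreover have "(\<Oplus>i\<in>I. a i) \<in> carrier K" using insert by auto
  ultimately show ?case using insert by (simp add: smult_l_distr Pi_def)
qed simp

text \<open>The exchange of two finite sums behind a change of generators: coefficients multiply
  like matrices.\<close>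

lemma lin_lin:
  assumes "finite I" "finite J" "a \<in> I \<rightarrow> carrier K" "c \<in> J \<rightarrow> carrier V"
    and v: "\<And>i j. i \<in> I \<Longrightarrow> j \<in> J \<Longrightarrow> v i j \<in> carrier K"
  shows "lin I a (\<lambda>i. lin J (v i) c) = lin J (\<lambda>j. \<Oplus>i\<in>I. a i \<otimes> v i j) c"
proof -
  have aK: "i \<in> I \<Longrightarrow> a i \<in> carrier K" and cV: "j \<in> J \<Longrightarrow> c j \<in> carrier V" for i j
    using assms by auto
  have "lin I a (\<lambda>i. lin J (v i) c) = (\<Oplus>\<^bsub>V\<^esub>i\<in>I. \<Oplus>\<^bsub>V\<^esub>j\<in>J. (a i \<otimes> v i j) \<odot>\<^bsub>V\<^esub> c j)"
  proof (rule M.finsum_cong'[OF refl])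
    show "(\<lambda>i. \<Oplus>\<^bsub>V\<^esub>j\<in>J. (a i \<otimes> v i j) \<odot>\<^bsub>V\<^esub> c j) \<in> I \<rightarrow> carrier V"
      using aK cV v by (auto intro!: M.finsum_closed)
    show "a i \<odot>\<^bsub>V\<^esub> lin J (v i) c = (\<Oplus>\<^bsub>V\<^esub>j\<in>J. (a i \<otimes> v i j) \<odot>\<^bsub>V\<^esub> c j)" if "i \<in> I" for i
      using lin_smult[of J "a i" "v i" c] assms aK that by auto
  qed
  also have "\<dots> = (\<Oplus>\<^bsub>V\<^esub>j\<in>J. \<Oplus>\<^bsub>V\<^esub>i\<in>I. (a i \<otimes> v i j) \<odot>\<^bsub>V\<^esub> c j)"
    using assms(1,2) aK cV v by (intro M.finsum_swap) auto
  also have "\<dots> = lin J (\<lambda>j. \<Oplus>i\<in>I. a i \<otimes> v i j) c"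
    using assms(1,2) aK cV v by (intro M.finsum_cong') (auto simp: smult_finsum_left intro!: smult_closed)
  finally show ?thesis .
qed

lemma lin_reindex:
  assumes "bij_betw h J I" "a \<in> I \<rightarrow> carrier K" "b \<in> I \<rightarrow> carrier V"
  shows "lin J (a \<circ> h) (b \<circ> h) = lin I a b"
proof -
  have "lin (h ` J) a b = (\<Oplus>\<^bsub>V\<^esub>j\<in>J. a (h j) \<odot>\<^bsub>V\<^esub> b (h j))"
    using assms by (intro M.finsum_reindex) (auto simp: bij_betw_def)
  then show ?thesis using assms by (simp add: bij_betw_def)
qed

lemma subspace_lin:
  assumes "subspace S L" "finite I" "a \<in> I \<rightarrow> S" "b \<in> I \<rightarrow> L" "S \<subseteq> carrier K"
  shows "lin I a b \<in> L"
  using assms(2-4)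
proof (induction I rule: finite_induct)
  case (insert j I)
  then have "lin (insert j I) a b = a j \<odot>\<^bsub>V\<^esub> b j \<oplus>\<^bsub>V\<^esub> lin I a b"
    using assms(1,5) by (intro lin_insert) (auto simp: subspace_def)
  then show ?case using insert assms(1) by (auto simp: subspace_def)
qed (use assms in \<open>simp add: subspace_def\<close>)

lemma subspace_minus:
  assumes "subspace S L" "subring S K" "x \<in> L" "y \<in> L"
  shows "x \<ominus>\<^bsub>V\<^esub> y \<in> L"
proof -
  have "\<ominus> \<one> \<in> S" using subringE(3,5)[OF assms(2)] by blast
  then have "(\<ominus> \<one>) \<odot>\<^bsub>V\<^esub> y \<in> L" using assms by (auto simp: subspace_def)
  moreover have "y \<in> carrier V" using assms by (auto simp: subspace_def)
  ultimately have "\<ominus>\<^bsub>V\<^esub> y \<in> L" using smult_l_minus[of \<one> y] by simp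
  then show ?thesis using assms unfolding a_minus_def by (auto simp: subspace_def)
qed

lemma basis_onD:
  assumes "basis_on S L I b"
  shows "finite I" "b \<in> I \<rightarrow> carrier V" "L = {lin I a b | a. a \<in> I \<rightarrow> S}"
    "\<And>a i. a \<in> I \<rightarrow> S \<Longrightarrow> lin I a b = \<zero>\<^bsub>V\<^esub> \<Longrightarrow> i \<in> I \<Longrightarrow> a i = \<zero>"
  using assms unfolding basis_on_def by blast+

lemma basis_on_mem:
  assumes "basis_on S L I b" "subring S K" "i \<in> I"
  shows "b i \<in> L"
proof -
  note b = basis_onD[OF assms(1)] and S = subringE[OF assms(2)]
  have "lin I (\<lambda>j. if j = i then \<one> else \<zero>) b = b i"
    using lin_delta[OF b(1) assms(3) _ b(2), of \<one>] b(2) assms(3) by (auto simp: Pi_def)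
  moreover have "(\<lambda>j. if j = i then \<one> else \<zero>) \<in> I \<rightarrow> S" using S by auto
  ultimately show ?thesis unfolding b(3) by (intro CollectI exI[of _ "\<lambda>j. if j = i then \<one> else \<zero>"]) simp
qed

lemma basis_on_unique:
  assumes "basis_on S L I b" "subring S K" "a \<in> I \<rightarrow> S" "a' \<in> I \<rightarrow> S"
    and "lin I a b = lin I a' b" "i \<in> I"
  shows "a i = a' i"
proof -
  note b = basis_onD[OF assms(1)] and S = subringE[OF assms(2)]
  have K: "a \<in> I \<rightarrow> carrier K" "a' \<in> I \<rightarrow> carrier K" using assms(3,4) S(1) by blast+
  have "lin I (\<lambda>i. a i \<ominus> a' i) b = \<zero>\<^bsub>V\<^esub>"
    using lin_diff[OF b(1) K b(2)] assms(5) K b(2) by (simp add: a_minus_def M.r_neg)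
  moreover have "(\<lambda>i. a i \<ominus> a' i) \<in> I \<rightarrow> S"
    using assms(3,4) subring_minus_closed[OF assms(2)] by (simp add: Pi_def)
  ultimately have "a i \<ominus> a' i = \<zero>" using b(4) assms(6) by blast
  then show ?thesis using K assms(6) R.r_right_minus_eq by (simp add: Pi_def)
qed

lemma basis_on_subspace:
  assumes "basis_on S L I b" "subring S K"
  shows "subspace S L"
proof -
  note b = basis_onD[OF assms(1)] and S = subringE[OF assms(2)]
  have SK: "a \<in> I \<rightarrow> S \<Longrightarrow> a \<in> I \<rightarrow> carrier K" for a using S(1) by auto
  show ?thesis unfolding subspace_def
  proof (intro conjI ballI)
    show "L \<subseteq> carrier V" using b SK by auto
    show "\<zero>\<^bsub>V\<^esub> \<in> L"
      unfolding b(3) using lin_zero[of I "\<lambda>_. \<zero>" b] b(2) S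
      by (intro CollectI exI[of _ "\<lambda>_. \<zero>"]) auto
    fix x assume "x \<in> L"
    then obtain a where a: "a \<in> I \<rightarrow> S" "x = lin I a b" using b(3) by auto
    show "s \<odot>\<^bsub>V\<^esub> x \<in> L" if "s \<in> S" for s
      unfolding b(3) using a lin_smult[OF b(1) _ SK[OF a(1)] b(2), of s] that S
      by (intro CollectI exI[of _ "\<lambda>i. s \<otimes> a i"]) (auto simp: Pi_def)
    fix y assume "y \<in> L"
    then obtain a' where a': "a' \<in> I \<rightarrow> S" "y = lin I a' b" using b(3) by auto
    show "x \<oplus>\<^bsub>V\<^esub> y \<in> L"
      unfolding b(3) using a a' lin_add[OF SK[OF a(1)] SK[OF a'(1)] b(2)] S
      by (intro CollectI exI[of _ "\<lambda>i. a i \<oplus> a' i"]) (auto simp: Pi_def)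
  qed
qed

text \<open>If \<open>b\<close> had more members than \<open>c\<close>, its coordinates in
  \<open>c\<close> would form a matrix over \<open>S\<close> with more rows than columns. The rows
  then satisfy a nontrivial relation over \<open>S\<close>, contrary to independence. Elimination
  without fractions makes this work over any subring.\<close>

lemma basis_card_le:
  assumes "basis_on S L I b" "basis_on S L J c" "subring S K"
  shows "card I \<le> card J"
proof (rule ccontr)
  assume "\<not> card I \<le> card J"
  then have less: "card J < card I" by simp
  note b = basis_onD[OF assms(1)] and c = basis_onD[OF assms(2)] and S = subringE[OF assms(3)]
  have "\<exists>v. v \<in> J \<rightarrow> S \<and> b i = lin J v c" if "i \<in> I" for i
    using basis_on_mem[OF assms(1,3) that] c(3) by auto
  then obtain v where v: "\<And>i. i \<in> I \<Longrightarrow> v i \<in> J \<rightarrow> S \<and> b i = lin J (v i) c" by metis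
  then have vS: "v i j \<in> S" if "i \<in> I" "j \<in> J" for i j using that by auto
  obtain a where a: "a \<in> I \<rightarrow> S" "\<exists>i\<in>I. a i \<noteq> \<zero>" "\<forall>j\<in>J. (\<Oplus>i\<in>I. a i \<otimes> v i j) = \<zero>"
    using nontrivial_solution[of S J I v] assms(3) c(1) b(1) less vS by blast
  have aK: "a \<in> I \<rightarrow> carrier K" using a S(1) by auto
  have "lin I a b = lin I a (\<lambda>i. lin J (v i) c)"
    using aK vS c(2) v S(1) by (intro lin_cong) (auto intro!: lin_closed)
  also have "\<dots> = lin J (\<lambda>j. \<Oplus>i\<in>I. a i \<otimes> v i j) c"
    using b c aK vS S(1) by (intro lin_lin) auto
  also have "\<dots> = \<zero>\<^bsub>V\<^esub>" using a(3) c(2) by (intro lin_zero) auto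
  finally show False using b(4)[OF a(1)] a(2) by blast
qed

text \<open>Serves to number a basis by an initial segment of the natural numbers, as ranks require,
  and to let the basis vectors index themselves.\<close>

lemma basis_on_reindex:
  assumes "basis_on S L I b" "bij_betw h J I" "S \<subseteq> carrier K"
  shows "basis_on S L J (b \<circ> h)"
proof -
  note b = basis_onD[OF assms(1)]
  have hJ: "h j \<in> I" if "j \<in> J" for j using assms(2) that by (auto simp: bij_betw_def)
  define g where "g = inv_into J h"
  have g: "g i \<in> J" "h (g i) = i" if "i \<in> I" for i
    using assms(2) that by (auto simp: g_def bij_betw_def inv_into_into f_inv_into_f)
  have gh: "g (h j) = j" if "j \<in> J" for j
    using assms(2) that by (auto simp: g_def bij_betw_def)
  have eq: "lin J a (b \<circ> h) = lin I (a \<circ> g) b" if a: "a \<in> J \<rightarrow> S" for a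
  proof -
    have "lin J ((a \<circ> g) \<circ> h) (b \<circ> h) = lin I (a \<circ> g) b"
      using assms g a b by (intro lin_reindex) (auto simp: Pi_def subset_iff)
    moreover have "lin J ((a \<circ> g) \<circ> h) (b \<circ> h) = lin J a (b \<circ> h)"
      using a assms(3) hJ b(2) gh by (intro lin_cong) auto
    ultimately show ?thesis by simp
  qed
  have "L = {lin J a (b \<circ> h) | a. a \<in> J \<rightarrow> S}"
  proof
    show "L \<subseteq> {lin J a (b \<circ> h) | a. a \<in> J \<rightarrow> S}"
    proof
      fix x assume "x \<in> L"
      then obtain a where a: "a \<in> I \<rightarrow> S" "x = lin I a b" using b(3) by auto
      have "lin J (a \<circ> h) (b \<circ> h) = x"
        using lin_reindex[OF assms(2), of a b] a b(2) assms(3) by auto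
      then show "x \<in> {lin J a (b \<circ> h) | a. a \<in> J \<rightarrow> S}" using a hJ by force
    qed
    show "{lin J a (b \<circ> h) | a. a \<in> J \<rightarrow> S} \<subseteq> L"
      using eq g unfolding b(3) by fastforce
  qed
  moreover have "a j = \<zero>" if a: "a \<in> J \<rightarrow> S" "lin J a (b \<circ> h) = \<zero>\<^bsub>V\<^esub>" "j \<in> J" for a j
  proof -
    have "a \<circ> g \<in> I \<rightarrow> S" using a g by auto
    then show ?thesis using b(4)[of "a \<circ> g" "h j"] eq[OF a(1)] a hJ gh by auto
  qed
  moreover have "finite J" using assms(2) b(1) bij_betw_finite by blast
  ultimately show ?thesis using b(2) hJ unfolding basis_on_def by auto
qed

lemma basis_on_cong:
  assumes "basis_on S L I b" "\<And>i. i \<in> I \<Longrightarrow> b i = b' i" "S \<subseteq> carrier K"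
  shows "basis_on S L I b'"
proof -
  note b = basis_onD[OF assms(1)]
  have b': "b' i \<in> carrier V" if "i \<in> I" for i
    using funcset_mem[OF b(2) that] assms(2)[OF that] by simp
  have eq: "lin I a b = lin I a b'" if a: "a \<in> I \<rightarrow> S" for a
  proof (rule lin_cong)
    show "a \<in> I \<rightarrow> carrier K" using a assms(3) by (auto simp: Pi_def)
    show "b' \<in> I \<rightarrow> carrier V" using b' by (rule funcsetI)
  qed (use assms(2) in simp_all)
  have "L = {lin I a b' | a. a \<in> I \<rightarrow> S}"
    unfolding b(3) using eq by (intro Collect_cong) (metis (no_types))
  moreover have "a i = \<zero>" if "a \<in> I \<rightarrow> S" "lin I a b' = \<zero>\<^bsub>V\<^esub>" "i \<in> I" for a i
    using b(4)[OF that(1) _ that(3)] eq[OF that(1)] that(2) by simp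
  ultimately show ?thesis using b(1) b' unfolding basis_on_def by blast
qed

text \<open>A basis over a ring with 1 \<noteq> 0 repeats no vector: unit coefficients at two
  indices carrying the same vector would give the same combination. Hence the family can be replaced
  by its set of vectors, in terms of which lattices are defined.\<close>

lemma basis_on_image:
  assumes "basis_on S L I b" "subring S K"
  shows "basis_on S L (b ` I) (\<lambda>x. x)" "card (b ` I) = card I"
proof -
  note b = basis_onD[OF assms(1)] and S = subringE[OF assms(2)]
  have "inj_on b I"
  proof (rule inj_onI)
    fix i j assume ij: "i \<in> I" "j \<in> I" "b i = b j"
    let ?d = "\<lambda>k i. if i = k then \<one> else \<zero>"
    have "lin I (?d i) b = lin I (?d j) b"
      using lin_delta[OF b(1) ij(1) R.one_closed b(2)] lin_delta[OF b(1) ij(2) R.one_closed b(2)] ij(3)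
      by simp
    moreover have "?d k \<in> I \<rightarrow> S" for k using S by simp
    ultimately have "?d i i = ?d j i"
      using basis_on_unique[OF assms _ _ _ ij(1), of "?d i" "?d j"] by blast
    then show "i = j" by (simp split: if_splits)
  qed
  then have bij: "bij_betw b I (b ` I)" by (simp add: bij_betw_def)
  then show "card (b ` I) = card I" using bij_betw_same_card by metis
  have "basis_on S L (b ` I) (b \<circ> inv_into I b)"
    using basis_on_reindex[OF assms(1) bij_betw_inv_into[OF bij] S(1)] .
  then show "basis_on S L (b ` I) (\<lambda>x. x)"
    by (rule basis_on_cong) (auto simp: f_inv_into_f S(1)[THEN subsetD])
qed

text \<open>Spans and independence in the definition of a lattice involve arbitrary finite subsets
  of the basis; extension by zero turns their combinations into combinations over the whole index
  set.\<close>

lemma basis_on_span_indep: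
  assumes "basis_on S L I b" "subring S K"
  shows "finite (b ` I)" "b ` I \<subseteq> L" "module_span (K\<lparr>carrier := S\<rparr>) V (b ` I) = L"
    "module_indep (K\<lparr>carrier := S\<rparr>) V (b ` I)"
proof -
  define B where "B = b ` I"
  have B: "basis_on S L B (\<lambda>x. x)" unfolding B_def by (rule basis_on_image[OF assms])
  note b = basis_onD[OF B] and S = subringE[OF assms(2)]
  have BV: "B \<subseteq> carrier V" using b(2) by auto
  define ext where "ext X a = (\<lambda>x. if x \<in> X then a x else \<zero>)" for X and a :: "'b \<Rightarrow> 'a"
  have ext: "ext X a \<in> B \<rightarrow> S" "lin B (ext X a) (\<lambda>x. x) = lin X a (\<lambda>x. x)"
    if X: "X \<subseteq> B" "a \<in> X \<rightarrow> S" for X a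
  proof -
    show "ext X a \<in> B \<rightarrow> S" using X S(2) by (auto simp: ext_def)
    have "a \<in> X \<rightarrow> carrier K" using X(2) S(1) by auto
    then show "lin B (ext X a) (\<lambda>x. x) = lin X a (\<lambda>x. x)"
      unfolding ext_def by (intro lin_extend b(1) X(1) b(2))
  qed
  have "module_span (K\<lparr>carrier := S\<rparr>) V B = L"
  proof
    show "module_span (K\<lparr>carrier := S\<rparr>) V B \<subseteq> L"
    proof
      fix x assume "x \<in> module_span (K\<lparr>carrier := S\<rparr>) V B"
      then obtain a X where X: "X \<subseteq> B" "a \<in> X \<rightarrow> S" "x = lin X a (\<lambda>x. x)"
        unfolding module_span_def by auto
      then show "x \<in> L"
        unfolding b(3) using ext[OF X(1,2)] by (intro CollectI exI[of _ "ext X a"]) simp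
    qed
    show "L \<subseteq> module_span (K\<lparr>carrier := S\<rparr>) V B"
      unfolding module_span_def using b(1,3) by auto
  qed
  moreover have "module_indep (K\<lparr>carrier := S\<rparr>) V B"
    unfolding module_indep_def
  proof (intro allI impI ballI)
    fix a X x
    assume *: "finite X \<and> X \<subseteq> B \<and> a \<in> X \<rightarrow> carrier (K\<lparr>carrier := S\<rparr>) \<and> lin X a (\<lambda>x. x) = \<zero>\<^bsub>V\<^esub>"
      and x: "x \<in> X"
    then have X: "X \<subseteq> B" "a \<in> X \<rightarrow> S" by auto
    have "ext X a x = \<zero>" using b(4)[of "ext X a" x] ext[OF X] * x by auto
    then show "a x = \<zero>\<^bsub>K\<lparr>carrier := S\<rparr>\<^esub>" using x by (simp add: ext_def)
  qed
  moreover have "B \<subseteq> L" using basis_on_mem[OF B assms(2)] by auto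
  ultimately show "finite (b ` I)" "b ` I \<subseteq> L" "module_span (K\<lparr>carrier := S\<rparr>) V (b ` I) = L"
    "module_indep (K\<lparr>carrier := S\<rparr>) V (b ` I)"
    using b(1) by (simp_all only: B_def)
qed

lemma basis_on_lessThan:
  assumes "basis_on S L I b" "subring S K"
  shows "\<exists>b'. basis_on S L {..<card I} b'"
proof -
  obtain h where "bij_betw h {..<card I} I"
    using ex_bij_betw_nat_finite[OF basis_onD(1)[OF assms(1)]] by (auto simp: atLeast0LessThan)
  then show ?thesis using basis_on_reindex[OF assms(1)] subringE(1)[OF assms(2)] by blast
qed

text \<open>The isomorphism is the inverse of the map from coefficients to combinations, a bijection
  once the coefficient functions are restricted to the index set.\<close>

lemma basis_on_free:
  assumes "basis_on S L I b" "subring S K"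
  shows "free_of_rank (K\<lparr>carrier := S\<rparr>) (V\<lparr>carrier := L\<rparr>) (card I)"
proof -
  let ?N = "card I"
  obtain b' where b': "basis_on S L {..<?N} b'" using basis_on_lessThan[OF assms] by blast
  note b = basis_onD[OF b'] and S = subringE[OF assms(2)]
  let ?P = "{..<?N} \<rightarrow>\<^sub>E S"
  let ?l = "\<lambda>a. lin {..<?N} a b'"
  have PS: "a \<in> ?P \<Longrightarrow> a \<in> {..<?N} \<rightarrow> S" for a by (auto simp: PiE_def)
  have SK: "a \<in> {..<?N} \<rightarrow> S \<Longrightarrow> a \<in> {..<?N} \<rightarrow> carrier K" for a using S(1) by auto
  have restr: "?l (restrict a {..<?N}) = ?l a" if "a \<in> {..<?N} \<rightarrow> S" for a
    using SK[OF that] b(2) by (intro lin_cong) auto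
  have inj: "inj_on ?l ?P"
  proof (rule inj_onI)
    fix a a' assume a: "a \<in> ?P" "a' \<in> ?P" "?l a = ?l a'"
    then show "a = a'"
      using basis_on_unique[OF b' assms(2) PS PS, of a a'] by (intro PiE_ext[OF a(1,2)]) simp
  qed
  have img: "?l ` ?P = L"
  proof
    show "?l ` ?P \<subseteq> L" unfolding b(3) using PS by auto
    show "L \<subseteq> ?l ` ?P"
    proof
      fix x assume "x \<in> L"
      then obtain a where a: "a \<in> {..<?N} \<rightarrow> S" "x = ?l a" unfolding b(3) by auto
      then show "x \<in> ?l ` ?P"
        using restr[OF a(1)] by (intro image_eqI[of _ _ "restrict a {..<?N}"]) auto
    qed
  qed
  define \<phi> where "\<phi> = inv_into ?P ?l"
  have bij: "bij_betw \<phi> L ?P"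
    unfolding \<phi>_def using inj img by (intro bij_betw_inv_into) (simp add: bij_betw_def)
  have \<phi>: "\<phi> x \<in> ?P" "?l (\<phi> x) = x" if "x \<in> L" for x
    using that img inv_into_into[of x ?l ?P] f_inv_into_f[of x ?l ?P] by (simp_all add: \<phi>_def)
  have \<phi>l: "\<phi> x i = a i" if "a \<in> {..<?N} \<rightarrow> S" "x = ?l a" "i < ?N" for x a i
  proof -
    have "x \<in> L" unfolding b(3) using that by auto
    then show ?thesis
      using basis_on_unique[OF b' assms(2) PS[OF \<phi>(1)] that(1)] \<phi>(2) that(2,3) by simp
  qed
  have "\<phi> (x \<oplus>\<^bsub>V\<^esub> y) i = \<phi> x i \<oplus> \<phi> y i" if "x \<in> L" "y \<in> L" "i < ?N" for x y i
  proof (rule \<phi>l)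
    note xy = PS[OF \<phi>(1)[OF that(1)]] PS[OF \<phi>(1)[OF that(2)]]
    show "(\<lambda>i. \<phi> x i \<oplus> \<phi> y i) \<in> {..<?N} \<rightarrow> S" using xy S(7) by (auto simp: Pi_def)
    show "x \<oplus>\<^bsub>V\<^esub> y = ?l (\<lambda>i. \<phi> x i \<oplus> \<phi> y i)"
      using lin_add[OF SK[OF xy(1)] SK[OF xy(2)] b(2)] \<phi>(2) that by simp
  qed (use that in simp)
  moreover have "\<phi> (s \<odot>\<^bsub>V\<^esub> x) i = s \<otimes> \<phi> x i" if "s \<in> S" "x \<in> L" "i < ?N" for s x i
  proof (rule \<phi>l)
    note x = PS[OF \<phi>(1)[OF that(2)]]
    have sK: "s \<in> carrier K" using that S(1) by blast
    show "(\<lambda>i. s \<otimes> \<phi> x i) \<in> {..<?N} \<rightarrow> S" using x S(6) that by (auto simp: Pi_def)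
    show "s \<odot>\<^bsub>V\<^esub> x = ?l (\<lambda>i. s \<otimes> \<phi> x i)"
      using lin_smult[OF b(1) sK SK[OF x] b(2)] \<phi>(2) that by simp
  qed (use that in simp)
  ultimately show ?thesis using bij unfolding free_of_rank_def by auto
qed

text \<open>The preimages of the unit vectors form the basis. The rank is a definite description
  over abstract isomorphisms, and this leads each of them back to a basis that can be
  counted.\<close>

lemma free_basis_on:
  assumes "free_of_rank (K\<lparr>carrier := S\<rparr>) (V\<lparr>carrier := L\<rparr>) N" "subring S K" "subspace S L"
  shows "\<exists>b. basis_on S L {..<N} b"
proof -
  note S = subringE[OF assms(2)]
  obtain \<phi> where bij: "bij_betw \<phi> L ({..<N} \<rightarrow>\<^sub>E S)"
    and add: "\<And>x y i. x \<in> L \<Longrightarrow> y \<in> L \<Longrightarrow> i < N \<Longrightarrow> \<phi> (x \<oplus>\<^bsub>V\<^esub> y) i = \<phi> x i \<oplus> \<phi> y i"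
    and smult: "\<And>s x i. s \<in> S \<Longrightarrow> x \<in> L \<Longrightarrow> i < N \<Longrightarrow> \<phi> (s \<odot>\<^bsub>V\<^esub> x) i = s \<otimes> \<phi> x i"
    using assms(1) unfolding free_of_rank_def by auto
  have L: "L \<subseteq> carrier V" "\<zero>\<^bsub>V\<^esub> \<in> L" "\<And>x y. x \<in> L \<Longrightarrow> y \<in> L \<Longrightarrow> x \<oplus>\<^bsub>V\<^esub> y \<in> L"
    "\<And>s x. s \<in> S \<Longrightarrow> x \<in> L \<Longrightarrow> s \<odot>\<^bsub>V\<^esub> x \<in> L"
    using assms(3) by (auto simp: subspace_def)
  have \<phi>S: "\<phi> x \<in> {..<N} \<rightarrow>\<^sub>E S" if "x \<in> L" for x using bij that by (auto simp: bij_betw_def)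
  have \<phi>K: "\<phi> x i \<in> carrier K" "\<phi> x i \<in> S" if "x \<in> L" "i < N" for x i
    using \<phi>S[OF that(1)] that(2) S(1) by auto
  have inj: "x = y" if "x \<in> L" "y \<in> L" "\<And>i. i < N \<Longrightarrow> \<phi> x i = \<phi> y i" for x y
  proof -
    have "\<phi> x = \<phi> y" using that by (intro PiE_ext[OF \<phi>S \<phi>S]) auto
    then show ?thesis using bij that by (auto simp: bij_betw_def inj_on_def)
  qed
  have zero: "\<phi> \<zero>\<^bsub>V\<^esub> i = \<zero>" if "i < N" for i
    using add[OF L(2) L(2) that] \<phi>K[OF L(2) that] by (simp add: R.add.l_cancel_one)
  define e where "e i = (\<lambda>j\<in>{..<N}. if j = i then \<one> else \<zero>)" for i
  define b where "b i = inv_into L \<phi> (e i)" for i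
  have bL: "b i \<in> L" and \<phi>b: "\<phi> (b i) = e i" for i
  proof -
    have "e i \<in> \<phi> ` L" using bij S(2,3) by (auto simp: bij_betw_def e_def)
    then show "b i \<in> L" "\<phi> (b i) = e i" by (auto simp: b_def inv_into_into f_inv_into_f)
  qed
  have bV: "b i \<in> carrier V" for i using bL L(1) by blast
  \<comment> \<open>Sums over subsets \<open>A\<close> are included for the sake of the induction;
    coordinates outside \<open>A\<close> vanish.\<close>
  have coords: "lin A a b \<in> L \<and> (\<forall>j<N. \<phi> (lin A a b) j = (if j \<in> A then a j else \<zero>))"
    if "finite A" "a \<in> A \<rightarrow> S" "A \<subseteq> {..<N}" for A a
    using that
  proof (induction A rule: finite_induct)
    case (insert k A)
    then have IH: "lin A a b \<in> L" "\<And>j. j < N \<Longrightarrow> \<phi> (lin A a b) j = (if j \<in> A then a j else \<zero>)"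
      by auto
    have ak: "a k \<in> S" "a k \<in> carrier K" "k < N" using insert.prems S(1) by auto
    have eq: "lin (insert k A) a b = a k \<odot>\<^bsub>V\<^esub> b k \<oplus>\<^bsub>V\<^esub> lin A a b"
      using insert.hyps insert.prems S(1) bV by (intro lin_insert) auto
    have mem: "a k \<odot>\<^bsub>V\<^esub> b k \<in> L" using L(4) ak bL by blast
    have "\<phi> (lin (insert k A) a b) j = (if j \<in> insert k A then a j else \<zero>)" if j: "j < N" for j
    proof -
      have "\<phi> (lin (insert k A) a b) j = a k \<otimes> e k j \<oplus> (if j \<in> A then a j else \<zero>)"
        using add[OF mem IH(1) j] smult[OF ak(1) bL j] IH(2)[OF j] \<phi>b by (simp add: eq)
      moreover have "a j \<in> carrier K" if "j \<in> A" using insert.prems that S(1) by auto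
      ultimately show ?thesis using insert.hyps(2) ak j by (auto simp: e_def)
    qed
    then show ?case using eq L(3)[OF mem IH(1)] by simp
  qed (use L zero in simp)
  have eqL: "L = {lin {..<N} a b | a. a \<in> {..<N} \<rightarrow> S}"
  proof
    show "{lin {..<N} a b | a. a \<in> {..<N} \<rightarrow> S} \<subseteq> L" using coords by auto
    show "L \<subseteq> {lin {..<N} a b | a. a \<in> {..<N} \<rightarrow> S}"
    proof
      fix x assume x: "x \<in> L"
      have "\<phi> x \<in> {..<N} \<rightarrow> S" using \<phi>S[OF x] by (auto simp: PiE_def)
      moreover have "lin {..<N} (\<phi> x) b = x"
        using coords[OF _ calculation] x by (intro inj) auto
      ultimately show "x \<in> {lin {..<N} a b | a. a \<in> {..<N} \<rightarrow> S}" by force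
    qed
  qed
  have "basis_on S L {..<N} b"
    unfolding basis_on_def
  proof (intro conjI ballI impI)
    fix a i assume a: "a \<in> {..<N} \<rightarrow> S" "lin {..<N} a b = \<zero>\<^bsub>V\<^esub>" "i \<in> {..<N}"
    then show "a i = \<zero>" using coords[of "{..<N}" a] zero[of i] by simp
  qed (use bV eqL in simp_all)
  then show ?thesis by blast
qed

text \<open>The description is unique because any second isomorphism yields a second basis, and two
  bases over \<open>S\<close> have the same number of members.\<close>

lemma module_rank_eq:
  assumes "basis_on S L I b" "subring S K"
  shows "module_rank (K\<lparr>carrier := S\<rparr>) (V\<lparr>carrier := L\<rparr>) = card I"
  unfolding module_rank_def
proof (rule the_equality)
  fix N assume "free_of_rank (K\<lparr>carrier := S\<rparr>) (V\<lparr>carrier := L\<rparr>) N"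
  then obtain c where "basis_on S L {..<N} c"
    using free_basis_on assms(2) basis_on_subspace[OF assms] by blast
  then have "card {..<N} = card I"
    using basis_card_le[OF _ assms] basis_card_le[OF assms(1) _ assms(2)] by (meson order_antisym)
  then show "N = card I" by simp
qed (rule basis_on_free[OF assms])

end

section \<open>The field as a module over itself, and the tower law\<close>

lemma vector_module_self:
  fixes R :: "'a ring" (structure)
  assumes "field R"
  shows "vector_module R (as_module id R)"
proof -
  interpret field R by fact
  show ?thesis
  proof (intro vector_module.intro field_axioms moduleI)
  show "abelian_group (as_module id R)"
  proof (rule abelian_groupI)
    show "\<exists>y \<in> carrier (as_module id R). y \<oplus>\<^bsub>as_module id R\<^esub> x = \<zero>\<^bsub>as_module id R\<^esub>"
      if "x \<in> carrier (as_module id R)" for x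
      using that by (intro bexI[of _ "\<ominus> x"]) (auto simp: as_module_def l_neg)
  qed (auto simp: as_module_def a_ac)
  qed (auto simp: as_module_def l_distr r_distr m_assoc is_cring)
qed

text \<open>A sum depends on carrier, zero and addition alone, which \<open>as_module\<close>
  copies.\<close>

lemma finsum_as_module: "finsum (as_module \<iota> A) = finsum A"
  by (rule ext)+ (simp add: finsum_def finprod_def as_module_def)

text \<open>The multiplicativity of degrees: grouping the coefficients of the products by the index
  of \<open>b\<close> turns an \<open>E\<close>-combination of them into an
  \<open>F\<close>-combination of \<open>b\<close>.\<close>

lemma (in vector_module) basis_on_tower:
  assumes b: "basis_on F W I b" and c: "vector_module.basis_on K (as_module id K) E F J c"
    and E: "subring E K" and F: "subring F K"
  shows "basis_on E W (I \<times> J) (\<lambda>(i, j). c j \<odot>\<^bsub>V\<^esub> b i)"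
proof -
  interpret U: vector_module K "as_module id K" by (rule vector_module_self) (rule field_axioms)
  note b = basis_onD[OF b]
  have sm: "a \<odot>\<^bsub>as_module id K\<^esub> x = a \<otimes> x" "carrier (as_module id K) = carrier K"
    "\<zero>\<^bsub>as_module id K\<^esub> = \<zero>" for a x
    by (simp_all add: as_module_def)
  note cU = U.basis_onD[OF c, unfolded finsum_as_module sm]
  note c = cU
  have EK: "E \<subseteq> carrier K" "F \<subseteq> carrier K" using E F by (simp_all add: subringE)
  have cK: "c j \<in> carrier K" if "j \<in> J" for j using c(2) that by blast
  have bV: "b i \<in> carrier V" if "i \<in> I" for i using b(2) that by blast
  let ?d = "\<lambda>(i, j). c j \<odot>\<^bsub>V\<^esub> b i"
  have eq: "lin (I \<times> J) a ?d = lin I (\<lambda>i. \<Oplus>j\<in>J. a (i, j) \<otimes> c j) b" if a: "a \<in> I \<times> J \<rightarrow> E" for a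
  proof -
    have aK: "a (i, j) \<in> carrier K" if "i \<in> I" "j \<in> J" for i j using a that EK by blast
    have "lin (I \<times> J) a ?d = (\<Oplus>\<^bsub>V\<^esub>i\<in>I. \<Oplus>\<^bsub>V\<^esub>j\<in>J. a (i, j) \<odot>\<^bsub>V\<^esub> (c j \<odot>\<^bsub>V\<^esub> b i))"
      using M.finsum_cartesian[OF b(1) c(1), of "\<lambda>p. a p \<odot>\<^bsub>V\<^esub> ?d p"] aK cK bV by (auto simp: Pi_def)
    also have "\<dots> = lin I (\<lambda>i. \<Oplus>j\<in>J. a (i, j) \<otimes> c j) b"
    proof (rule M.finsum_cong'[OF refl])
      show "(\<lambda>i. (\<Oplus>j\<in>J. a (i, j) \<otimes> c j) \<odot>\<^bsub>V\<^esub> b i) \<in> I \<rightarrow> carrier V"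
        using aK cK bV by (intro funcsetI smult_closed R.finsum_closed) auto
      fix i assume i: "i \<in> I"
      have "(\<Oplus>j\<in>J. a (i, j) \<otimes> c j) \<odot>\<^bsub>V\<^esub> b i = (\<Oplus>\<^bsub>V\<^esub>j\<in>J. (a (i, j) \<otimes> c j) \<odot>\<^bsub>V\<^esub> b i)"
        using aK cK bV i by (intro smult_finsum_left c(1)) auto
      also have "\<dots> = (\<Oplus>\<^bsub>V\<^esub>j\<in>J. a (i, j) \<odot>\<^bsub>V\<^esub> (c j \<odot>\<^bsub>V\<^esub> b i))"
        using aK cK bV i by (intro M.finsum_cong') (auto simp: smult_assoc1)
      finally show "(\<Oplus>\<^bsub>V\<^esub>j\<in>J. a (i, j) \<odot>\<^bsub>V\<^esub> (c j \<odot>\<^bsub>V\<^esub> b i)) = (\<Oplus>j\<in>J. a (i, j) \<otimes> c j) \<odot>\<^bsub>V\<^esub> b i" by simp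
    qed
    finally show ?thesis .
  qed
  have inF: "(\<lambda>i. \<Oplus>j\<in>J. a (i, j) \<otimes> c j) \<in> I \<rightarrow> F" if a: "a \<in> I \<times> J \<rightarrow> E" for a
  proof
    fix i assume "i \<in> I"
    then have "(\<lambda>j. a (i, j)) \<in> J \<rightarrow> E" using a by auto
    then show "(\<Oplus>j\<in>J. a (i, j) \<otimes> c j) \<in> F"
      unfolding c(3) by (intro CollectI exI[of _ "\<lambda>j. a (i, j)"] conjI refl)
  qed
  have "W = {lin (I \<times> J) a ?d | a. a \<in> I \<times> J \<rightarrow> E}"
  proof
    show "{lin (I \<times> J) a ?d | a. a \<in> I \<times> J \<rightarrow> E} \<subseteq> W"
    proof
      fix x assume "x \<in> {lin (I \<times> J) a ?d | a. a \<in> I \<times> J \<rightarrow> E}"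
      then obtain a where a: "a \<in> I \<times> J \<rightarrow> E" "x = lin (I \<times> J) a ?d" by blast
      show "x \<in> W"
        unfolding b(3) using eq[OF a(1)] inF[OF a(1)] a(2)
        by (intro CollectI exI[of _ "\<lambda>i. \<Oplus>j\<in>J. a (i, j) \<otimes> c j"] conjI) simp_all
    qed
    show "W \<subseteq> {lin (I \<times> J) a ?d | a. a \<in> I \<times> J \<rightarrow> E}"
    proof
      fix x assume "x \<in> W"
      then obtain r where r: "r \<in> I \<rightarrow> F" "x = lin I r b" unfolding b(3) by blast
      have "\<forall>i\<in>I. \<exists>a. a \<in> J \<rightarrow> E \<and> r i = (\<Oplus>j\<in>J. a j \<otimes> c j)"
      proof
        fix i assume "i \<in> I"
        then have "r i \<in> F" using r(1) by blast
        then show "\<exists>a. a \<in> J \<rightarrow> E \<and> r i = (\<Oplus>j\<in>J. a j \<otimes> c j)" unfolding c(3) by blast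
      qed
      from bchoice[OF this] obtain s where s: "\<And>i. i \<in> I \<Longrightarrow> s i \<in> J \<rightarrow> E"
        "\<And>i. i \<in> I \<Longrightarrow> r i = (\<Oplus>j\<in>J. s i j \<otimes> c j)" by blast
      have sE: "(\<lambda>(i, j). s i j) \<in> I \<times> J \<rightarrow> E" using s(1) by (auto simp: Pi_def)
      have "lin I r b = lin I (\<lambda>i. \<Oplus>j\<in>J. s i j \<otimes> c j) b"
        using inF[OF sE] EK b(2) s(2) by (intro lin_cong) auto
      then have "x = lin (I \<times> J) (\<lambda>(i, j). s i j) ?d" using eq[OF sE] r(2) by simp
      then show "x \<in> {lin (I \<times> J) a ?d | a. a \<in> I \<times> J \<rightarrow> E}" using sE by blast
    qed
  qed
  moreover have "a p = \<zero>" if a: "a \<in> I \<times> J \<rightarrow> E" "lin (I \<times> J) a ?d = \<zero>\<^bsub>V\<^esub>" "p \<in> I \<times> J" for a p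
  proof -
    obtain i j where p: "p = (i, j)" "i \<in> I" "j \<in> J" using a(3) by auto
    have "(\<Oplus>j\<in>J. a (i, j) \<otimes> c j) = \<zero>"
      using b(4)[OF inF[OF a(1)] _ p(2)] eq[OF a(1)] a(2) by simp
    moreover have "(\<lambda>j. a (i, j)) \<in> J \<rightarrow> E" using a(1) p by auto
    ultimately show ?thesis using c(4)[of "\<lambda>j. a (i, j)" j] p by simp
  qed
  moreover have "?d \<in> I \<times> J \<rightarrow> carrier V" using bV cK by auto
  ultimately show ?thesis using b(1) c(1) unfolding basis_on_def by blast
qed

lemma (in field) combine_eq_finsum:
  assumes "length ks = length us" "set ks \<subseteq> carrier R" "set us \<subseteq> carrier R"
  shows "combine ks us = (\<Oplus>i\<in>{..<length us}. ks ! i \<otimes> us ! i)"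
  using assms
proof (induction ks us rule: list_induct2)
  case (Cons k ks u us)
  let ?f = "\<lambda>i. (k # ks) ! i \<otimes> (u # us) ! i"
  have f: "?f i \<in> carrier R" if "i < Suc (length us)" for i
    using Cons.prems Cons.hyps that by (cases i) (auto simp: subset_iff)
  have "(\<Oplus>i\<in>{..<Suc (length us)}. ?f i) = (\<Oplus>i\<in>insert 0 (Suc ` {..<length us}). ?f i)"
    by (simp add: lessThan_Suc_eq_insert_0)
  also have "\<dots> = ?f 0 \<oplus> (\<Oplus>i\<in>Suc ` {..<length us}. ?f i)"
    using f f[of 0] by (intro finsum_insert) auto
  also have "(\<Oplus>i\<in>Suc ` {..<length us}. ?f i) = (\<Oplus>i\<in>{..<length us}. ?f (Suc i))"
    using f by (intro finsum_reindex) auto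
  finally show ?case using Cons by simp
qed simp

text \<open>Connects the list-based notion of dimension, in which the degree of \<open>K\<close>
  over \<open>F\<close> is given, with indexed families.\<close>

lemma basis_on_of_dimension:
  fixes R :: "'a ring" (structure)
  assumes "field R" "subfield F R" "ring.dimension R n F (carrier R)"
  shows "\<exists>c. vector_module.basis_on R (as_module id R) F (carrier R) {..<n} c"
proof -
  interpret field R by fact
  interpret U: vector_module R "as_module id R" by (rule vector_module_self) fact
  obtain us where us: "set us \<subseteq> carrier R" "independent F us" "length us = n" "Span F us = carrier R"
    using exists_base[OF assms(2,3)] by blast
  have FR: "F \<subseteq> carrier R" using subfieldE(3)[OF assms(2)] .
  have eq: "U.lin {..<n} a ((!) us) = combine (map a [0..<n]) us" if a: "a \<in> {..<n} \<rightarrow> F" for a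
  proof -
    have "set (map a [0..<n]) \<subseteq> carrier R" using a FR by auto
    then have "combine (map a [0..<n]) us = (\<Oplus>i\<in>{..<n}. map a [0..<n] ! i \<otimes> us ! i)"
      using combine_eq_finsum[of "map a [0..<n]" us] us by simp
    also have "\<dots> = (\<Oplus>i\<in>{..<n}. a i \<otimes> us ! i)"
    proof (rule finsum_cong'[OF refl])
      show "(\<lambda>i. a i \<otimes> us ! i) \<in> {..<n} \<rightarrow> carrier R"
      proof
        fix i assume i: "i \<in> {..<n}"
        have "a i \<in> carrier R" using a i FR by blast
        moreover have "us ! i \<in> carrier R" using us(1,3) i by (auto intro: nth_mem)
        ultimately show "a i \<otimes> us ! i \<in> carrier R" by simp
      qed
    qed simp
    finally show ?thesis unfolding finsum_as_module by (simp add: as_module_def)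
  qed
  have "carrier R = {U.lin {..<n} a ((!) us) | a. a \<in> {..<n} \<rightarrow> F}"
  proof
    have sub: "combine ks us \<in> carrier R" if "set ks \<subseteq> F" for ks
      using combine_in_carrier[of ks us] that FR us(1) by blast
    show "{U.lin {..<n} a ((!) us) | a. a \<in> {..<n} \<rightarrow> F} \<subseteq> carrier R"
    proof
      fix x assume "x \<in> {U.lin {..<n} a ((!) us) | a. a \<in> {..<n} \<rightarrow> F}"
      then obtain a where a: "a \<in> {..<n} \<rightarrow> F" "x = combine (map a [0..<n]) us" using eq by auto
      have "set (map a [0..<n]) \<subseteq> F" using a(1) by auto
      then show "x \<in> carrier R" using sub a(2) by blast
    qed
    show "carrier R \<subseteq> {U.lin {..<n} a ((!) us) | a. a \<in> {..<n} \<rightarrow> F}"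
    proof
      fix x assume "x \<in> carrier R"
      then obtain ks where ks: "length ks = n" "set ks \<subseteq> F" "x = combine ks us"
        using Span_eq_combine_set_length_version[OF assms(2) us(1)] us(3,4) by (smt (verit) mem_Collect_eq)
      have a: "(!) ks \<in> {..<n} \<rightarrow> F" using ks by (auto intro: nth_mem)
      have "map ((!) ks) [0..<n] = ks" using ks(1) map_nth by blast
      then have "x = U.lin {..<n} ((!) ks) ((!) us)" using eq[OF a] ks(3) by simp
      then show "x \<in> {U.lin {..<n} a ((!) us) | a. a \<in> {..<n} \<rightarrow> F}" using a by blast
    qed
  qed
  moreover have "a i = \<zero>"
    if a: "a \<in> {..<n} \<rightarrow> F" "U.lin {..<n} a ((!) us) = \<zero>\<^bsub>as_module id R\<^esub>" "i < n" for a i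
  proof -
    have "set (map a [0..<n]) \<subseteq> F" using a by auto
    moreover have "combine (map a [0..<n]) us = \<zero>" using eq[OF a(1)] a(2) by (simp add: as_module_def)
    ultimately have "set (take (length us) (map a [0..<n])) \<subseteq> {\<zero>}"
      using independent_imp_trivial_combine[OF assms(2) us(2)] by blast
    then show ?thesis using us(3) a(3) by (auto simp: image_subset_iff)
  qed
  moreover have "(!) us \<in> {..<n} \<rightarrow> carrier (as_module id R)"
    using us by (auto simp: as_module_def intro: nth_mem)
  ultimately show ?thesis unfolding U.basis_on_def by (intro exI[of _ "(!) us"]) auto
qed

section \<open>Lattices over complete valuation rings\<close>

lemma (in abelian_group) eq_if_diff_zero:
  assumes "x \<ominus> y = \<zero>" "x \<in> carrier G" "y \<in> carrier G"
  shows "x = y"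
proof -
  have "x = (x \<ominus> y) \<oplus> y" using assms(2,3) by (simp add: a_minus_def a_assoc l_neg)
  then show ?thesis using assms by simp
qed

text \<open>The linear functionals \<open>crd\<close> jointly separate the points, so the maximum of
  |crd| is a norm. The two instances are the coefficients of an element of \<open>S\<^sub>f\<close>,
  and the identity as the single coordinate of \<open>K\<close>.\<close>

locale coordinate_space = R?: valued_field K nv + vector_module K V
  for K :: "'a ring" (structure) and nv and V :: "('a, 'b) module" +
  fixes X :: "'x set" and crd :: "'x \<Rightarrow> 'b \<Rightarrow> 'a"
  assumes finite_X: "finite X"
    and crd_closed: "\<lbrakk>\<xi> \<in> X; x \<in> carrier V\<rbrakk> \<Longrightarrow> crd \<xi> x \<in> carrier K"
    and crd_add: "\<lbrakk>\<xi> \<in> X; x \<in> carrier V; y \<in> carrier V\<rbrakk> \<Longrightarrow> crd \<xi> (x \<oplus>\<^bsub>V\<^esub> y) = crd \<xi> x \<oplus> crd \<xi> y"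
    and crd_smult: "\<lbrakk>\<xi> \<in> X; a \<in> carrier K; x \<in> carrier V\<rbrakk> \<Longrightarrow> crd \<xi> (a \<odot>\<^bsub>V\<^esub> x) = a \<otimes> crd \<xi> x"
    and crd_inject: "\<lbrakk>x \<in> carrier V; \<And>\<xi>. \<xi> \<in> X \<Longrightarrow> crd \<xi> x = \<zero>\<rbrakk> \<Longrightarrow> x = \<zero>\<^bsub>V\<^esub>"
begin

lemma crd_zero: "\<xi> \<in> X \<Longrightarrow> crd \<xi> \<zero>\<^bsub>V\<^esub> = \<zero>"
  using crd_smult[of \<xi> \<zero> "\<zero>\<^bsub>V\<^esub>"] crd_closed[of \<xi> "\<zero>\<^bsub>V\<^esub>"] by simp

lemma crd_diff:
  assumes "\<xi> \<in> X" "x \<in> carrier V" "y \<in> carrier V"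
  shows "crd \<xi> (x \<ominus>\<^bsub>V\<^esub> y) = crd \<xi> x \<ominus> crd \<xi> y"
proof -
  have "x = (x \<ominus>\<^bsub>V\<^esub> y) \<oplus>\<^bsub>V\<^esub> y"
    using assms by (simp add: a_minus_def M.a_assoc M.l_neg)
  then have "crd \<xi> x = crd \<xi> (x \<ominus>\<^bsub>V\<^esub> y) \<oplus> crd \<xi> y"
    using crd_add[of \<xi> "x \<ominus>\<^bsub>V\<^esub> y" y] assms by simp
  then show ?thesis
    using crd_closed[of \<xi> "x \<ominus>\<^bsub>V\<^esub> y"] crd_closed[of \<xi> y] assms by (simp add: a_minus_def R.a_assoc R.r_neg)
qed

lemma crd_lin:
  assumes "\<xi> \<in> X" "finite I" "a \<in> I \<rightarrow> carrier K" "b \<in> I \<rightarrow> carrier V"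
  shows "crd \<xi> (lin I a b) = (\<Oplus>i\<in>I. a i \<otimes> crd \<xi> (b i))"
  using assms(2-4)
proof (induction I rule: finite_induct)
  case (insert j I)
  have j: "a j \<in> carrier K" "b j \<in> carrier V" and I: "a \<in> I \<rightarrow> carrier K" "b \<in> I \<rightarrow> carrier V"
    using insert.prems by auto
  have "crd \<xi> (lin (insert j I) a b) = crd \<xi> (a j \<odot>\<^bsub>V\<^esub> b j \<oplus>\<^bsub>V\<^esub> lin I a b)"
    using insert.hyps insert.prems by (subst lin_insert) auto
  also have "\<dots> = a j \<otimes> crd \<xi> (b j) \<oplus> crd \<xi> (lin I a b)"
    using assms(1) j lin_closed[OF I] by (simp add: crd_add crd_smult)
  also have "crd \<xi> (lin I a b) = (\<Oplus>i\<in>I. a i \<otimes> crd \<xi> (b i))" using insert.IH I by blast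
  also have "a j \<otimes> crd \<xi> (b j) \<oplus> \<dots> = (\<Oplus>i\<in>insert j I. a i \<otimes> crd \<xi> (b i))"
  proof -
    have "(\<lambda>i. a i \<otimes> crd \<xi> (b i)) \<in> I \<rightarrow> carrier K"
      using I assms(1) by (auto simp: Pi_def crd_closed)
    then show ?thesis
      using insert.hyps j assms(1) crd_closed by (simp add: R.finsum_insert)
  qed
  finally show ?case .
qed (simp add: crd_zero assms)

text \<open>The basis dual to the coordinates: a vector and its expansion have the same coordinates,
  hence coincide.\<close>

lemma standard_basis:
  assumes surj: "\<And>v. v \<in> X \<rightarrow> carrier K \<Longrightarrow> \<exists>x \<in> carrier V. \<forall>\<xi>\<in>X. crd \<xi> x = v \<xi>"
  shows "\<exists>b. basis_on (carrier K) (carrier V) X b"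
proof -
  have "\<exists>x. x \<in> carrier V \<and> (\<forall>\<xi>\<in>X. crd \<xi> x = (if \<xi> = \<eta> then \<one> else \<zero>))" for \<eta>
    using surj[of "\<lambda>\<xi>. if \<xi> = \<eta> then \<one> else \<zero>"] by auto
  then obtain b where b: "\<And>\<eta>. b \<eta> \<in> carrier V"
      "\<And>\<eta> \<xi>. \<xi> \<in> X \<Longrightarrow> crd \<xi> (b \<eta>) = (if \<xi> = \<eta> then \<one> else \<zero>)" by metis
  have bV: "b \<in> X \<rightarrow> carrier V" using b by blast
  have coord: "crd \<xi> (lin X a b) = a \<xi>" if a: "a \<in> X \<rightarrow> carrier K" and \<xi>: "\<xi> \<in> X" for a \<xi>
  proof -
    have "crd \<xi> (lin X a b) = (\<Oplus>\<eta>\<in>X. a \<eta> \<otimes> crd \<xi> (b \<eta>))"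
      by (rule crd_lin[OF \<xi> finite_X a bV])
    also have "\<dots> = (\<Oplus>\<eta>\<in>X. if \<xi> = \<eta> then a \<eta> else \<zero>)"
      using a b \<xi> by (intro R.finsum_cong') (auto simp: Pi_def)
    also have "\<dots> = a \<xi>" by (rule R.finsum_singleton[OF \<xi> finite_X a])
    finally show ?thesis .
  qed
  have "carrier V = {lin X a b | a. a \<in> X \<rightarrow> carrier K}"
  proof
    show "{lin X a b | a. a \<in> X \<rightarrow> carrier K} \<subseteq> carrier V" using bV by (auto intro!: lin_closed)
    show "carrier V \<subseteq> {lin X a b | a. a \<in> X \<rightarrow> carrier K}"
    proof
      fix x assume x: "x \<in> carrier V"
      let ?a = "\<lambda>\<xi>. crd \<xi> x"
      have a: "?a \<in> X \<rightarrow> carrier K" using x crd_closed by blast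
      have l: "lin X ?a b \<in> carrier V" using a bV by (rule lin_closed)
      have "x \<ominus>\<^bsub>V\<^esub> lin X ?a b = \<zero>\<^bsub>V\<^esub>"
      proof (rule crd_inject)
        fix \<xi> assume \<xi>: "\<xi> \<in> X"
        show "crd \<xi> (x \<ominus>\<^bsub>V\<^esub> lin X ?a b) = \<zero>"
          using crd_diff[OF \<xi> x l] coord[OF a \<xi>] crd_closed[OF \<xi> x] by (simp add: a_minus_def R.r_neg)
      qed (use x l in simp)
      then have "x = lin X ?a b"
        by (rule M.eq_if_diff_zero[OF _ x l])
      then show "x \<in> {lin X a b | a. a \<in> X \<rightarrow> carrier K}"
        using a by (intro CollectI exI[of _ ?a] conjI)
    qed
  qed
  moreover have "a \<xi> = \<zero>" if "a \<in> X \<rightarrow> carrier K" "lin X a b = \<zero>\<^bsub>V\<^esub>" "\<xi> \<in> X" for a \<xi>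
    using coord[OF that(1,3)] that(2) crd_zero[OF that(3)] by simp
  ultimately show ?thesis using finite_X bV unfolding basis_on_def by blast
qed

text \<open>
  A generator whose coefficient in a relation has the largest absolute value is a combination of
  the other generators.
\<close>

lemma valuation_ring_basis:
  assumes E: "subfield E K" and I: "finite I" "b \<in> I \<rightarrow> carrier V"
    and L: "L = {lin I a b | a. a \<in> I \<rightarrow> {x \<in> E. nv x \<le> 1}}"
  shows "\<exists>J. J \<subseteq> I \<and> basis_on {x \<in> E. nv x \<le> 1} L J b"
  using I L
proof (induction "card I" arbitrary: I rule: less_induct)
  case less
  let ?S = "{x \<in> E. nv x \<le> 1}"
  have subr: "subring E K" using subfieldE(1)[OF E] .
  have SS: "subring ?S K" by (rule integers_subring[OF subr])
  note S = subringE[OF SS]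
  have EK: "E \<subseteq> carrier K" using subringE(1)[OF subr] .
  show ?case
  proof (cases "\<forall>a \<in> I \<rightarrow> ?S. lin I a b = \<zero>\<^bsub>V\<^esub> \<longrightarrow> (\<forall>i\<in>I. a i = \<zero>)")
    case True
    then have "basis_on ?S L I b" using less.prems unfolding basis_on_def by blast
    then show ?thesis by blast
  next
    case False
    then obtain a k where a: "a \<in> I \<rightarrow> ?S" "lin I a b = \<zero>\<^bsub>V\<^esub>" "k \<in> I" "a k \<noteq> \<zero>" by blast
    have "\<exists>j\<in>I. \<forall>i\<in>I. nv (a i) \<le> nv (a j)"
    proof -
      have "finite ((\<lambda>i. nv (a i)) ` I)" "(\<lambda>i. nv (a i)) ` I \<noteq> {}" using less.prems(1) a(3) by auto
      then have "Max ((\<lambda>i. nv (a i)) ` I) \<in> (\<lambda>i. nv (a i)) ` I" by (rule Max_in)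
      then obtain j where "j \<in> I" "Max ((\<lambda>i. nv (a i)) ` I) = nv (a j)" by auto
      then show ?thesis using less.prems(1) by (metis Max_ge finite_imageI imageI)
    qed
    then obtain j where j: "j \<in> I" "\<And>i. i \<in> I \<Longrightarrow> nv (a i) \<le> nv (a j)" by blast
    have aE: "a i \<in> E" "a i \<in> carrier K" if "i \<in> I" for i using a(1) that EK by auto
    have pos: "0 < nv (a j)" using nv_pos[OF aE(2)[OF a(3)] a(4)] j(2)[OF a(3)] by linarith
    then have nz: "a j \<noteq> \<zero>" by auto
    let ?t = "inv (a j)"
    have t: "?t \<in> E" "?t \<in> carrier K"
      using subfield_m_inv(1)[OF E, of "a j"] aE[OF j(1)] nz EK by auto
    have inv: "?t \<otimes> a j = \<one>" using nonzero_inv(3)[OF aE(2)[OF j(1)] nz] .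
    define I' where "I' = I - {j}"
    have I': "finite I'" "I = insert j I'" "j \<notin> I'" "card I' < card I" "b \<in> I' \<rightarrow> carrier V"
      using less.prems j(1) psubset_card_mono[OF less.prems(1), of I'] by (auto simp: I'_def)
    have bV: "b i \<in> carrier V" if "i \<in> I" for i using less.prems(2) that by blast
    \<comment> \<open>Dividing by the largest coefficient leaves quotients of absolute value at most
      one, so the expression for \<open>b j\<close> has coefficients in the valuation ring and not
      just in its quotient field.\<close>
    define r where "r i = \<ominus> (?t \<otimes> a i)" for i
    have rS: "r i \<in> ?S" if "i \<in> I" for i
    proof -
      have "nv (r i) = inverse (nv (a j)) * nv (a i)"
        using t aE[OF that] nv_inv[OF aE(2)[OF j(1)] nz] by (simp add: r_def nv_minus nv_mult)
      also have "\<dots> \<le> inverse (nv (a j)) * nv (a j)"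
        using j(2)[OF that] pos by (intro mult_left_mono) auto
      finally have "nv (r i) \<le> 1" using pos by simp
      moreover have "r i \<in> E"
        using t aE[OF that] subringE(5,6)[OF subr] by (simp add: r_def)
      ultimately show ?thesis by simp
    qed
    then have rI': "r \<in> I' \<rightarrow> ?S" "r \<in> I' \<rightarrow> carrier K" using I'(2) S(1) by auto
    have bj: "b j = lin I' r b"
    proof -
      have taK: "(\<lambda>i. ?t \<otimes> a i) \<in> insert j I' \<rightarrow> carrier K" using t aE I'(2) by auto
      have "lin I (\<lambda>i. ?t \<otimes> a i) b = ?t \<odot>\<^bsub>V\<^esub> lin I a b"
        using less.prems t aE by (intro lin_smult) auto
      then have "\<zero>\<^bsub>V\<^esub> = lin (insert j I') (\<lambda>i. ?t \<otimes> a i) b" using a(2) t I'(2) by simp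
      also have "\<dots> = (?t \<otimes> a j) \<odot>\<^bsub>V\<^esub> b j \<oplus>\<^bsub>V\<^esub> lin I' (\<lambda>i. ?t \<otimes> a i) b"
        using I' less.prems(2) taK by (intro lin_insert) auto
      finally have 1: "b j \<oplus>\<^bsub>V\<^esub> lin I' (\<lambda>i. ?t \<otimes> a i) b = \<zero>\<^bsub>V\<^esub>" using inv bV[OF j(1)] by simp
      have "lin I' r b \<oplus>\<^bsub>V\<^esub> lin I' (\<lambda>i. ?t \<otimes> a i) b = lin I' (\<lambda>i. r i \<oplus> ?t \<otimes> a i) b"
        using rI' taK I' by (intro lin_add[symmetric]) auto
      also have "\<dots> = \<zero>\<^bsub>V\<^esub>"
        using taK I' by (intro lin_zero) (auto simp: r_def R.l_neg Pi_def)
      finally have 2: "lin I' r b \<oplus>\<^bsub>V\<^esub> lin I' (\<lambda>i. ?t \<otimes> a i) b = \<zero>\<^bsub>V\<^esub>" .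
      have z: "lin I' (\<lambda>i. ?t \<otimes> a i) b \<in> carrier V" using taK I'(5) by (intro lin_closed) auto
      \<comment> \<open>Both sides are the negative of the same vector.\<close>
      show ?thesis
        using M.minus_equality[OF 1 z bV[OF j(1)]] M.minus_equality[OF 2 z lin_closed[OF rI'(2) I'(5)]]
        by simp
    qed
    have "L = {lin I' s b | s. s \<in> I' \<rightarrow> ?S}"
    proof
      show "L \<subseteq> {lin I' s b | s. s \<in> I' \<rightarrow> ?S}"
      proof
        fix x assume "x \<in> L"
        then obtain s where s: "s \<in> I \<rightarrow> ?S" "x = lin I s b" using less.prems(3) by blast
        have sS: "s i \<in> ?S" "s i \<in> carrier K" if "i \<in> I" for i using s(1) that S(1) by auto
        have "x = s j \<odot>\<^bsub>V\<^esub> lin I' r b \<oplus>\<^bsub>V\<^esub> lin I' s b"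
          unfolding s(2) I'(2) using lin_insert[of I' j s b] I' sS bV less.prems(2) bj[symmetric] by auto
        also have "s j \<odot>\<^bsub>V\<^esub> lin I' r b = lin I' (\<lambda>i. s j \<otimes> r i) b"
          using I' sS j rI' by (intro lin_smult[symmetric]) auto
        also have "\<dots> \<oplus>\<^bsub>V\<^esub> lin I' s b = lin I' (\<lambda>i. s j \<otimes> r i \<oplus> s i) b"
        proof (rule lin_add[symmetric])
          show "(\<lambda>i. s j \<otimes> r i) \<in> I' \<rightarrow> carrier K" using rI'(2) sS(2)[OF j(1)] by auto
          show "s \<in> I' \<rightarrow> carrier K" using sS(2) I'(2) by auto
        qed (rule I'(5))
        finally have "x = lin I' (\<lambda>i. s j \<otimes> r i \<oplus> s i) b" .
        moreover have "(\<lambda>i. s j \<otimes> r i \<oplus> s i) \<in> I' \<rightarrow> ?S"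
        proof
          fix i assume "i \<in> I'"
          then have "i \<in> I" using I'(2) by blast
          then show "s j \<otimes> r i \<oplus> s i \<in> ?S"
            using S(7)[OF S(6)[OF sS(1)[OF j(1)] rS] sS(1)] by blast
        qed
        ultimately show "x \<in> {lin I' s b | s. s \<in> I' \<rightarrow> ?S}"
          by (intro CollectI exI[of _ "\<lambda>i. s j \<otimes> r i \<oplus> s i"] conjI)
      qed
      show "{lin I' s b | s. s \<in> I' \<rightarrow> ?S} \<subseteq> L"
      proof
        fix x assume "x \<in> {lin I' s b | s. s \<in> I' \<rightarrow> ?S}"
        then obtain s where s: "s \<in> I' \<rightarrow> ?S" "x = lin I' s b" by blast
        have sK: "s \<in> I' \<rightarrow> carrier K" using s(1) S(1) by auto
        have "x = lin I (\<lambda>i. if i \<in> I' then s i else \<zero>) b"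
          unfolding s(2) using less.prems I'(2) sK by (intro lin_extend[symmetric]) auto
        moreover have "(\<lambda>i. if i \<in> I' then s i else \<zero>) \<in> I \<rightarrow> ?S" using s(1) S(2) by auto
        ultimately show "x \<in> L"
          unfolding less.prems(3) by (intro CollectI exI[of _ "\<lambda>i. if i \<in> I' then s i else \<zero>"] conjI)
      qed
    qed
    then obtain J where "J \<subseteq> I'" "basis_on ?S L J b"
      using less.hyps[OF I'(4) I'(1) I'(5)] by blast
    then show ?thesis using I'(2) by blast
  qed
qed

lemma scale_into_ball:
  assumes "\<pi> \<in> carrier K" "nv \<pi> < 1" "0 < \<epsilon>" "finite A" "A \<subseteq> carrier K"
  shows "\<exists>k::nat. \<forall>a\<in>A. nv (\<pi> [^] k \<otimes> a) \<le> \<epsilon>"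
proof -
  \<comment> \<open>The inserted 0 makes the maximum defined for empty \<open>A\<close> and
    nonnegative, so that B + 1 is a positive divisor below.\<close>
  define B where "B = Max (insert 0 (nv ` A))"
  have B: "nv a \<le> B" if "a \<in> A" for a using assms(4) that by (auto simp: B_def)
  have B0: "0 \<le> B" using assms(4) by (auto simp: B_def)
  obtain k where k: "nv \<pi> ^ k < \<epsilon> / (B + 1)"
    using real_arch_pow_inv[of "\<epsilon> / (B + 1)" "nv \<pi>"] assms(2,3) B0 by auto
  have "nv (\<pi> [^] k \<otimes> a) \<le> \<epsilon>" if "a \<in> A" for a
  proof -
    have "nv (\<pi> [^] k \<otimes> a) = nv \<pi> ^ k * nv a" using assms that by (auto simp: nv_mult nv_pow)
    also have "\<dots> \<le> \<epsilon> / (B + 1) * B"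
      using k B[OF that] B0 assms(3) nv_nonneg that assms(5) by (intro mult_mono) auto
    also have "\<dots> \<le> \<epsilon>" using B0 assms(3) by (simp add: field_simps)
    finally show ?thesis .
  qed
  then show ?thesis by blast
qed

text \<open>Clearing denominators by a power of \<pi>: for spanning, the power moves a vector of
  \<open>W\<close> into \<open>L\<close>; for independence, it moves the coefficients of a relation
  into the valuation ring. It is then divided out.\<close>

lemma basis_on_extend_scalars:
  assumes E: "subfield E K" and \<pi>: "\<pi> \<in> E" "0 < nv \<pi>" "nv \<pi> < 1"
    and W: "subspace E W" and LW: "L \<subseteq> W"
    and absorb: "0 < \<epsilon>" "\<And>x. x \<in> W \<Longrightarrow> (\<And>\<xi>. \<xi> \<in> X \<Longrightarrow> nv (crd \<xi> x) \<le> \<epsilon>) \<Longrightarrow> x \<in> L"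
    and b: "basis_on {x \<in> E. nv x \<le> 1} L I b"
  shows "basis_on E W I b"
proof -
  let ?S = "{x \<in> E. nv x \<le> 1}"
  have subr: "subring E K" using subfieldE(1)[OF E] .
  have SS: "subring ?S K" by (rule integers_subring[OF subr])
  have EK: "E \<subseteq> carrier K" using subringE(1)[OF subr] .
  note bD = basis_onD[OF b]
  have bW: "b \<in> I \<rightarrow> W" using basis_on_mem[OF b SS] LW by auto
  have pE: "\<pi> [^] (k::nat) \<in> E" for k
    by (induction k) (use subringE(3,6)[OF subr] \<pi>(1) in auto)
  have pK: "\<pi> [^] (k::nat) \<in> carrier K" for k using pE EK by blast
  have p0: "\<pi> [^] (k::nat) \<noteq> \<zero>" for k
    using nv_pow[of \<pi> k] \<pi> EK by (auto simp flip: nv_eq_0_iff)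
  have pinv: "inv (\<pi> [^] (k::nat)) \<in> E" for k
    using subfield_m_inv(1)[OF E, of "\<pi> [^] k"] pE p0 by auto
  have "W = {lin I a b | a. a \<in> I \<rightarrow> E}"
  proof
    show "{lin I a b | a. a \<in> I \<rightarrow> E} \<subseteq> W"
      using subspace_lin[OF W bD(1) _ bW EK] by blast
    show "W \<subseteq> {lin I a b | a. a \<in> I \<rightarrow> E}"
    proof
      fix x assume x: "x \<in> W"
      have xV: "x \<in> carrier V" using x W by (auto simp: subspace_def)
      have "finite ((\<lambda>\<xi>. crd \<xi> x) ` X)" "(\<lambda>\<xi>. crd \<xi> x) ` X \<subseteq> carrier K"
        using finite_X crd_closed xV by auto
      from scale_into_ball[OF _ \<pi>(3) absorb(1) this] obtain k :: nat
        where k: "\<And>\<xi>. \<xi> \<in> X \<Longrightarrow> nv (\<pi> [^] k \<otimes> crd \<xi> x) \<le> \<epsilon>" using \<pi>(1) EK by auto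
      let ?p = "\<pi> [^] k"
      have "?p \<odot>\<^bsub>V\<^esub> x \<in> L"
      proof (rule absorb(2))
        show "?p \<odot>\<^bsub>V\<^esub> x \<in> W" using W x pE by (auto simp: subspace_def)
        show "nv (crd \<xi> (?p \<odot>\<^bsub>V\<^esub> x)) \<le> \<epsilon>" if "\<xi> \<in> X" for \<xi>
          using k[OF that] crd_smult[OF that pK xV] by simp
      qed
      then obtain a where a: "a \<in> I \<rightarrow> ?S" "?p \<odot>\<^bsub>V\<^esub> x = lin I a b" using bD(3) by blast
      have aK: "a \<in> I \<rightarrow> carrier K" using a(1) EK by auto
      have "lin I (\<lambda>i. inv ?p \<otimes> a i) b = inv ?p \<odot>\<^bsub>V\<^esub> (?p \<odot>\<^bsub>V\<^esub> x)"
        using lin_smult[OF bD(1) _ aK bD(2)] pinv EK a(2) by auto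
      also have "\<dots> = x"
        using smult_assoc1[of "inv ?p" ?p x] nonzero_inv[OF pK p0] pK xV by simp
      finally have "x = lin I (\<lambda>i. inv ?p \<otimes> a i) b" by simp
      moreover have "(\<lambda>i. inv ?p \<otimes> a i) \<in> I \<rightarrow> E"
        using a(1) pinv[of k] subringE(6)[OF subr] by (auto simp: Pi_def)
      ultimately show "x \<in> {lin I a b | a. a \<in> I \<rightarrow> E}"
        by (intro CollectI exI[of _ "\<lambda>i. inv ?p \<otimes> a i"] conjI)
    qed
  qed
  moreover have "a i = \<zero>" if a: "a \<in> I \<rightarrow> E" "lin I a b = \<zero>\<^bsub>V\<^esub>" "i \<in> I" for a i
  proof -
    have aK: "a \<in> I \<rightarrow> carrier K" using a(1) EK by auto
    have "finite (a ` I)" "a ` I \<subseteq> carrier K" using bD(1) aK by auto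
    from scale_into_ball[OF _ \<pi>(3) zero_less_one this] obtain k :: nat
      where k: "\<And>i. i \<in> I \<Longrightarrow> nv (\<pi> [^] k \<otimes> a i) \<le> 1" using \<pi>(1) EK by auto
    let ?p = "\<pi> [^] k"
    have "lin I (\<lambda>i. ?p \<otimes> a i) b = \<zero>\<^bsub>V\<^esub>"
      using lin_smult[OF bD(1) pK aK bD(2)] a(2) pK by simp
    moreover have "(\<lambda>i. ?p \<otimes> a i) \<in> I \<rightarrow> ?S"
      using k a(1) pE[of k] subringE(6)[OF subr] by (auto simp: Pi_def)
    ultimately have "?p \<otimes> a i = \<zero>" using bD(4)[of "\<lambda>i. ?p \<otimes> a i" i] a(3) by blast
    then show ?thesis
      using integral[of ?p "a i"] p0 pK funcset_mem[OF aK a(3)] by blast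
  qed
  ultimately show ?thesis using bD(1,2) unfolding basis_on_def by blast
qed

text \<open>Successive approximation: the coefficients are power series in \<open>\<pi>\<close>.\<close>

lemma generators_of_generators_mod:
  assumes E: "subfield E K" "complete_valued (K\<lparr>carrier := E\<rparr>) nv"
    and \<pi>: "\<pi> \<in> E" "0 < nv \<pi>" "nv \<pi> < 1"
    and L: "subspace {x \<in> E. nv x \<le> 1} L" "\<And>\<xi> x. \<xi> \<in> X \<Longrightarrow> x \<in> L \<Longrightarrow> nv (crd \<xi> x) \<le> 1"
    and G: "finite G" "G \<subseteq> L"
    and gen: "\<And>x. x \<in> L \<Longrightarrow> \<exists>g \<in> G. \<exists>y \<in> L. x = g \<oplus>\<^bsub>V\<^esub> \<pi> \<odot>\<^bsub>V\<^esub> y"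
  shows "L = {lin G a (\<lambda>x. x) | a. a \<in> G \<rightarrow> {x \<in> E. nv x \<le> 1}}"
proof
  let ?S = "{x \<in> E. nv x \<le> 1}"
  have subr: "subring E K" using subfieldE(1)[OF E(1)] .
  have EK: "E \<subseteq> carrier K" using subringE(1)[OF subr] .
  have LV: "L \<subseteq> carrier V" using L(1) by (auto simp: subspace_def)
  have GV: "(\<lambda>x. x) \<in> G \<rightarrow> carrier V" using G(2) LV by auto
  show "{lin G a (\<lambda>x. x) | a. a \<in> G \<rightarrow> ?S} \<subseteq> L"
  proof
    fix x assume "x \<in> {lin G a (\<lambda>x. x) | a. a \<in> G \<rightarrow> ?S}"
    then obtain a where "a \<in> G \<rightarrow> ?S" "x = lin G a (\<lambda>x. x)" by blast
    moreover have "(\<lambda>x. x) \<in> G \<rightarrow> L" using G(2) by auto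
    moreover have "?S \<subseteq> carrier K" using EK by auto
    ultimately show "x \<in> L" using subspace_lin[OF L(1) G(1)] by blast
  qed
  show "L \<subseteq> {lin G a (\<lambda>x. x) | a. a \<in> G \<rightarrow> ?S}"
  proof
    fix x assume x: "x \<in> L"
    \<comment> \<open>For one approximation step, \<open>\<gamma>\<close> is the digit and
      \<open>\<eta>\<close> the remainder; iterating \<open>\<eta>\<close> from \<open>x\<close>
      gives the remainders \<open>R k\<close>.\<close>
    obtain \<gamma> \<eta> where ge: "\<And>x. x \<in> L \<Longrightarrow> \<gamma> x \<in> G \<and> \<eta> x \<in> L \<and> x = \<gamma> x \<oplus>\<^bsub>V\<^esub> \<pi> \<odot>\<^bsub>V\<^esub> \<eta> x"
      using gen by metis
    define R where "R k = (\<eta> ^^ k) x" for k :: nat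
    have RL: "R k \<in> L" for k by (induction k) (simp_all add: R_def x ge)
    have Rstep: "R k = \<gamma> (R k) \<oplus>\<^bsub>V\<^esub> \<pi> \<odot>\<^bsub>V\<^esub> R (Suc k)" for k
      using ge[OF RL[of k]] by (simp add: R_def)
    have gG: "\<gamma> (R k) \<in> G" for k using ge[OF RL[of k]] by blast
    \<comment> \<open>Partial sums of the coefficients: \<open>s k g\<close> adds up the powers
      \<pi>^i with i < k for those i at which the digit is \<open>g\<close>.\<close>
    define s where "s = rec_nat (\<lambda>g. \<zero>) (\<lambda>k r g. r g \<oplus> (if g = \<gamma> (R k) then \<pi> [^] k else \<zero>))"
    have s0: "s 0 = (\<lambda>g. \<zero>)" and sSuc: "s (Suc k) = (\<lambda>g. s k g \<oplus> (if g = \<gamma> (R k) then \<pi> [^] k else \<zero>))" for k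
      by (simp_all add: s_def)
    have pE: "\<pi> [^] (k::nat) \<in> E" for k
      by (induction k) (use subringE(3,6)[OF subr] \<pi>(1) in auto)
    have pK: "\<pi> [^] (k::nat) \<in> carrier K" for k using pE EK by blast
    have sE: "s k g \<in> E" for k g
      by (induction k) (use subringE(2,7)[OF subr] pE in \<open>auto simp: s0 sSuc\<close>)
    have sK: "s k g \<in> carrier K" for k g using sE EK by blast
    have sGK: "s k \<in> G \<rightarrow> carrier K" for k using sK by blast
    have RV: "R k \<in> carrier V" and gV: "\<gamma> (R k) \<in> carrier V" for k using RL gG G(2) LV by blast+
    have xk: "x = lin G (s k) (\<lambda>x. x) \<oplus>\<^bsub>V\<^esub> \<pi> [^] k \<odot>\<^bsub>V\<^esub> R k" for k
    proof (induction k)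
      case 0
      have "lin G (s 0) (\<lambda>x. x) = \<zero>\<^bsub>V\<^esub>" using GV by (intro lin_zero) (simp_all add: s0)
      then show ?case using x LV by (auto simp: R_def)
    next
      case (Suc k)
      let ?l = "lin G (s k) (\<lambda>x. x)"
      have l: "?l \<in> carrier V" using sGK GV by (rule lin_closed)
      have "lin G (s (Suc k)) (\<lambda>x. x) = ?l \<oplus>\<^bsub>V\<^esub> lin G (\<lambda>g. if g = \<gamma> (R k) then \<pi> [^] k else \<zero>) (\<lambda>x. x)"
        unfolding sSuc using sGK pK GV by (intro lin_add) auto
      also have "lin G (\<lambda>g. if g = \<gamma> (R k) then \<pi> [^] k else \<zero>) (\<lambda>x. x) = \<pi> [^] k \<odot>\<^bsub>V\<^esub> \<gamma> (R k)"
        by (rule lin_delta[OF G(1) gG pK GV])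
      finally have 1: "lin G (s (Suc k)) (\<lambda>x. x) = ?l \<oplus>\<^bsub>V\<^esub> \<pi> [^] k \<odot>\<^bsub>V\<^esub> \<gamma> (R k)" .
      have "\<pi> [^] k \<odot>\<^bsub>V\<^esub> R k = \<pi> [^] k \<odot>\<^bsub>V\<^esub> (\<gamma> (R k) \<oplus>\<^bsub>V\<^esub> \<pi> \<odot>\<^bsub>V\<^esub> R (Suc k))"
        using Rstep[of k] by simp
      also have "\<dots> = \<pi> [^] k \<odot>\<^bsub>V\<^esub> \<gamma> (R k) \<oplus>\<^bsub>V\<^esub> \<pi> [^] Suc k \<odot>\<^bsub>V\<^esub> R (Suc k)"
        using pK[of k] gV[of k] RV[of "Suc k"] \<pi>(1) EK by (simp add: smult_r_distr smult_assoc1 subset_iff)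
      finally have "x = ?l \<oplus>\<^bsub>V\<^esub> (\<pi> [^] k \<odot>\<^bsub>V\<^esub> \<gamma> (R k) \<oplus>\<^bsub>V\<^esub> \<pi> [^] Suc k \<odot>\<^bsub>V\<^esub> R (Suc k))"
        using Suc by (rule subst)
      then show ?case
        unfolding 1 using M.a_assoc[OF l smult_closed[OF pK gV] smult_closed[OF pK RV]] by (rule trans[OF _ sym])
    qed
    have limits: "\<exists>l \<in> E. \<forall>k. nv (l \<ominus> s k g) \<le> nv \<pi> ^ k" for g
    proof (rule geometric_limit[OF subr E(2) sE])
      show "0 \<le> nv \<pi>" "nv \<pi> < 1" using \<pi> by auto
      fix k
      let ?d = "if g = \<gamma> (R k) then \<pi> [^] k else \<zero>"
      have d: "?d \<in> carrier K" using pK by simp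
      have "s (Suc k) g \<ominus> s k g = ?d"
      proof -
        have aux: "u \<oplus> v \<ominus> u = v" if "u \<in> carrier K" "v \<in> carrier K" for u v using that by algebra
        show ?thesis unfolding sSuc using sK d by (intro aux)
      qed
      then show "nv (s (Suc k) g \<ominus> s k g) \<le> nv \<pi> ^ k"
        using \<pi> EK by (auto simp: nv_pow)
    qed
    obtain a where a: "\<And>g. a g \<in> E" "\<And>g k. nv (a g \<ominus> s k g) \<le> nv \<pi> ^ k"
      using limits by metis
    have aK: "a g \<in> carrier K" for g using a(1) EK by blast
    have aGK: "a \<in> G \<rightarrow> carrier K" using aK by blast
    have "nv (a g) \<le> 1" for g using a(2)[of g 0] aK[of g] by (simp add: s0 a_minus_def)
    then have aS: "a \<in> G \<rightarrow> ?S" using a(1) by blast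
    let ?l = "lin G a (\<lambda>x. x)"
    have l: "?l \<in> carrier V" using aGK GV by (rule lin_closed)
    have xV: "x \<in> carrier V" using x LV by blast
    have "x \<ominus>\<^bsub>V\<^esub> ?l = \<zero>\<^bsub>V\<^esub>"
    proof (rule crd_inject)
      show "x \<ominus>\<^bsub>V\<^esub> ?l \<in> carrier V" using xV l by simp
      fix \<xi> assume \<xi>: "\<xi> \<in> X"
      \<comment> \<open>After k steps two errors remain, the term \<pi>^k R_k and the change of the
        coefficients from \<open>s k\<close> to their limits. Both are at most |\<pi>|^k, as the
        coordinates of elements of \<open>L\<close> are bounded by one.\<close>
      have small: "nv (crd \<xi> x \<ominus> crd \<xi> ?l) \<le> nv \<pi> ^ k" for k
      proof -
        let ?lk = "lin G (s k) (\<lambda>x. x)"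
        have lk: "?lk \<in> carrier V" using sGK GV by (rule lin_closed)
        have pR: "\<pi> [^] k \<odot>\<^bsub>V\<^esub> R k \<in> carrier V" using pK RV by simp
        have "crd \<xi> x = crd \<xi> ?lk \<oplus> \<pi> [^] k \<otimes> crd \<xi> (R k)"
          using xk[of k] crd_add[OF \<xi> lk pR] crd_smult[OF \<xi> pK RV] by metis
        moreover have c: "crd \<xi> ?lk \<in> carrier K" "crd \<xi> ?l \<in> carrier K" "crd \<xi> (R k) \<in> carrier K"
          using crd_closed[OF \<xi>] lk l RV by blast+
        moreover have "crd \<xi> ?lk \<oplus> \<pi> [^] k \<otimes> crd \<xi> (R k) \<ominus> crd \<xi> ?l =
            \<pi> [^] k \<otimes> crd \<xi> (R k) \<ominus> (crd \<xi> ?l \<ominus> crd \<xi> ?lk)"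
        proof -
          have aux: "u \<oplus> v \<ominus> w = v \<ominus> (w \<ominus> u)"
            if "u \<in> carrier K" "v \<in> carrier K" "w \<in> carrier K" for u v w
            using that by algebra
          show ?thesis using c pK[of k] by (intro aux) simp_all
        qed
        ultimately have "nv (crd \<xi> x \<ominus> crd \<xi> ?l) \<le>
            max (nv (\<pi> [^] k \<otimes> crd \<xi> (R k))) (nv (crd \<xi> ?l \<ominus> crd \<xi> ?lk))"
          using nv_diff[of "\<pi> [^] k \<otimes> crd \<xi> (R k)" "crd \<xi> ?l \<ominus> crd \<xi> ?lk"] pK[of k] by simp
        moreover have "nv (\<pi> [^] k \<otimes> crd \<xi> (R k)) \<le> nv \<pi> ^ k"
        proof -
          have "nv (\<pi> [^] k \<otimes> crd \<xi> (R k)) = nv \<pi> ^ k * nv (crd \<xi> (R k))"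
            using nv_mult[OF pK c(3)] nv_pow \<pi>(1) EK by auto
          also have "\<dots> \<le> nv \<pi> ^ k * 1"
            using L(2)[OF \<xi> RL] \<pi>(2) by (intro mult_left_mono) auto
          finally show ?thesis by simp
        qed
        moreover have "nv (crd \<xi> ?l \<ominus> crd \<xi> ?lk) \<le> nv \<pi> ^ k"
        proof -
          have dK: "(\<lambda>g. a g \<ominus> s k g) \<in> G \<rightarrow> carrier K" using aK sK by simp
          have "crd \<xi> ?l \<ominus> crd \<xi> ?lk = crd \<xi> (?l \<ominus>\<^bsub>V\<^esub> ?lk)"
            by (rule crd_diff[OF \<xi> l lk, symmetric])
          also have "?l \<ominus>\<^bsub>V\<^esub> ?lk = lin G (\<lambda>g. a g \<ominus> s k g) (\<lambda>x. x)"
            by (rule lin_diff[OF G(1) aGK sGK GV, symmetric])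
          also have "crd \<xi> \<dots> = (\<Oplus>g\<in>G. (a g \<ominus> s k g) \<otimes> crd \<xi> g)"
            by (rule crd_lin[OF \<xi> G(1) dK GV])
          also have "nv \<dots> \<le> nv \<pi> ^ k"
          proof (rule nv_finsum_le[OF G(1)])
            have cg: "crd \<xi> g \<in> carrier K" if "g \<in> G" for g using crd_closed[OF \<xi>] that GV by blast
            show "(\<lambda>g. (a g \<ominus> s k g) \<otimes> crd \<xi> g) \<in> G \<rightarrow> carrier K" using aK sK cg by simp
            fix g assume g: "g \<in> G"
            have "nv ((a g \<ominus> s k g) \<otimes> crd \<xi> g) = nv (a g \<ominus> s k g) * nv (crd \<xi> g)"
              using aK sK cg[OF g] by (simp add: nv_mult)
            also have "\<dots> \<le> nv \<pi> ^ k * 1"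
              using a(2) L(2)[OF \<xi>, of g] g G(2) \<pi>(2) nv_nonneg[OF cg[OF g]] by (intro mult_mono) auto
            finally show "nv ((a g \<ominus> s k g) \<otimes> crd \<xi> g) \<le> nv \<pi> ^ k" by simp
          qed (use \<pi>(2) in simp)
          finally show ?thesis .
        qed
        ultimately show ?thesis by linarith
      qed
      have cK: "crd \<xi> x \<ominus> crd \<xi> ?l \<in> carrier K" using crd_closed[OF \<xi>] xV l by simp
      have "nv (crd \<xi> x \<ominus> crd \<xi> ?l) = 0"
      proof (rule ccontr)
        assume "nv (crd \<xi> x \<ominus> crd \<xi> ?l) \<noteq> 0"
        then have "0 < nv (crd \<xi> x \<ominus> crd \<xi> ?l)" using nv_nonneg[OF cK] by linarith
        then obtain k where "nv \<pi> ^ k < nv (crd \<xi> x \<ominus> crd \<xi> ?l)" using real_arch_pow_inv \<pi>(3) by blast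
        then show False using small[of k] by linarith
      qed
      then show "crd \<xi> (x \<ominus>\<^bsub>V\<^esub> ?l) = \<zero>"
        using nv_eq_0_iff[OF cK] crd_diff[OF \<xi> xV l] by simp
    qed
    then have "x = ?l"
      by (rule M.eq_if_diff_zero[OF _ xV l])
    then show "x \<in> {lin G a (\<lambda>x. x) | a. a \<in> G \<rightarrow> ?S}"
      using aS by (intro CollectI exI[of _ a] conjI)
  qed
qed

text \<open>Two elements of \<open>L\<close> whose coordinates lie in the same balls of radius
  \<epsilon> |\<pi>| differ by \<pi> times an element of \<open>L\<close>: dividing their difference
  by \<pi> leads into the ball that \<open>L\<close> absorbs. Finitely many such balls cover the
  integers of \<open>K\<close>, so \<open>L\<close> is finite modulo \<pi> L.\<close>

lemma lattice_basis:
  assumes E: "subfield E K" "complete_valued (K\<lparr>carrier := E\<rparr>) nv"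
    and \<pi>: "\<pi> \<in> E" "0 < nv \<pi>" "nv \<pi> < 1"
    and tb: "\<And>\<delta>. 0 < \<delta> \<Longrightarrow> \<exists>T. finite T \<and> T \<subseteq> carrier K \<and>
      (\<forall>x \<in> carrier K. nv x \<le> 1 \<longrightarrow> (\<exists>t \<in> T. nv (x \<ominus> t) < \<delta>))"
    and W: "subspace E W" and L: "subspace {x \<in> E. nv x \<le> 1} L" "L \<subseteq> W"
      "\<And>\<xi> x. \<xi> \<in> X \<Longrightarrow> x \<in> L \<Longrightarrow> nv (crd \<xi> x) \<le> 1"
    and absorb: "0 < \<epsilon>" "\<And>x. x \<in> W \<Longrightarrow> (\<And>\<xi>. \<xi> \<in> X \<Longrightarrow> nv (crd \<xi> x) \<le> \<epsilon>) \<Longrightarrow> x \<in> L"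
  shows "\<exists>J b. basis_on {x \<in> E. nv x \<le> 1} L J (b :: 'b \<Rightarrow> 'b) \<and> basis_on E W J b"
proof -
  let ?S = "{x \<in> E. nv x \<le> 1}"
  have subr: "subring E K" using subfieldE(1)[OF E(1)] .
  have EK: "E \<subseteq> carrier K" using subringE(1)[OF subr] .
  have pK: "\<pi> \<in> carrier K" using \<pi>(1) EK by blast
  have p0: "\<pi> \<noteq> \<zero>" using \<pi>(2) by auto
  have pinv: "inv \<pi> \<in> E" "inv \<pi> \<in> carrier K"
    using subfield_m_inv(1)[OF E(1), of \<pi>] \<pi>(1) p0 EK by auto
  have WV: "W \<subseteq> carrier V" using W by (auto simp: subspace_def)
  let ?\<delta> = "\<epsilon> * nv \<pi>"
  have "0 < ?\<delta>" using absorb(1) \<pi>(2) by simp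
  from tb[OF this] obtain T where T: "finite T" "T \<subseteq> carrier K"
      "\<forall>x \<in> carrier K. nv x \<le> 1 \<longrightarrow> (\<exists>t \<in> T. nv (x \<ominus> t) < ?\<delta>)" by (elim exE conjE)
  \<comment> \<open>Records one centre from \<open>T\<close> for each coordinate; the value outside
    \<open>X\<close> is fixed, so there are finitely many codes.\<close>
  define code where "code x = (\<lambda>\<xi>\<in>X. SOME t. t \<in> T \<and> nv (crd \<xi> x \<ominus> t) < ?\<delta>)" for x
  have code: "code x \<xi> \<in> T" "nv (crd \<xi> x \<ominus> code x \<xi>) < ?\<delta>" if "x \<in> L" "\<xi> \<in> X" for x \<xi>
  proof -
    have "crd \<xi> x \<in> carrier K" using crd_closed that L(2) WV by blast
    then have "\<exists>t. t \<in> T \<and> nv (crd \<xi> x \<ominus> t) < ?\<delta>" using T(3) L(3)[OF that(2,1)] by auto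
    from someI_ex[OF this]
    show "code x \<xi> \<in> T" "nv (crd \<xi> x \<ominus> code x \<xi>) < ?\<delta>" using that(2) by (auto simp: code_def)
  qed
  have "code ` L \<subseteq> X \<rightarrow>\<^sub>E T" using code(1) by (auto simp: code_def)
  moreover have "finite (X \<rightarrow>\<^sub>E T)" using finite_X T(1) by (rule finite_PiE)
  ultimately have "finite (code ` L)" by (rule finite_subset)
  then obtain G where G: "G \<subseteq> L" "finite G" "code ` L = code ` G"
    using finite_subset_image[of "code ` L" code L] by auto
  have gen: "\<exists>g \<in> G. \<exists>y \<in> L. x = g \<oplus>\<^bsub>V\<^esub> \<pi> \<odot>\<^bsub>V\<^esub> y" if x: "x \<in> L" for x
  proof -
    have "code x \<in> code ` G" using x G(3) by blast
    then obtain g where g: "g \<in> G" "code x = code g" by blast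
    have gL: "g \<in> L" using g G by blast
    have V: "x \<in> carrier V" "g \<in> carrier V" using x gL L(2) WV by blast+
    let ?d = "x \<ominus>\<^bsub>V\<^esub> g"
    have dV: "?d \<in> carrier V" using V by simp
    have dW: "?d \<in> W" using subspace_minus[OF W subr] x gL L(2) by blast
    have "inv \<pi> \<odot>\<^bsub>V\<^esub> ?d \<in> L"
    proof (rule absorb(2))
      show "inv \<pi> \<odot>\<^bsub>V\<^esub> ?d \<in> W" using W dW pinv by (auto simp: subspace_def)
      fix \<xi> assume \<xi>: "\<xi> \<in> X"
      have c: "crd \<xi> x \<in> carrier K" "crd \<xi> g \<in> carrier K" "code x \<xi> \<in> carrier K"
        using crd_closed[OF \<xi>] V code(1)[OF x \<xi>] T(2) by blast+
      have "nv (crd \<xi> x \<ominus> crd \<xi> g) \<le> max (nv (crd \<xi> x \<ominus> code x \<xi>)) (nv (code x \<xi> \<ominus> crd \<xi> g))"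
        using nv_triangle[OF c(1,3,2)] .
      also have "\<dots> \<le> ?\<delta>"
        using code(2)[OF x \<xi>] code(2)[OF gL \<xi>] g(2) nv_diff_commute[OF c(3,2)] by simp
      finally have "nv (crd \<xi> ?d) \<le> ?\<delta>" using crd_diff[OF \<xi> V] by simp
      moreover have "nv (crd \<xi> (inv \<pi> \<odot>\<^bsub>V\<^esub> ?d)) = inverse (nv \<pi>) * nv (crd \<xi> ?d)"
        using crd_smult[OF \<xi> pinv(2) dV] nv_mult[OF pinv(2) crd_closed[OF \<xi> dV]] nv_inv[OF pK p0] by simp
      moreover have "inverse (nv \<pi>) * nv (crd \<xi> ?d) \<le> inverse (nv \<pi>) * ?\<delta>"
        using calculation(1) \<pi>(2) by (intro mult_left_mono) auto
      moreover have "inverse (nv \<pi>) * ?\<delta> = \<epsilon>" using \<pi>(2) by simp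
      ultimately show "nv (crd \<xi> (inv \<pi> \<odot>\<^bsub>V\<^esub> ?d)) \<le> \<epsilon>" by linarith
    qed
    moreover have "\<pi> \<odot>\<^bsub>V\<^esub> (inv \<pi> \<odot>\<^bsub>V\<^esub> ?d) = ?d"
      using smult_assoc1[OF pK pinv(2) dV] nonzero_inv[OF pK p0] dV by simp
    moreover have "x = g \<oplus>\<^bsub>V\<^esub> ?d"
      using V by (simp add: a_minus_def M.a_lcomm[of g x] M.r_neg)
    ultimately show ?thesis using g(1) by metis
  qed
  have "L = {lin G a (\<lambda>x. x) | a. a \<in> G \<rightarrow> ?S}"
    by (rule generators_of_generators_mod[OF E \<pi> L(1,3) G(2,1) gen])
  moreover have "(\<lambda>x. x) \<in> G \<rightarrow> carrier V" using G(1) L(2) WV by blast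
  ultimately obtain J where "basis_on ?S L J (\<lambda>x. x)"
    using valuation_ring_basis[OF E(1) G(2)] by blast
  moreover from basis_on_extend_scalars[OF E(1) \<pi> W L(2) absorb this]
  have "basis_on E W J (\<lambda>x. x)" .
  ultimately show ?thesis by blast
qed

end

section \<open>Skew polynomials and Petit algebras\<close>

text \<open>\<open>deg\<close> is the least bound of a coefficient sequence, taken from the
  commutative polynomial ring; skew polynomials share the underlying sequences, and the product does
  not enter.\<close>

lemma deg_eq:
  assumes "f \<in> up S" "f m \<noteq> \<zero>\<^bsub>S\<^esub>" "\<And>i. m < i \<Longrightarrow> f i = \<zero>\<^bsub>S\<^esub>"
  shows "deg S f = m"
  unfolding deg_def
proof (rule Least_equality)
  show "bound \<zero>\<^bsub>S\<^esub> m (coeff (UP S) f)" using assms by (auto simp: UP_def)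
  fix n assume "bound \<zero>\<^bsub>S\<^esub> n (coeff (UP S) f)"
  then have "bound \<zero>\<^bsub>S\<^esub> n f" using assms(1) by (simp add: UP_def)
  then show "m \<le> n" using assms(2) bound_below by metis
qed

lemma coeff_above_deg:
  assumes "f \<in> up S" "deg S f < i"
  shows "f i = \<zero>\<^bsub>S\<^esub>"
proof -
  obtain n where "bound \<zero>\<^bsub>S\<^esub> n f" using assms(1) unfolding up_def by blast
  then have "bound \<zero>\<^bsub>S\<^esub> n (coeff (UP S) f)" using assms(1) by (simp add: UP_def)
  then have "bound \<zero>\<^bsub>S\<^esub> (deg S f) (coeff (UP S) f)" unfolding deg_def by (rule LeastI)
  then have "bound \<zero>\<^bsub>S\<^esub> (deg S f) f" using assms(1) by (simp add: UP_def)
  then show ?thesis using assms(2) by (auto dest: bound.bound)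
qed

lemma upI:
  "(\<And>i. f i \<in> carrier S) \<Longrightarrow> (\<And>i. n \<le> i \<Longrightarrow> f i = \<zero>\<^bsub>S\<^esub>) \<Longrightarrow> f \<in> up S"
  unfolding up_def by (intro CollectI conjI exI[of _ n]) (auto simp: bound_def)

lemma (in ring) finsum_only:
  assumes "finite A" "i \<in> A" "f i \<in> carrier R" "\<And>j. j \<in> A \<Longrightarrow> j \<noteq> i \<Longrightarrow> f j = \<zero>"
  shows "(\<Oplus>j\<in>A. f j) = f i"
proof -
  have "(\<Oplus>j\<in>A. f j) = (\<Oplus>j\<in>insert i (A - {i}). f j)" using assms(2) by (simp add: insert_absorb)
  also have "\<dots> = f i \<oplus> (\<Oplus>j\<in>A - {i}. f j)"
    using assms by (intro finsum_insert) auto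
  also have "(\<Oplus>j\<in>A - {i}. f j) = \<zero>"
    using assms(4) by (intro add.finprod_one_eqI) auto
  finally show ?thesis using assms(3) by simp
qed

text \<open>The instances are \<open>D\<close>, its natural order and the quotient of that order.
  Right division by a monic polynomial twists the coefficients of the divisor, whose leading
  coefficient stays one.\<close>

locale skew_ring = ring S for S :: "'a ring" (structure) +
  fixes \<sigma> :: "'a \<Rightarrow> 'a"
  assumes twist_closed [simp]: "x \<in> carrier S \<Longrightarrow> \<sigma> x \<in> carrier S"
    and twist_one [simp]: "\<sigma> \<one> = \<one>"
    and twist_zero [simp]: "\<sigma> \<zero> = \<zero>"
begin

section \<open>Products and right division of skew polynomials\<close>

lemma twists [simp]:
  "x \<in> carrier S \<Longrightarrow> (\<sigma> ^^ k) x \<in> carrier S" "(\<sigma> ^^ k) \<one> = \<one>" "(\<sigma> ^^ k) \<zero> = \<zero>"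
  by (induction k) simp_all

lemma skew_mult: "(g \<otimes>\<^bsub>skew_poly S \<sigma>\<^esub> h) k = (\<Oplus>i\<in>{..k}. g i \<otimes> (\<sigma> ^^ i) (h (k - i)))"
  by (simp add: skew_poly_def)

lemma skew_mult_closed:
  assumes "g \<in> up S" "h \<in> up S"
  shows "g \<otimes>\<^bsub>skew_poly S \<sigma>\<^esub> h \<in> up S"
proof -
  have gh: "g i \<in> carrier S" "h i \<in> carrier S" for i using assms by (auto simp: up_def)
  obtain m where m: "\<And>i. m < i \<Longrightarrow> g i = \<zero>" using assms(1) unfolding up_def bound_def by blast
  obtain n where n: "\<And>i. n < i \<Longrightarrow> h i = \<zero>" using assms(2) unfolding up_def bound_def by blast
  show ?thesis
  proof (rule upI)
    show "(g \<otimes>\<^bsub>skew_poly S \<sigma>\<^esub> h) k \<in> carrier S" for k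
      unfolding skew_mult using gh by (intro finsum_closed) auto
    show "(g \<otimes>\<^bsub>skew_poly S \<sigma>\<^esub> h) k = \<zero>" if k: "Suc (m + n) \<le> k" for k
      unfolding skew_mult
    proof (rule add.finprod_one_eqI)
      fix i assume "i \<in> {..k}"
      show "g i \<otimes> (\<sigma> ^^ i) (h (k - i)) = \<zero>"
      proof (cases "m < i")
        case False
        then have "n < k - i" using k by simp
        then show ?thesis using n gh by simp
      qed (use m gh in simp)
    qed
  qed
qed

lemma monomial_mult:
  assumes "a \<in> carrier S" "h \<in> up S"
  shows "((\<lambda>i. if i = N then a else \<zero>) \<otimes>\<^bsub>skew_poly S \<sigma>\<^esub> h) k =
    (if N \<le> k then a \<otimes> (\<sigma> ^^ N) (h (k - N)) else \<zero>)"
proof -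
  have h: "h i \<in> carrier S" for i using assms(2) by (auto simp: up_def)
  show ?thesis
  proof (cases "N \<le> k")
    case True
    have "(\<Oplus>i\<in>{..k}. (if i = N then a else \<zero>) \<otimes> (\<sigma> ^^ i) (h (k - i))) =
        (if N = N then a else \<zero>) \<otimes> (\<sigma> ^^ N) (h (k - N))"
      using True assms(1) h by (intro finsum_only[where i = N]) auto
    then show ?thesis using True by (simp add: skew_mult)
  next
    case False
    have "(\<Oplus>i\<in>{..k}. (if i = N then a else \<zero>) \<otimes> (\<sigma> ^^ i) (h (k - i))) = \<zero>"
      using False h by (intro add.finprod_one_eqI) auto
    then show ?thesis using False by (simp add: skew_mult)
  qed
qed

lemma const_mult:
  assumes "a \<in> carrier S" "h \<in> up S"
  shows "const_seq S a \<otimes>\<^bsub>skew_poly S \<sigma>\<^esub> h = (\<lambda>k. a \<otimes> h k)"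
  using monomial_mult[OF assms, of 0] by (intro ext) (simp add: const_seq_def)

lemma mult_const:
  assumes "a \<in> carrier S" "h \<in> up S"
  shows "h \<otimes>\<^bsub>skew_poly S \<sigma>\<^esub> const_seq S a = (\<lambda>k. h k \<otimes> (\<sigma> ^^ k) a)"
proof
  fix k
  have h: "h i \<in> carrier S" for i using assms(2) by (auto simp: up_def)
  have "(\<Oplus>i\<in>{..k}. h i \<otimes> (\<sigma> ^^ i) (const_seq S a (k - i))) =
      h k \<otimes> (\<sigma> ^^ k) (const_seq S a (k - k))"
    using assms(1) h by (intro finsum_only[where i = k]) (auto simp: const_seq_def)
  then show "(h \<otimes>\<^bsub>skew_poly S \<sigma>\<^esub> const_seq S a) k = h k \<otimes> (\<sigma> ^^ k) a"
    by (simp add: skew_mult const_seq_def)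
qed

lemma skew_mult_add_left:
  assumes "g \<in> up S" "g' \<in> up S" "h \<in> up S"
  shows "(\<lambda>i. g i \<oplus> g' i) \<otimes>\<^bsub>skew_poly S \<sigma>\<^esub> h =
    (\<lambda>i. (g \<otimes>\<^bsub>skew_poly S \<sigma>\<^esub> h) i \<oplus> (g' \<otimes>\<^bsub>skew_poly S \<sigma>\<^esub> h) i)"
proof
  fix k
  have c: "g i \<in> carrier S" "g' i \<in> carrier S" "h i \<in> carrier S" for i using assms by (auto simp: up_def)
  have "(\<Oplus>i\<in>{..k}. (g i \<oplus> g' i) \<otimes> (\<sigma> ^^ i) (h (k - i))) =
      (\<Oplus>i\<in>{..k}. g i \<otimes> (\<sigma> ^^ i) (h (k - i)) \<oplus> g' i \<otimes> (\<sigma> ^^ i) (h (k - i)))"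
    using c by (intro finsum_cong') (auto simp: l_distr)
  also have "\<dots> = (\<Oplus>i\<in>{..k}. g i \<otimes> (\<sigma> ^^ i) (h (k - i))) \<oplus> (\<Oplus>i\<in>{..k}. g' i \<otimes> (\<sigma> ^^ i) (h (k - i)))"
    using c by (intro finsum_addf) auto
  finally show "((\<lambda>i. g i \<oplus> g' i) \<otimes>\<^bsub>skew_poly S \<sigma>\<^esub> h) k =
      (g \<otimes>\<^bsub>skew_poly S \<sigma>\<^esub> h) k \<oplus> (g' \<otimes>\<^bsub>skew_poly S \<sigma>\<^esub> h) k"
    by (simp add: skew_mult)
qed

text \<open>The degree is an explicit parameter shared by a polynomial and its reduction; it agrees
  with \<open>deg\<close> as soon as one differs from zero.\<close>

definition monic_of_degree :: "nat \<Rightarrow> (nat \<Rightarrow> 'a) \<Rightarrow> bool" where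
  "monic_of_degree m f \<longleftrightarrow> f \<in> up S \<and> f m = \<one> \<and> (\<forall>i>m. f i = \<zero>)"

lemma deg_monic: "monic_of_degree m f \<Longrightarrow> \<one> \<noteq> \<zero> \<Longrightarrow> deg S f = m"
  by (intro deg_eq) (auto simp: monic_of_degree_def)

text \<open>The product of a t^N with the monic \<open>f\<close> has top coefficient a \<sigma>^N(1)
  = a, so subtracting it removes the top coefficient a of the dividend without any
  inversion.\<close>

lemma division_exists:
  assumes f: "monic_of_degree m f" and h: "h \<in> up S"
  shows "\<exists>q \<in> up S. \<exists>r \<in> deg_below S m. h = (\<lambda>i. (q \<otimes>\<^bsub>skew_poly S \<sigma>\<^esub> f) i \<oplus> r i)"
proof -
  have f': "f \<in> up S" "f m = \<one>" "\<And>i. m < i \<Longrightarrow> f i = \<zero>" using f by (auto simp: monic_of_degree_def)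
  have fc: "f i \<in> carrier S" for i using f'(1) by (auto simp: up_def)
  have step: "\<exists>q \<in> up S. \<exists>r \<in> deg_below S m. h = (\<lambda>i. (q \<otimes>\<^bsub>skew_poly S \<sigma>\<^esub> f) i \<oplus> r i)"
    if "h \<in> up S" "\<And>i. m + N \<le> i \<Longrightarrow> h i = \<zero>" for N h
    using that
  proof (induction N arbitrary: h)
    case 0
    let ?z = "\<lambda>i::nat. \<zero>"
    have "?z \<in> up S" by (rule upI[where n = 0]) auto
    moreover have "?z \<otimes>\<^bsub>skew_poly S \<sigma>\<^esub> f = ?z"
      using fc by (intro ext) (simp add: skew_mult)
    moreover have "h \<in> deg_below S m" using 0 by (simp add: deg_below_def)
    moreover have "h = (\<lambda>i. \<zero> \<oplus> h i)" using mem_upD[OF 0(1)] by (intro ext) simp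
    ultimately show ?case by metis
  next
    case (Suc N)
    have hc: "h i \<in> carrier S" for i using Suc.prems(1) by (auto simp: up_def)
    define a where "a = h (m + N)"
    have aS: "a \<in> carrier S" using hc by (simp add: a_def)
    define q0 where "q0 = (\<lambda>i. if i = N then a else \<zero>)"
    have q0: "q0 \<in> up S" unfolding q0_def using aS by (intro upI[where n = "Suc N"]) auto
    note q0f = monomial_mult[OF aS f'(1), of N, folded q0_def]
    have q0fc: "(q0 \<otimes>\<^bsub>skew_poly S \<sigma>\<^esub> f) i \<in> carrier S" for i using q0f aS fc by simp
    define h' where "h' i = h i \<ominus> (q0 \<otimes>\<^bsub>skew_poly S \<sigma>\<^esub> f) i" for i
    have h'c: "h' i \<in> carrier S" for i using hc q0fc by (simp add: h'_def)
    have h'0: "h' i = \<zero>" if "m + N \<le> i" for i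
    proof (cases "i = m + N")
      case True
      then have "(q0 \<otimes>\<^bsub>skew_poly S \<sigma>\<^esub> f) i = a" using q0f[of i] f'(2) aS by simp
      then show ?thesis using True aS by (simp add: h'_def a_def r_right_minus_eq)
    next
      case False
      then have "m < i - N" "m + Suc N \<le> i" using that by auto
      then have "(q0 \<otimes>\<^bsub>skew_poly S \<sigma>\<^esub> f) i = \<zero>" "h i = \<zero>" using q0f[of i] f'(3) aS Suc.prems(2) by auto
      then show ?thesis by (simp add: h'_def)
    qed
    have "h' \<in> up S" using h'c h'0 by (rule upI)
    then obtain q r where qr: "q \<in> up S" "r \<in> deg_below S m"
        "h' = (\<lambda>i. (q \<otimes>\<^bsub>skew_poly S \<sigma>\<^esub> f) i \<oplus> r i)"
      using Suc.IH[of h'] h'0 by blast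
    have qfc: "(q \<otimes>\<^bsub>skew_poly S \<sigma>\<^esub> f) i \<in> carrier S" for i
      using skew_mult_closed[OF qr(1) f'(1)] by (auto simp: up_def)
    have rc: "r i \<in> carrier S" for i using qr(2) by (auto simp: deg_below_def up_def)
    have "h i = ((\<lambda>i. q0 i \<oplus> q i) \<otimes>\<^bsub>skew_poly S \<sigma>\<^esub> f) i \<oplus> r i" for i
    proof -
      have "h i = (q0 \<otimes>\<^bsub>skew_poly S \<sigma>\<^esub> f) i \<oplus> h' i"
      proof -
        have "u = v \<oplus> (u \<ominus> v)" if "u \<in> carrier S" "v \<in> carrier S" for u v
          using that by (simp add: a_minus_def a_lcomm[of v u] r_neg)
        then show ?thesis using hc q0fc by (simp add: h'_def)
      qed
      also have "h' i = (q \<otimes>\<^bsub>skew_poly S \<sigma>\<^esub> f) i \<oplus> r i" by (simp add: qr(3))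
      finally show ?thesis
        using skew_mult_add_left[OF q0 qr(1) f'(1)] q0fc[of i] qfc[of i] rc[of i] by (simp add: a_assoc)
    qed
    then show ?case using up_add_closed[OF q0 qr(1)] qr(2) by blast
  qed
  obtain n where n: "\<And>i. n < i \<Longrightarrow> h i = \<zero>" using h unfolding up_def bound_def by blast
  show ?thesis by (rule step[OF h, of "Suc n"]) (simp add: n)
qed

text \<open>The remainders do not reach degree m, and the coefficient of the product at k + m is the
  k-th coefficient of the quotient plus terms with later ones. Comparing from the top down shows
  that the quotients agree.\<close>

lemma division_unique:
  assumes f: "monic_of_degree m f"
    and q: "q \<in> up S" "q' \<in> up S" and r: "r \<in> deg_below S m" "r' \<in> deg_below S m"
    and eq: "\<And>i. (q \<otimes>\<^bsub>skew_poly S \<sigma>\<^esub> f) i \<oplus> r i = (q' \<otimes>\<^bsub>skew_poly S \<sigma>\<^esub> f) i \<oplus> r' i"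
  shows "r = r'"
proof -
  have f': "f \<in> up S" "f m = \<one>" "\<And>i. m < i \<Longrightarrow> f i = \<zero>" using f by (auto simp: monic_of_degree_def)
  have fc: "f i \<in> carrier S" for i using f'(1) by (auto simp: up_def)
  have qc: "q i \<in> carrier S" "q' i \<in> carrier S" for i using q by (auto simp: up_def)
  have rc: "r i \<in> carrier S" "r' i \<in> carrier S" for i using r by (auto simp: deg_below_def up_def)
  have r0: "r i = \<zero>" "r' i = \<zero>" if "m \<le> i" for i using r that by (auto simp: deg_below_def)
  obtain n1 where n1: "\<And>i. n1 < i \<Longrightarrow> q i = \<zero>" using q(1) unfolding up_def bound_def by blast
  obtain n2 where n2: "\<And>i. n2 < i \<Longrightarrow> q' i = \<zero>" using q(2) unfolding up_def bound_def by blast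
  have qf: "(p \<otimes>\<^bsub>skew_poly S \<sigma>\<^esub> f) (k + m) =
      p k \<oplus> (\<Oplus>i\<in>{k<..k + m}. p i \<otimes> (\<sigma> ^^ i) (f (k + m - i)))"
    if p: "\<And>i. p i \<in> carrier S" for p k
  proof -
    have "(p \<otimes>\<^bsub>skew_poly S \<sigma>\<^esub> f) (k + m) = (\<Oplus>i\<in>insert k ({..<k} \<union> {k<..k + m}). p i \<otimes> (\<sigma> ^^ i) (f (k + m - i)))"
      unfolding skew_mult by (rule arg_cong[of _ _ "finsum S _"]) auto
    also have "\<dots> = p k \<otimes> (\<sigma> ^^ k) (f (k + m - k)) \<oplus>
        (\<Oplus>i\<in>{..<k} \<union> {k<..k + m}. p i \<otimes> (\<sigma> ^^ i) (f (k + m - i)))"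
      using p fc by (intro finsum_insert) auto
    also have "(\<Oplus>i\<in>{..<k} \<union> {k<..k + m}. p i \<otimes> (\<sigma> ^^ i) (f (k + m - i))) =
        (\<Oplus>i\<in>{..<k}. p i \<otimes> (\<sigma> ^^ i) (f (k + m - i))) \<oplus>
        (\<Oplus>i\<in>{k<..k + m}. p i \<otimes> (\<sigma> ^^ i) (f (k + m - i)))"
      using p fc by (intro finsum_Un_disjoint) auto
    also have "(\<Oplus>i\<in>{..<k}. p i \<otimes> (\<sigma> ^^ i) (f (k + m - i))) = \<zero>"
      using p f'(3) by (intro add.finprod_one_eqI) auto
    finally show ?thesis using p fc f'(2) by simp
  qed
  have qq: "q k = q' k" for k
  \<comment> \<open>Descending induction on k; beyond n1 + n2 both quotients vanish.\<close>
  proof (induction "n1 + n2 - k" arbitrary: k rule: less_induct)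
    case less
    show ?case
    proof (cases "n1 + n2 < k")
      case False
      have "(\<Oplus>i\<in>{k<..k + m}. q i \<otimes> (\<sigma> ^^ i) (f (k + m - i))) =
          (\<Oplus>i\<in>{k<..k + m}. q' i \<otimes> (\<sigma> ^^ i) (f (k + m - i)))"
      proof (rule finsum_cong'[OF refl])
        fix i assume "i \<in> {k<..k + m}"
        then have "q i = q' i" using less False by (cases "n1 + n2 < i") (auto simp: n1 n2)
        then show "q i \<otimes> (\<sigma> ^^ i) (f (k + m - i)) = q' i \<otimes> (\<sigma> ^^ i) (f (k + m - i))" by simp
      qed (use qc fc in auto)
      moreover have "(\<Oplus>i\<in>{k<..k + m}. q' i \<otimes> (\<sigma> ^^ i) (f (k + m - i))) \<in> carrier S"
        using qc fc by (intro finsum_closed) auto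
      moreover have "(q \<otimes>\<^bsub>skew_poly S \<sigma>\<^esub> f) (k + m) = (q' \<otimes>\<^bsub>skew_poly S \<sigma>\<^esub> f) (k + m)"
        using eq[of "k + m"] r0[of "k + m"] skew_mult_closed[OF q(1) f'(1)] skew_mult_closed[OF q(2) f'(1)]
        by (simp add: mem_upD)
      ultimately show ?thesis
        using qf[of q k] qf[of q' k] qc by (simp add: add.right_cancel)
    qed (simp add: n1 n2)
  qed
  have "r i = r' i" for i
  proof -
    have "(q \<otimes>\<^bsub>skew_poly S \<sigma>\<^esub> f) i \<in> carrier S" using skew_mult_closed[OF q(1) f'(1)] by (simp add: mem_upD)
    moreover have "q = q'" using qq by (rule ext)
    ultimately show ?thesis using eq[of i] rc[of i] by (metis a_comm add.right_cancel)
  qed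
  then show ?thesis by (rule ext)
qed

lemma right_mod_eqI:
  assumes "monic_of_degree m f" "\<one> \<noteq> \<zero>" "q \<in> up S" "r \<in> deg_below S m"
    and "h = (\<lambda>i. (q \<otimes>\<^bsub>skew_poly S \<sigma>\<^esub> f) i \<oplus> r i)"
  shows "right_mod S \<sigma> f h = r"
  unfolding right_mod_def deg_monic[OF assms(1,2)]
proof (rule the_equality)
  show "r \<in> deg_below S m \<and> (\<exists>q\<in>carrier (skew_poly S \<sigma>).
      h = q \<otimes>\<^bsub>skew_poly S \<sigma>\<^esub> f \<oplus>\<^bsub>skew_poly S \<sigma>\<^esub> r)"
    using assms(3-5) by (auto simp: skew_poly_def)
  fix r' assume r': "r' \<in> deg_below S m \<and> (\<exists>q\<in>carrier (skew_poly S \<sigma>).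
      h = q \<otimes>\<^bsub>skew_poly S \<sigma>\<^esub> f \<oplus>\<^bsub>skew_poly S \<sigma>\<^esub> r')"
  then obtain q' where q': "q' \<in> up S" "h = q' \<otimes>\<^bsub>skew_poly S \<sigma>\<^esub> f \<oplus>\<^bsub>skew_poly S \<sigma>\<^esub> r'"
    by (auto simp: skew_poly_def)
  have "h = (\<lambda>i. (q' \<otimes>\<^bsub>skew_poly S \<sigma>\<^esub> f) i \<oplus> r' i)" using q'(2) by (simp add: skew_poly_def)
  then show "r' = r"
    using fun_cong[OF trans[OF sym assms(5)]] r'
    by (intro division_unique[OF assms(1) q'(1) assms(3) _ assms(4)]) blast+
qed

section \<open>Petit algebras of monic polynomials\<close>

lemma right_mod_small:
  assumes "monic_of_degree m f" "\<one> \<noteq> \<zero>" "h \<in> deg_below S m"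
  shows "right_mod S \<sigma> f h = h"
proof (rule right_mod_eqI[OF assms(1,2) _ assms(3)])
  let ?z = "\<lambda>i::nat. \<zero>"
  have fc: "f i \<in> carrier S" for i using assms(1) by (auto simp: monic_of_degree_def up_def)
  show "?z \<in> up S" by (rule upI[where n = 0]) auto
  have "?z \<otimes>\<^bsub>skew_poly S \<sigma>\<^esub> f = ?z" using fc by (intro ext) (simp add: skew_mult)
  then show "h = (\<lambda>i. (?z \<otimes>\<^bsub>skew_poly S \<sigma>\<^esub> f) i \<oplus> h i)"
    using assms(3) by (intro ext) (simp add: deg_below_def mem_upD)
qed

text \<open>The product need not be associative, so of the ring axioms the additive ones are what
  can be relied on.\<close>

lemma abelian_group_petit: "abelian_group (petit S \<sigma> f)"
proof (rule abelian_groupI)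
  fix x assume x: "x \<in> carrier (petit S \<sigma> f)"
  then have xc: "x i \<in> carrier S" for i by (auto simp: petit_def deg_below_def up_def)
  have "(\<lambda>i. \<ominus> x i) \<in> deg_below S (deg S f)"
    using x up_a_inv_closed by (auto simp: petit_def deg_below_def)
  then show "\<exists>y \<in> carrier (petit S \<sigma> f). y \<oplus>\<^bsub>petit S \<sigma> f\<^esub> x = \<zero>\<^bsub>petit S \<sigma> f\<^esub>"
    using xc by (intro bexI[of _ "\<lambda>i. \<ominus> x i"]) (auto simp: petit_def skew_poly_def l_neg)
next
  show "\<zero>\<^bsub>petit S \<sigma> f\<^esub> \<in> carrier (petit S \<sigma> f)"
    by (auto simp: petit_def skew_poly_def deg_below_def intro: upI)
next
  fix x y assume "x \<in> carrier (petit S \<sigma> f)" "y \<in> carrier (petit S \<sigma> f)"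
  then show "x \<oplus>\<^bsub>petit S \<sigma> f\<^esub> y \<in> carrier (petit S \<sigma> f)"
    using up_add_closed by (auto simp: petit_def skew_poly_def deg_below_def)
qed (auto simp: petit_def skew_poly_def deg_below_def mem_upD a_ac)

lemma petit_simps:
  assumes "monic_of_degree m f" "\<one> \<noteq> \<zero>"
  shows "carrier (petit S \<sigma> f) = deg_below S m"
    "x \<otimes>\<^bsub>petit S \<sigma> f\<^esub> y = right_mod S \<sigma> f (x \<otimes>\<^bsub>skew_poly S \<sigma>\<^esub> y)"
    "x \<oplus>\<^bsub>petit S \<sigma> f\<^esub> y = (\<lambda>i. x i \<oplus> y i)" "\<zero>\<^bsub>petit S \<sigma> f\<^esub> = (\<lambda>i. \<zero>)"
  by (simp_all add: petit_def skew_poly_def deg_monic[OF assms])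

text \<open>A constant factor does not raise the degree, so no reduction modulo \<open>f\<close>
  takes place.\<close>

lemma petit_const_mult:
  assumes f: "monic_of_degree m f" "\<one> \<noteq> \<zero>" and a: "a \<in> carrier S" and x: "x \<in> deg_below S m"
  shows "const_seq S a \<otimes>\<^bsub>petit S \<sigma> f\<^esub> x = (\<lambda>i. a \<otimes> x i)"
proof -
  have "x \<in> up S" using x by (simp add: deg_below_def)
  then have "(\<lambda>i. a \<otimes> x i) \<in> deg_below S m"
    using x a up_smult_closed by (auto simp: deg_below_def)
  then show ?thesis
    using const_mult[OF a \<open>x \<in> up S\<close>] right_mod_small[OF f] by (simp add: petit_simps[OF f])
qed

lemma petit_mult_const:
  assumes f: "monic_of_degree m f" "\<one> \<noteq> \<zero>" and a: "a \<in> carrier S" and x: "x \<in> deg_below S m"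
  shows "x \<otimes>\<^bsub>petit S \<sigma> f\<^esub> const_seq S a = (\<lambda>i. x i \<otimes> (\<sigma> ^^ i) a)"
proof -
  have xc: "x i \<in> carrier S" for i using x by (auto simp: deg_below_def up_def)
  have x0: "x i = \<zero>" if "m \<le> i" for i using x that by (auto simp: deg_below_def)
  have "(\<lambda>i. x i \<otimes> (\<sigma> ^^ i) a) \<in> up S"
    using xc x0 a by (intro upI[where n = m]) auto
  then have "(\<lambda>i. x i \<otimes> (\<sigma> ^^ i) a) \<in> deg_below S m"
    using x0 a by (auto simp: deg_below_def)
  moreover have "x \<in> up S" using x by (simp add: deg_below_def)
  ultimately show ?thesis
    using mult_const[OF a] right_mod_small[OF f] by (simp add: petit_simps[OF f])
qed

end

section \<open>Compatibility of Petit algebras with ring homomorphisms\<close>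

locale skew_ring_hom = S: skew_ring S \<sigma> + S': skew_ring S' \<sigma>'
  for S :: "'a ring" and \<sigma> and S' :: "'b ring" and \<sigma>' +
  fixes \<phi> :: "'a \<Rightarrow> 'b"
  assumes hom: "\<phi> \<in> ring_hom S S'"
    and commutes: "x \<in> carrier S \<Longrightarrow> \<phi> (\<sigma> x) = \<sigma>' (\<phi> x)"
begin

sublocale hom: ring_hom_ring S S' \<phi>
  by (rule ring_hom_ringI2[OF S.ring_axioms S'.ring_axioms hom])

lemma commutes_pow: "x \<in> carrier S \<Longrightarrow> \<phi> ((\<sigma> ^^ k) x) = (\<sigma>' ^^ k) (\<phi> x)"
  by (induction k) (simp_all add: commutes)

lemma map_up: "g \<in> up S \<Longrightarrow> (\<lambda>i. \<phi> (g i)) \<in> up S'"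
proof -
  assume g: "g \<in> up S"
  obtain n where n: "\<And>i. n < i \<Longrightarrow> g i = \<zero>\<^bsub>S\<^esub>" using g unfolding up_def bound_def by blast
  show "(\<lambda>i. \<phi> (g i)) \<in> up S'"
    using g n by (intro upI[where n = "Suc n"]) (auto simp: mem_upD)
qed

lemma map_deg_below: "g \<in> deg_below S m \<Longrightarrow> (\<lambda>i. \<phi> (g i)) \<in> deg_below S' m"
  using map_up by (auto simp: deg_below_def)

lemma map_monic: "S.monic_of_degree m f \<Longrightarrow> S'.monic_of_degree m (\<lambda>i. \<phi> (f i))"
  using map_up by (auto simp: S.monic_of_degree_def S'.monic_of_degree_def)

lemma map_skew_mult:
  assumes "g \<in> up S" "h \<in> up S"
  shows "\<phi> ((g \<otimes>\<^bsub>skew_poly S \<sigma>\<^esub> h) k) = ((\<lambda>i. \<phi> (g i)) \<otimes>\<^bsub>skew_poly S' \<sigma>'\<^esub> (\<lambda>i. \<phi> (h i))) k"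
proof -
  have c: "g i \<in> carrier S" "h i \<in> carrier S" for i using assms by (auto simp: up_def)
  have "\<phi> (\<Oplus>\<^bsub>S\<^esub>i\<in>{..k}. g i \<otimes>\<^bsub>S\<^esub> (\<sigma> ^^ i) (h (k - i))) =
      (\<Oplus>\<^bsub>S'\<^esub>i\<in>{..k}. \<phi> (g i \<otimes>\<^bsub>S\<^esub> (\<sigma> ^^ i) (h (k - i))))"
    using hom.hom_finsum[of "\<lambda>i. g i \<otimes>\<^bsub>S\<^esub> (\<sigma> ^^ i) (h (k - i))" "{..k}"] c by (simp add: comp_def)
  also have "\<dots> = (\<Oplus>\<^bsub>S'\<^esub>i\<in>{..k}. \<phi> (g i) \<otimes>\<^bsub>S'\<^esub> (\<sigma>' ^^ i) (\<phi> (h (k - i))))"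
    using c by (intro S'.finsum_cong') (auto simp: commutes_pow)
  finally show ?thesis by (simp add: S.skew_mult S'.skew_mult)
qed

text \<open>A homomorphism that commutes with the twists carries a division with remainder to one by
  the image of \<open>f\<close>, which is again monic of degree m; uniqueness identifies the
  remainders.\<close>

lemma map_right_mod:
  assumes f: "S.monic_of_degree m f" and ne: "\<one>\<^bsub>S\<^esub> \<noteq> \<zero>\<^bsub>S\<^esub>" "\<one>\<^bsub>S'\<^esub> \<noteq> \<zero>\<^bsub>S'\<^esub>" and h: "h \<in> up S"
  shows "(\<lambda>i. \<phi> (right_mod S \<sigma> f h i)) = right_mod S' \<sigma>' (\<lambda>i. \<phi> (f i)) (\<lambda>i. \<phi> (h i))"
    "right_mod S \<sigma> f h \<in> deg_below S m"
proof -
  obtain q r where qr: "q \<in> up S" "r \<in> deg_below S m" "h = (\<lambda>i. (q \<otimes>\<^bsub>skew_poly S \<sigma>\<^esub> f) i \<oplus>\<^bsub>S\<^esub> r i)"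
    using S.division_exists[OF f h] by blast
  have r: "right_mod S \<sigma> f h = r" by (rule S.right_mod_eqI[OF f ne(1) qr])
  then show "right_mod S \<sigma> f h \<in> deg_below S m" using qr(2) by simp
  have fu: "f \<in> up S" using f by (simp add: S.monic_of_degree_def)
  have "right_mod S' \<sigma>' (\<lambda>i. \<phi> (f i)) (\<lambda>i. \<phi> (h i)) = (\<lambda>i. \<phi> (r i))"
  proof (rule S'.right_mod_eqI[OF map_monic[OF f] ne(2) map_up[OF qr(1)] map_deg_below[OF qr(2)]])
    have c: "(q \<otimes>\<^bsub>skew_poly S \<sigma>\<^esub> f) i \<in> carrier S" "r i \<in> carrier S" for i
      using S.skew_mult_closed[OF qr(1) fu] qr(2) by (auto simp: deg_below_def mem_upD)
    show "(\<lambda>i. \<phi> (h i)) = (\<lambda>i. ((\<lambda>i. \<phi> (q i)) \<otimes>\<^bsub>skew_poly S' \<sigma>'\<^esub> (\<lambda>i. \<phi> (f i))) i \<oplus>\<^bsub>S'\<^esub> \<phi> (r i))"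
      unfolding qr(3) using c by (simp add: map_skew_mult[OF qr(1) fu, symmetric])
  qed
  then show "(\<lambda>i. \<phi> (right_mod S \<sigma> f h i)) = right_mod S' \<sigma>' (\<lambda>i. \<phi> (f i)) (\<lambda>i. \<phi> (h i))" using r by simp
qed

lemma map_petit_mult:
  assumes f: "S.monic_of_degree m f" and ne: "\<one>\<^bsub>S\<^esub> \<noteq> \<zero>\<^bsub>S\<^esub>" "\<one>\<^bsub>S'\<^esub> \<noteq> \<zero>\<^bsub>S'\<^esub>"
    and "g \<in> deg_below S m" "h \<in> deg_below S m"
  shows "(\<lambda>i. \<phi> ((g \<otimes>\<^bsub>petit S \<sigma> f\<^esub> h) i)) =
      (\<lambda>i. \<phi> (g i)) \<otimes>\<^bsub>petit S' \<sigma>' (\<lambda>i. \<phi> (f i))\<^esub> (\<lambda>i. \<phi> (h i))"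
    "g \<otimes>\<^bsub>petit S \<sigma> f\<^esub> h \<in> deg_below S m"
proof -
  have gh: "g \<in> up S" "h \<in> up S" using assms by (auto simp: deg_below_def)
  note m = map_right_mod[OF f ne S.skew_mult_closed[OF gh]]
  show "g \<otimes>\<^bsub>petit S \<sigma> f\<^esub> h \<in> deg_below S m" using m(2) by (simp add: S.petit_simps[OF f ne(1)])
  show "(\<lambda>i. \<phi> ((g \<otimes>\<^bsub>petit S \<sigma> f\<^esub> h) i)) =
      (\<lambda>i. \<phi> (g i)) \<otimes>\<^bsub>petit S' \<sigma>' (\<lambda>i. \<phi> (f i))\<^esub> (\<lambda>i. \<phi> (h i))"
    using m(1) map_skew_mult[OF gh] by (simp add: S.petit_simps[OF f ne(1)] S'.petit_simps[OF map_monic[OF f] ne(2)])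
qed

end

section \<open>Orders in cyclic algebras\<close>

lemma (in vector_module) subspace_submodule:
  assumes "subspace S L" "subring S K"
  shows "submodule L (K\<lparr>carrier := S\<rparr>) V"
proof -
  have L: "L \<subseteq> carrier V" "\<zero>\<^bsub>V\<^esub> \<in> L" "\<And>x y. x \<in> L \<Longrightarrow> y \<in> L \<Longrightarrow> x \<oplus>\<^bsub>V\<^esub> y \<in> L"
    "\<And>s x. s \<in> S \<Longrightarrow> x \<in> L \<Longrightarrow> s \<odot>\<^bsub>V\<^esub> x \<in> L"
    using assms(1) by (auto simp: subspace_def)
  have "\<ominus>\<^bsub>V\<^esub> x \<in> L" if "x \<in> L" for x
    using subspace_minus[OF assms L(2) that] that L(1) by (auto simp: a_minus_def)
  then have "subgroup L (add_monoid V)"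
    using L by (intro subgroup.intro) (auto simp flip: a_inv_def)
  then show ?thesis
    using L(4) by (intro submodule.intro submodule_axioms.intro) auto
qed

lemma ring_isoD:
  assumes "h \<in> ring_iso R S"
  shows "h \<in> ring_hom R S" "h ` carrier R = carrier S"
  using assms by (auto simp: ring_iso_def bij_betw_def)

text \<open>That \<tau> preserves the integers is postulated here, since it depends on completeness
  and discreteness, which \<open>valued_field\<close> does not provide. The ring laws of
  \<open>D\<close> are postulated as well: they come with the hypothesis that \<open>D\<close> is a
  division algebra, not from the product formula.\<close>

locale cyclic_order = valued_field K nv
  for K :: "'a ring" (structure) and nv +
  fixes F :: "'a set" and n :: nat and \<tau> :: "'a \<Rightarrow> 'a" and c :: 'a
    and D \<D> :: "(nat \<Rightarrow> 'a) ring"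
  assumes F: "subfield F K"
    and \<tau>_hom: "\<tau> \<in> ring_hom K K"
    and \<tau>_fixes: "x \<in> F \<Longrightarrow> \<tau> x = x"
    and \<tau>_integral: "\<lbrakk>x \<in> carrier K; nv x \<le> 1\<rbrakk> \<Longrightarrow> nv (\<tau> x) \<le> 1"
    and c: "c \<in> F" "nv c \<le> 1"
    and D_def: "D = cyclic_algebra K n \<tau> c"
    and D_ring: "ring D" and D_nontriv: "\<one>\<^bsub>D\<^esub> \<noteq> \<zero>\<^bsub>D\<^esub>"
    and order_def: "\<D> = natural_order (integers_of K nv) D"
begin

sublocale D: ring D by (rule D_ring)

lemma FK: "x \<in> F \<Longrightarrow> x \<in> carrier K"
  using subfieldE(3)[OF F] by blast

lemma cK: "c \<in> carrier K" using FK c(1) .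

lemma D_carrier: "carrier D = {x. (\<forall>i. x i \<in> carrier K) \<and> (\<forall>i\<ge>n. x i = \<zero>)}"
  by (auto simp: D_def cyclic_algebra_def)

lemma D_coeff: "x \<in> carrier D \<Longrightarrow> x i \<in> carrier K"
  by (simp add: D_carrier)

lemma D_add: "x \<oplus>\<^bsub>D\<^esub> y = (\<lambda>i. x i \<oplus> y i)"
  and D_zero: "\<zero>\<^bsub>D\<^esub> = (\<lambda>i. \<zero>)"
  and D_one: "\<one>\<^bsub>D\<^esub> = const_seq K \<one>"
  by (simp_all add: D_def cyclic_algebra_def)

section \<open>Multiplication by constants in the cyclic algebra\<close>

lemma D_mult: "(x \<otimes>\<^bsub>D\<^esub> y) k = (\<Oplus>i\<in>{..<n}. \<Oplus>j\<in>{..<n}.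
    if (i + j) mod n = k
    then x i \<otimes> (\<tau> ^^ i) (y j) \<otimes> (if i + j < n then \<one> else c) else \<zero>)"
  by (simp add: D_def cyclic_algebra_def)

lemma n_pos: "0 < n"
proof (rule ccontr)
  assume "\<not> 0 < n"
  then have "\<one>\<^bsub>D\<^esub> 0 = \<zero>" using D.one_closed by (simp add: D_carrier)
  then show False by (simp add: D_one const_seq_def)
qed

lemma const_closed: "a \<in> carrier K \<Longrightarrow> const_seq K a \<in> carrier D"
  using n_pos by (auto simp: D_carrier const_seq_def)

lemma \<tau>_closed [simp]: "x \<in> carrier K \<Longrightarrow> (\<tau> ^^ i) x \<in> carrier K"
  by (induction i) (use ring_hom_closed[OF \<tau>_hom] in auto)

lemma \<tau>_zero [simp]: "(\<tau> ^^ i) \<zero> = \<zero>"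
proof (induction i)
  case (Suc i)
  have "\<tau> \<zero> = \<zero>"
    using ring_hom_zero[OF \<tau>_hom] ring_axioms by blast
  then show ?case using Suc by simp
qed simp

lemma \<tau>_pow_fixes: "x \<in> F \<Longrightarrow> (\<tau> ^^ i) x = x"
  by (induction i) (simp_all add: \<tau>_fixes)

lemma \<tau>_pow_integral: "x \<in> carrier K \<Longrightarrow> nv x \<le> 1 \<Longrightarrow> nv ((\<tau> ^^ i) x) \<le> 1"
  by (induction i) (simp_all add: \<tau>_integral)

lemma term_closed:
  assumes "x \<in> carrier D" "y \<in> carrier D"
  shows "(if (i + j) mod n = k
    then x i \<otimes> (\<tau> ^^ i) (y j) \<otimes> (if i + j < n then \<one> else c) else \<zero>) \<in> carrier K"
  using assms cK by (simp add: D_coeff)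

text \<open>One factor involves e^0 only, so no power of e reaches e^n and the constant
  \<open>c\<close> does not appear.\<close>

lemma const_mult_D:
  assumes "a \<in> carrier K" "x \<in> carrier D"
  shows "const_seq K a \<otimes>\<^bsub>D\<^esub> x = (\<lambda>i. a \<otimes> x i)"
proof
  fix k
  note tc = term_closed[OF const_closed[OF assms(1)] assms(2)]
  let ?t = "\<lambda>i j. if (i + j) mod n = k
    then const_seq K a i \<otimes> (\<tau> ^^ i) (x j) \<otimes> (if i + j < n then \<one> else c) else \<zero>"
  have "(\<Oplus>i\<in>{..<n}. \<Oplus>j\<in>{..<n}. ?t i j) = (\<Oplus>j\<in>{..<n}. ?t 0 j)"
  proof (rule finsum_only)
    show "(\<Oplus>j\<in>{..<n}. ?t 0 j) \<in> carrier K" using tc by (intro finsum_closed funcsetI)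
    show "(\<Oplus>j\<in>{..<n}. ?t i j) = \<zero>" if "i \<noteq> 0" for i
      using that assms cK by (intro add.finprod_one_eqI) (simp add: const_seq_def D_coeff)
  qed (use n_pos in auto)
  also have "\<dots> = a \<otimes> x k"
  proof (cases "k < n")
    case True
    have "(\<Oplus>j\<in>{..<n}. ?t 0 j) = ?t 0 k"
      using True tc[of 0 k k] by (intro finsum_only) auto
    then show ?thesis using True assms by (simp add: const_seq_def D_coeff)
  next
    case False
    have "(\<Oplus>j\<in>{..<n}. ?t 0 j) = \<zero>"
      using False n_pos by (intro add.finprod_one_eqI) auto
    moreover have "x k = \<zero>" using False assms(2) by (simp add: D_carrier)
    ultimately show ?thesis using assms(1) by (simp only: r_null)
  qed
  finally show "(const_seq K a \<otimes>\<^bsub>D\<^esub> x) k = a \<otimes> x k" by (simp add: D_mult)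
qed

lemma mult_const_D:
  assumes "a \<in> carrier K" "x \<in> carrier D"
  shows "x \<otimes>\<^bsub>D\<^esub> const_seq K a = (\<lambda>i. x i \<otimes> (\<tau> ^^ i) a)"
proof
  fix k
  note tc = term_closed[OF assms(2) const_closed[OF assms(1)]]
  let ?t = "\<lambda>i j. if (i + j) mod n = k
    then x i \<otimes> (\<tau> ^^ i) (const_seq K a j) \<otimes> (if i + j < n then \<one> else c) else \<zero>"
  have inner: "(\<Oplus>j\<in>{..<n}. ?t i j) = ?t i 0" for i
    using n_pos tc assms cK by (intro finsum_only) (auto simp: const_seq_def D_coeff)
  have "(\<Oplus>i\<in>{..<n}. \<Oplus>j\<in>{..<n}. ?t i j) = (\<Oplus>i\<in>{..<n}. ?t i 0)"
    unfolding inner ..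
  also have "\<dots> = x k \<otimes> (\<tau> ^^ k) a"
  proof (cases "k < n")
    case True
    have "(\<Oplus>i\<in>{..<n}. ?t i 0) = ?t k 0"
      using True tc[of k 0 k] by (intro finsum_only) auto
    then show ?thesis using True assms by (simp add: const_seq_def D_coeff)
  next
    case False
    have "(\<Oplus>i\<in>{..<n}. ?t i 0) = \<zero>"
      using False n_pos by (intro add.finprod_one_eqI) auto
    moreover have "x k = \<zero>" using False assms(2) by (simp add: D_carrier)
    ultimately show ?thesis using l_null[OF \<tau>_closed[OF assms(1)]] by (simp only:)
  qed
  finally show "(x \<otimes>\<^bsub>D\<^esub> const_seq K a) k = x k \<otimes> (\<tau> ^^ k) a" by (simp add: D_mult)
qed

text \<open>Constants from \<open>F\<close> commute with e because \<tau> fixes them.\<close>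

lemma const_central:
  assumes "a \<in> F" "x \<in> carrier D"
  shows "x \<otimes>\<^bsub>D\<^esub> const_seq K a = const_seq K a \<otimes>\<^bsub>D\<^esub> x"
  using assms FK[OF assms(1)]
  by (simp add: const_mult_D mult_const_D \<tau>_pow_fixes m_comm D_coeff)

section \<open>The subring of elements with integral coefficients\<close>

lemma order_carrier: "carrier \<D> = {x \<in> carrier D. \<forall>i. nv (x i) \<le> 1}"
  by (auto simp: order_def natural_order_def integers_of_def D_coeff)

lemma order_eq: "\<D> = D\<lparr>carrier := carrier \<D>\<rparr>"
  by (simp add: order_def natural_order_def)

lemma order_simps: "x \<otimes>\<^bsub>\<D>\<^esub> y = x \<otimes>\<^bsub>D\<^esub> y" "x \<oplus>\<^bsub>\<D>\<^esub> y = x \<oplus>\<^bsub>D\<^esub> y"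
  "\<one>\<^bsub>\<D>\<^esub> = \<one>\<^bsub>D\<^esub>" "\<zero>\<^bsub>\<D>\<^esub> = \<zero>\<^bsub>D\<^esub>"
  by (simp_all add: order_def natural_order_def)

lemma D_neg: "x \<in> carrier D \<Longrightarrow> \<ominus>\<^bsub>D\<^esub> x = (\<lambda>i. \<ominus> x i)"
  by (rule D.minus_equality) (auto simp: D_add D_zero D_carrier l_neg)

text \<open>Closure under products holds because \<tau> preserves the integers of \<open>K\<close>
  and the structure constants 1 and \<open>c\<close> are integral.\<close>

lemma order_subring: "subring (carrier \<D>) D"
proof (rule D.subringI)
  show "carrier \<D> \<subseteq> carrier D" by (auto simp: order_carrier)
  show "\<one>\<^bsub>D\<^esub> \<in> carrier \<D>"
    using D.one_closed by (simp add: order_carrier) (simp add: D_one const_seq_def)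
  fix x assume x: "x \<in> carrier \<D>"
  then show "\<ominus>\<^bsub>D\<^esub> x \<in> carrier \<D>"
    using D.a_inv_closed[of x] by (simp add: order_carrier) (simp add: D_neg nv_minus D_coeff)
  fix y assume y: "y \<in> carrier \<D>"
  have xy: "x i \<in> carrier K" "y i \<in> carrier K" "nv (x i) \<le> 1" "nv (y i) \<le> 1" for i
    using x y by (auto simp: order_carrier D_coeff)
  have "nv ((x \<oplus>\<^bsub>D\<^esub> y) i) \<le> 1" for i
    using nv_ultrametric[OF xy(1,2), of i i] xy(3,4)[of i] by (simp add: D_add)
  then show "x \<oplus>\<^bsub>D\<^esub> y \<in> carrier \<D>" using x y by (simp add: order_carrier)
  have xyD: "x \<in> carrier D" "y \<in> carrier D" using x y by (auto simp: order_carrier)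
  have "nv ((x \<otimes>\<^bsub>D\<^esub> y) k) \<le> 1" for k
    unfolding D_mult
  proof (intro nv_finsum_le funcsetI finsum_closed term_closed[OF xyD])
    fix i j
    have "nv (x i \<otimes> (\<tau> ^^ i) (y j) \<otimes> c') \<le> 1" if "c' \<in> carrier K" "nv c' \<le> 1" for c'
      using xy[of i] xy[of j] \<tau>_pow_integral[of "y j" i] that nv_nonneg
      by (simp add: nv_mult mult_le_one)
    then show "nv (if (i + j) mod n = k
        then x i \<otimes> (\<tau> ^^ i) (y j) \<otimes> (if i + j < n then \<one> else c) else \<zero>) \<le> 1"
      using cK c(2) by auto
  qed auto
  then show "x \<otimes>\<^bsub>D\<^esub> y \<in> carrier \<D>" using xyD by (simp add: order_carrier)
qed

sublocale order: ring \<D>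
  using D.subring_is_ring[OF order_subring] by (simp only: order_eq[symmetric])

lemma const_in_order: "a \<in> carrier K \<Longrightarrow> nv a \<le> 1 \<Longrightarrow> const_seq K a \<in> carrier \<D>"
  using const_closed[of a] by (auto simp: order_carrier const_seq_def)

lemma orderD: "x \<in> carrier \<D> \<Longrightarrow> x \<in> carrier D"
  by (simp add: order_carrier)

lemma order_neg: "x \<in> carrier \<D> \<Longrightarrow> \<ominus>\<^bsub>\<D>\<^esub> x = \<ominus>\<^bsub>D\<^esub> x"
  by (rule order.minus_equality) (auto simp: order_simps orderD D.l_neg intro: subringE(5)[OF order_subring])

end

section \<open>The natural order of a Petit algebra\<close>

lemma quot_zero: "\<zero>\<^bsub>R Quot I\<^esub> = I"
  and quot_one: "\<one>\<^bsub>R Quot I\<^esub> = I +>\<^bsub>R\<^esub> \<one>\<^bsub>R\<^esub>"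
  and carrier_quot: "carrier (R Quot I) = (\<lambda>x. I +>\<^bsub>R\<^esub> x) ` carrier R"
  by (auto simp: FactRing_def A_RCOSETS_def')

text \<open>The same function \<open>f\<close> serves as a polynomial over \<open>D\<close> and over
  its order, since zero, one and negation agree. The set \<open>J\<close> is the multiple of the
  order by the maximal ideal of the integers of \<open>F0\<close>.\<close>

locale petit_order = cyclic_order K nv F n \<tau> c D \<D>
  for K :: "'a ring" (structure) and nv and F :: "'a set" and n :: nat and \<tau> :: "'a \<Rightarrow> 'a" and c :: 'a
    and D \<D> :: "(nat \<Rightarrow> 'a) ring" +
  fixes F0 :: "'a set" and \<sigma> :: "(nat \<Rightarrow> 'a) \<Rightarrow> nat \<Rightarrow> 'a" and m :: nat and d :: "nat \<Rightarrow> 'a"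
    and f :: "nat \<Rightarrow> nat \<Rightarrow> 'a" and S\<^sub>f \<Lambda> :: "(nat \<Rightarrow> nat \<Rightarrow> 'a) ring"
    and \<kappa> :: "'a \<Rightarrow> nat \<Rightarrow> nat \<Rightarrow> 'a" and \<pp> :: "'a set" and J :: "(nat \<Rightarrow> 'a) set"
  assumes F0: "subfield F0 K" "F0 \<subseteq> F"
    and \<sigma>_hom: "\<sigma> \<in> ring_hom D D" and \<sigma>_order: "\<sigma> ` carrier \<D> \<subseteq> carrier \<D>"
    and \<sigma>_fixes: "x \<in> F0 \<Longrightarrow> \<sigma> (const_seq K x) = const_seq K x"
    and m: "0 < m" and d: "d \<in> carrier \<D>" and f_def: "f = binomial_poly D m d"
    and S\<^sub>f_def: "S\<^sub>f = petit D \<sigma> f" and \<Lambda>_def: "\<Lambda> = petit \<D> \<sigma> f"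
    and \<kappa>_def: "\<kappa> = (\<lambda>a. const_seq D (const_seq K a))"
    and \<pp>_def: "\<pp> = {x \<in> F0. nv x < 1}"
    and J_def: "J = (const_seq K ` \<pp>) \<cdot>\<^bsub>\<D>\<^esub> carrier \<D>"
begin

lemma F0K: "x \<in> F0 \<Longrightarrow> x \<in> carrier K"
  using FK F0(2) by blast

lemma \<pp>D: "x \<in> \<pp> \<Longrightarrow> x \<in> F0" "x \<in> \<pp> \<Longrightarrow> x \<in> F" "x \<in> \<pp> \<Longrightarrow> x \<in> carrier K" "x \<in> \<pp> \<Longrightarrow> nv x < 1"
  using FK F0(2) by (auto simp: \<pp>_def)

lemma \<sigma>_zero: "\<sigma> \<zero>\<^bsub>D\<^esub> = \<zero>\<^bsub>D\<^esub>"
  by (rule ring_hom_zero[OF \<sigma>_hom D_ring D_ring])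

sublocale DS: skew_ring D \<sigma>
  by (intro skew_ring.intro skew_ring_axioms.intro D_ring \<sigma>_zero ring_hom_closed[OF \<sigma>_hom] ring_hom_one[OF \<sigma>_hom])

sublocale OS: skew_ring \<D> \<sigma>
proof (intro skew_ring.intro skew_ring_axioms.intro order.ring_axioms)
  show "\<sigma> x \<in> carrier \<D>" if "x \<in> carrier \<D>" for x using \<sigma>_order that by blast
qed (simp_all add: order_simps)

lemma \<sigma>_pow_fixes: "x \<in> F0 \<Longrightarrow> (\<sigma> ^^ k) (const_seq K x) = const_seq K x"
  by (induction k) (simp_all add: \<sigma>_fixes)

lemma order_const_in: "a \<in> \<pp> \<Longrightarrow> const_seq K a \<in> carrier \<D>"
  using \<pp>D[of a] by (intro const_in_order) auto

section \<open>The ideal of the order generated by the maximal ideal of the integers of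
  \<open>F0\<close>, and its quotient\<close>

lemma J_carrier: "s \<in> J \<Longrightarrow> s \<in> carrier \<D>"
  unfolding J_def
  by (induction s rule: ideal_prod.induct) (auto intro: order_const_in)

text \<open>A bound that keeps the one of the order out of \<open>J\<close>, so that the quotient is
  nontrivial and reductions of monic polynomials keep their degree.\<close>

lemma J_small: "s \<in> J \<Longrightarrow> nv (s i) < 1"
  unfolding J_def
proof (induction s rule: ideal_prod.induct)
  case (prod s x)
  then obtain a where a: "a \<in> \<pp>" "s = const_seq K a" by blast
  have x: "x \<in> carrier D" "x i \<in> carrier K" "nv (x i) \<le> 1"
    using prod(2) by (auto simp: order_carrier D_coeff)
  have "nv a * nv (x i) \<le> nv a * 1"
    using x(3) nv_nonneg[OF \<pp>D(3)[OF a(1)]] by (rule mult_left_mono)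
  then have "nv (a \<otimes> x i) < 1"
    using x \<pp>D(3,4)[OF a(1)] by (simp add: nv_mult)
  then show ?case using a x(1) \<pp>D(3)[OF a(1)] by (simp add: order_simps const_mult_D)
next
  case (sum s t)
  then have "s \<in> carrier D" "t \<in> carrier D" using J_carrier orderD unfolding J_def by blast+
  then show ?case
    using nv_ultrametric[of "s i" "t i"] sum(3,4) by (simp add: order_simps D_add D_coeff)
qed

lemma J_const_mult: "a \<in> \<pp> \<Longrightarrow> x \<in> carrier \<D> \<Longrightarrow> const_seq K a \<otimes>\<^bsub>D\<^esub> x \<in> J"
  unfolding J_def using ideal_prod.prod[of "const_seq K a" "const_seq K ` \<pp>" x "carrier \<D>" \<D>]
  by (simp add: order_simps)

lemma J_add: "s \<in> J \<Longrightarrow> t \<in> J \<Longrightarrow> s \<oplus>\<^bsub>D\<^esub> t \<in> J"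
  unfolding J_def using ideal_prod.sum[of s \<D> "const_seq K ` \<pp>" "carrier \<D>" t]
  by (simp add: order_simps)

lemma J_induct [consumes 1, case_names prod sum]:
  assumes "s \<in> J"
    and "\<And>a x. a \<in> \<pp> \<Longrightarrow> x \<in> carrier \<D> \<Longrightarrow> P (const_seq K a \<otimes>\<^bsub>D\<^esub> x)"
    and "\<And>s t. s \<in> J \<Longrightarrow> t \<in> J \<Longrightarrow> P s \<Longrightarrow> P t \<Longrightarrow> P (s \<oplus>\<^bsub>D\<^esub> t)"
  shows "P s"
  using assms(1) unfolding J_def
proof (induction s rule: ideal_prod.induct)
  case (prod s x)
  then show ?case using assms(2)[of _ x] by (auto simp: order_simps)
next
  case (sum s t)
  then show ?case using assms(3)[of s t] by (simp add: order_simps J_def)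
qed

lemma zero_in_\<pp>: "\<zero> \<in> \<pp>"
  using subringE(2)[OF subfieldE(1)[OF F0(1)]] by (simp add: \<pp>_def)

text \<open>The constants from \<open>\<pp>\<close> are in general not an ideal of the order. They
  are central in \<open>D\<close>, however, so a factor from the left can be moved past
  them.\<close>

lemma J_ideal: "ideal J \<D>"
proof (rule idealI[OF order.ring_axioms])
  have J_D: "s \<in> carrier D" if "s \<in> J" for s using J_carrier orderD that by blast
  have constD: "const_seq K a \<in> carrier D" if "a \<in> \<pp>" for a using order_const_in orderD that by blast
  show "subgroup J (add_monoid \<D>)"
  proof (rule order.add.subgroupI)
    show "J \<subseteq> carrier \<D>" using J_carrier by blast
    have "const_seq K \<zero> \<otimes>\<^bsub>D\<^esub> \<zero>\<^bsub>D\<^esub> \<in> J"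
      using J_const_mult[OF zero_in_\<pp>] order.zero_closed by (simp add: order_simps)
    then show "J \<noteq> {}" by blast
    show "\<ominus>\<^bsub>\<D>\<^esub> s \<in> J" if "s \<in> J" for s
    proof -
      have "\<ominus>\<^bsub>D\<^esub> s \<in> J" using that
      proof (induction s rule: J_induct)
        case (prod a x)
        have "\<ominus>\<^bsub>D\<^esub> x \<in> carrier \<D>" using order.a_inv_closed[OF prod(2)] order_neg[OF prod(2)] by simp
        moreover have "const_seq K a \<otimes>\<^bsub>D\<^esub> (\<ominus>\<^bsub>D\<^esub> x) = \<ominus>\<^bsub>D\<^esub> (const_seq K a \<otimes>\<^bsub>D\<^esub> x)"
          using constD[OF prod(1)] orderD[OF prod(2)] by (rule D.r_minus)
        ultimately show ?case using J_const_mult[OF prod(1), of "\<ominus>\<^bsub>D\<^esub> x"] by simp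
      next
        case (sum s t)
        then show ?case
          using J_add[OF sum(3,4)] J_D[OF sum(1)] J_D[OF sum(2)] by (simp add: D.minus_add)
      qed
      then show ?thesis using order_neg[OF J_carrier[OF that]] by simp
    qed
    show "s \<oplus>\<^bsub>\<D>\<^esub> t \<in> J" if "s \<in> J" "t \<in> J" for s t
      using J_add[OF that] by (simp add: order_simps)
  qed
  fix s y assume s: "s \<in> J" and y: "y \<in> carrier \<D>"
  have yD: "y \<in> carrier D" using y by (rule orderD)
  show "y \<otimes>\<^bsub>\<D>\<^esub> s \<in> J"
    unfolding order_simps using s
  proof (induction s rule: J_induct)
    case (prod a x)
    have xD: "x \<in> carrier D" using prod(2) by (rule orderD)
    have "y \<otimes>\<^bsub>D\<^esub> (const_seq K a \<otimes>\<^bsub>D\<^esub> x) = const_seq K a \<otimes>\<^bsub>D\<^esub> (y \<otimes>\<^bsub>D\<^esub> x)"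
      using const_central[OF \<pp>D(2)[OF prod(1)] yD] D.m_assoc[OF yD constD[OF prod(1)] xD]
        D.m_assoc[OF constD[OF prod(1)] yD xD] by simp
    then show ?case
      using J_const_mult[OF prod(1), of "y \<otimes>\<^bsub>D\<^esub> x"] order.m_closed[OF y prod(2)] by (simp add: order_simps)
  next
    case (sum s t)
    then show ?case
      using J_add[OF sum(3,4)] D.r_distr[OF J_D[OF sum(1)] J_D[OF sum(2)] yD] by simp
  qed
  show "s \<otimes>\<^bsub>\<D>\<^esub> y \<in> J"
    unfolding order_simps using s
  proof (induction s rule: J_induct)
    case (prod a x)
    have xD: "x \<in> carrier D" using prod(2) by (rule orderD)
    show ?case
      using D.m_assoc[OF constD[OF prod(1)] xD yD] J_const_mult[OF prod(1), of "x \<otimes>\<^bsub>D\<^esub> y"]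
        order.m_closed[OF prod(2) y] by (simp add: order_simps)
  next
    case (sum s t)
    then show ?case
      using J_add[OF sum(3,4)] D.l_distr[OF J_D[OF sum(1)] J_D[OF sum(2)] yD] by simp
  qed
qed

sublocale J: ideal J \<D> by (rule J_ideal)

abbreviation red :: "(nat \<Rightarrow> 'a) \<Rightarrow> (nat \<Rightarrow> 'a) set" where
  "red x \<equiv> J +>\<^bsub>\<D>\<^esub> x"

lemma red_hom: "red \<in> ring_hom \<D> (\<D> Quot J)"
  by (rule J.rcos_ring_hom)

sublocale redh: ring_hom_ring \<D> "\<D> Quot J" red
  by (rule J.rcos_ring_hom_ring)

lemma red_eq_iff:
  assumes "x \<in> carrier \<D>" "y \<in> carrier \<D>"
  shows "red x = red y \<longleftrightarrow> x \<ominus>\<^bsub>\<D>\<^esub> y \<in> J"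
proof
  assume "red x = red y"
  then have "x \<in> red y" using J.a_rcos_self[OF assms(1)] by simp
  then show "x \<ominus>\<^bsub>\<D>\<^esub> y \<in> J" using J.a_rcos_module_minus[OF order.ring_axioms assms(2,1)] by simp
next
  assume "x \<ominus>\<^bsub>\<D>\<^esub> y \<in> J"
  then have "x \<in> red y" using J.a_rcos_module_minus[OF order.ring_axioms assms(2,1)] by simp
  then show "red x = red y" by (rule J.a_repr_independence'[OF _ assms(2), symmetric])
qed

lemma red_zero: "s \<in> J \<Longrightarrow> red s = \<zero>\<^bsub>\<D> Quot J\<^esub>"
  unfolding quot_zero by (rule J.a_rcos_const)

lemma quot_nontriv: "\<one>\<^bsub>\<D> Quot J\<^esub> \<noteq> \<zero>\<^bsub>\<D> Quot J\<^esub>"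
proof
  assume "\<one>\<^bsub>\<D> Quot J\<^esub> = \<zero>\<^bsub>\<D> Quot J\<^esub>"
  then have "red \<one>\<^bsub>\<D>\<^esub> = J" unfolding quot_zero quot_one .
  then have "\<one>\<^bsub>\<D>\<^esub> \<in> J" using J.a_rcos_self[OF order.one_closed] by (simp only:)
  then have "nv (\<one>\<^bsub>\<D>\<^esub> 0) < 1" by (rule J_small)
  then show False by (simp add: order_simps D_one const_seq_def)
qed

lemma order_nontriv: "\<one>\<^bsub>\<D>\<^esub> \<noteq> \<zero>\<^bsub>\<D>\<^esub>"
  using D_nontriv by (simp add: order_simps)

text \<open>The generators of \<open>J\<close> come from \<open>F0\<close> and are fixed by
  \<sigma>.\<close>

lemma \<sigma>_J: "s \<in> J \<Longrightarrow> \<sigma> s \<in> J"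
proof (induction s rule: J_induct)
  case (prod a x)
  have "\<sigma> (const_seq K a \<otimes>\<^bsub>D\<^esub> x) = const_seq K a \<otimes>\<^bsub>D\<^esub> \<sigma> x"
    using ring_hom_mult[OF \<sigma>_hom, of "const_seq K a" x] orderD[OF order_const_in[OF prod(1)]]
      orderD[OF prod(2)] \<sigma>_fixes[OF \<pp>D(1)[OF prod(1)]] by simp
  then show ?case using J_const_mult[OF prod(1), of "\<sigma> x"] OS.twist_closed[OF prod(2)] by simp
next
  case (sum s t)
  then show ?case
    using ring_hom_add[OF \<sigma>_hom, of s t] J_add[OF sum(3,4)] orderD[OF J_carrier[OF sum(1)]]
      orderD[OF J_carrier[OF sum(2)]] by simp
qed

abbreviation \<sigma>_bar :: "(nat \<Rightarrow> 'a) set \<Rightarrow> (nat \<Rightarrow> 'a) set" where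
  "\<sigma>_bar \<equiv> coset_map \<D> J \<sigma>"

text \<open>\<open>coset_map\<close> picks the only element of an image; representatives of a coset
  differ by an element of \<open>J\<close>, which \<sigma> keeps in \<open>J\<close>, so there is
  just one.\<close>

lemma \<sigma>_bar: "\<sigma>_bar (red x) = red (\<sigma> x)" if x: "x \<in> carrier \<D>"
proof -
  have "red (\<sigma> y) = red (\<sigma> x)" if y: "y \<in> red x" for y
  proof -
    have yc: "y \<in> carrier \<D>" using J.a_elemrcos_carrier[OF x y] .
    have yx: "y \<ominus>\<^bsub>\<D>\<^esub> x \<in> J" using J.a_rcos_module_minus[OF order.ring_axioms x yc] y by simp
    then have "\<sigma> (y \<ominus>\<^bsub>\<D>\<^esub> x) \<in> J" by (rule \<sigma>_J)
    moreover have "\<sigma> (y \<ominus>\<^bsub>\<D>\<^esub> x) = \<sigma> y \<ominus>\<^bsub>\<D>\<^esub> \<sigma> x"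
    proof -
      have "y = (y \<ominus>\<^bsub>\<D>\<^esub> x) \<oplus>\<^bsub>D\<^esub> x"
        using x yc by (simp add: order.a_assoc order.l_neg a_minus_def flip: order_simps(2))
      then have "\<sigma> y = \<sigma> (y \<ominus>\<^bsub>\<D>\<^esub> x) \<oplus>\<^bsub>\<D>\<^esub> \<sigma> x"
        using ring_hom_add[OF \<sigma>_hom, of "y \<ominus>\<^bsub>\<D>\<^esub> x" x] orderD[OF x] orderD[OF J_carrier[OF yx]]
        by (simp add: order_simps)
      then show ?thesis
        using OS.twist_closed[OF J_carrier[OF yx]] OS.twist_closed[OF x]
        by (simp add: a_minus_def order.a_assoc order.r_neg)
    qed
    ultimately show ?thesis using red_eq_iff OS.twist_closed x yc by simp
  qed
  moreover have "x \<in> red x" using x by (rule J.a_rcos_self)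
  ultimately have "(\<lambda>y. red (\<sigma> y)) ` red x = {red (\<sigma> x)}" by blast
  then show ?thesis by (simp add: coset_map_def)
qed

lemma quot_carrier: "carrier (\<D> Quot J) = red ` carrier \<D>"
  by (rule carrier_quot)

sublocale QS: skew_ring "\<D> Quot J" \<sigma>_bar
proof (intro skew_ring.intro skew_ring_axioms.intro J.quotient_is_ring)
  show "\<sigma>_bar X \<in> carrier (\<D> Quot J)" if "X \<in> carrier (\<D> Quot J)" for X
  proof -
    obtain x where x: "x \<in> carrier \<D>" "X = red x" using \<open>X \<in> _\<close> quot_carrier by blast
    then show ?thesis using \<sigma>_bar[OF x(1)] OS.twist_closed[OF x(1)] quot_carrier by simp
  qed
  show "\<sigma>_bar \<one>\<^bsub>\<D> Quot J\<^esub> = \<one>\<^bsub>\<D> Quot J\<^esub>"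
    using \<sigma>_bar[OF order.one_closed] redh.hom_one OS.twist_one by simp
  show "\<sigma>_bar \<zero>\<^bsub>\<D> Quot J\<^esub> = \<zero>\<^bsub>\<D> Quot J\<^esub>"
    using \<sigma>_bar[OF order.zero_closed] redh.hom_zero OS.twist_zero by simp
qed

sublocale RH: skew_ring_hom \<D> \<sigma> "\<D> Quot J" \<sigma>_bar red
  by (intro skew_ring_hom.intro skew_ring_hom_axioms.intro OS.skew_ring_axioms QS.skew_ring_axioms red_hom)
    (simp add: \<sigma>_bar)

section \<open>Scalars in the Petit algebra and in its order\<close>

lemma f_monic: "OS.monic_of_degree m f" "DS.monic_of_degree m f"
proof -
  have fi: "f i = (if i = m then \<one>\<^bsub>D\<^esub> else if i = 0 then \<ominus>\<^bsub>D\<^esub> d else \<zero>\<^bsub>D\<^esub>)" for i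
    by (simp add: f_def binomial_poly_def)
  have c: "f i \<in> carrier \<D>" for i
    using order.one_closed order.zero_closed order.a_inv_closed[OF d] order_neg[OF d]
    by (simp add: fi order_simps)
  have "f \<in> up \<D>" by (rule upI[where n = "Suc m"]) (use c in \<open>auto simp: fi order_simps\<close>)
  moreover have "f \<in> up D" by (rule upI[where n = "Suc m"]) (use c orderD in \<open>auto simp: fi\<close>)
  ultimately show "OS.monic_of_degree m f" "DS.monic_of_degree m f"
    by (simp_all add: OS.monic_of_degree_def DS.monic_of_degree_def fi order_simps)
qed

lemmas \<Lambda>_simps = OS.petit_simps[OF f_monic(1) order_nontriv, folded \<Lambda>_def]
lemmas S\<^sub>f_simps = DS.petit_simps[OF f_monic(2) D_nontriv, folded S\<^sub>f_def]

abbreviation S\<^sub>f_bar where "S\<^sub>f_bar \<equiv> petit (\<D> Quot J) \<sigma>_bar (reduce \<D> J f)"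

lemma reduce_eq: "reduce \<D> J g = (\<lambda>i. red (g i))"
  by (simp add: reduce_def)

lemmas S\<^sub>f_bar_simps =
  QS.petit_simps[OF RH.map_monic[OF f_monic(1)] quot_nontriv, folded reduce_eq]

lemma \<kappa>_eq: "\<kappa> a = const_seq \<D> (const_seq K a)"
  by (intro ext) (simp add: \<kappa>_def const_seq_def order_simps)

lemma \<kappa>_mult_S\<^sub>f: "a \<in> carrier K \<Longrightarrow> x \<in> carrier S\<^sub>f \<Longrightarrow> \<kappa> a \<otimes>\<^bsub>S\<^sub>f\<^esub> x = (\<lambda>j i. a \<otimes> x j i)"
proof -
  assume a: "a \<in> carrier K" and x: "x \<in> carrier S\<^sub>f"
  have xb: "x \<in> deg_below D m" using x by (simp add: S\<^sub>f_simps)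
  then have xc: "x j \<in> carrier D" for j by (auto simp: deg_below_def mem_upD)
  show ?thesis
    using DS.petit_const_mult[OF f_monic(2) D_nontriv const_closed[OF a] xb] const_mult_D[OF a xc]
    by (simp add: \<kappa>_def S\<^sub>f_def)
qed

lemma \<Lambda>_coeff: "x \<in> carrier \<Lambda> \<Longrightarrow> x j \<in> carrier \<D>"
  by (auto simp: \<Lambda>_simps deg_below_def mem_upD)

lemma \<kappa>_mult_\<Lambda>:
  assumes "a \<in> carrier K" "nv a \<le> 1" "x \<in> carrier \<Lambda>"
  shows "\<kappa> a \<otimes>\<^bsub>\<Lambda>\<^esub> x = (\<lambda>j. const_seq K a \<otimes>\<^bsub>\<D>\<^esub> x j)"
  using OS.petit_const_mult[OF f_monic(1) order_nontriv const_in_order[OF assms(1,2)]] assms(3)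
  by (simp add: \<kappa>_eq \<Lambda>_simps(1)) (simp add: \<Lambda>_def)

text \<open>Right multiplication is the form in which a left ideal contains multiples of its element
  \<open>\<kappa> a\<close>. The powers of \<sigma> fix a since it lies in \<open>F0\<close>, and a
  is central since \<open>F0\<close> lies in \<open>F\<close>.\<close>

lemma mult_\<kappa>_\<Lambda>:
  assumes "a \<in> F0" "nv a \<le> 1" "x \<in> carrier \<Lambda>"
  shows "x \<otimes>\<^bsub>\<Lambda>\<^esub> \<kappa> a = (\<lambda>j i. a \<otimes> x j i)"
proof -
  have aF: "a \<in> F" "a \<in> carrier K" using assms(1) F0K F0(2) by auto
  have "x \<otimes>\<^bsub>\<Lambda>\<^esub> \<kappa> a = (\<lambda>j. x j \<otimes>\<^bsub>\<D>\<^esub> (\<sigma> ^^ j) (const_seq K a))"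
    using OS.petit_mult_const[OF f_monic(1) order_nontriv const_in_order[OF aF(2) assms(2)]] assms(3)
    by (simp add: \<kappa>_eq \<Lambda>_simps(1)) (simp add: \<Lambda>_def)
  also have "\<dots> = (\<lambda>j i. a \<otimes> x j i)"
  proof
    fix j
    have "x j \<in> carrier D" using \<Lambda>_coeff[OF assms(3)] by (rule orderD)
    then show "x j \<otimes>\<^bsub>\<D>\<^esub> (\<sigma> ^^ j) (const_seq K a) = (\<lambda>i. a \<otimes> x j i)"
      using const_central[OF aF(1)] const_mult_D[OF aF(2)] by (simp add: \<sigma>_pow_fixes[OF assms(1)] order_simps)
  qed
  finally show ?thesis .
qed

lemma \<kappa>_in_\<Lambda>: "a \<in> carrier K \<Longrightarrow> nv a \<le> 1 \<Longrightarrow> \<kappa> a \<in> carrier \<Lambda>"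
proof -
  assume a: "a \<in> carrier K" "nv a \<le> 1"
  have "\<kappa> a \<in> up \<D>"
    by (rule upI[where n = 1]) (use const_in_order[OF a] in \<open>auto simp: \<kappa>_eq const_seq_def[of \<D>]\<close>)
  then show ?thesis using m by (auto simp: \<Lambda>_simps deg_below_def \<kappa>_eq const_seq_def[of \<D>])
qed

lemma V_smult: "a \<in> carrier K \<Longrightarrow> x \<in> carrier S\<^sub>f \<Longrightarrow> a \<odot>\<^bsub>as_module \<kappa> S\<^sub>f\<^esub> x = (\<lambda>j i. a \<otimes> x j i)"
  by (simp add: as_module_def \<kappa>_mult_S\<^sub>f)

section \<open>The Petit algebra as a space of m by n arrays over \<open>K\<close>\<close>

lemma V_add: "x \<oplus>\<^bsub>as_module \<kappa> S\<^sub>f\<^esub> y = (\<lambda>j i. x j i \<oplus> y j i)"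
  and V_zero: "\<zero>\<^bsub>as_module \<kappa> S\<^sub>f\<^esub> = (\<lambda>j i. \<zero>)"
  and V_carrier0: "carrier (as_module \<kappa> S\<^sub>f) = carrier S\<^sub>f"
  by (simp_all add: as_module_def S\<^sub>f_simps D_add D_zero)

lemma S\<^sub>f_carrier:
  "carrier S\<^sub>f = {x. (\<forall>j i. x j i \<in> carrier K) \<and> (\<forall>j i. m \<le> j \<or> n \<le> i \<longrightarrow> x j i = \<zero>)}"
proof -
  have up: "x \<in> up D" if "\<And>j. x j \<in> carrier D" "\<And>j. m \<le> j \<Longrightarrow> x j = \<zero>\<^bsub>D\<^esub>" for x
    using that by (rule upI)
  show ?thesis
  proof (intro equalityI subsetI)
    fix x assume "x \<in> carrier S\<^sub>f"
    then have "\<And>j. x j \<in> carrier D" "\<And>j. m \<le> j \<Longrightarrow> x j = \<zero>\<^bsub>D\<^esub>"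
      by (auto simp: S\<^sub>f_simps deg_below_def mem_upD)
    then show "x \<in> {x. (\<forall>j i. x j i \<in> carrier K) \<and> (\<forall>j i. m \<le> j \<or> n \<le> i \<longrightarrow> x j i = \<zero>)}"
      by (auto simp: D_carrier D_zero)
  next
    fix x assume "x \<in> {x. (\<forall>j i. x j i \<in> carrier K) \<and> (\<forall>j i. m \<le> j \<or> n \<le> i \<longrightarrow> x j i = \<zero>)}"
    then have "\<And>j. x j \<in> carrier D" "\<And>j. m \<le> j \<Longrightarrow> x j = \<zero>\<^bsub>D\<^esub>"
      by (auto simp: D_carrier D_zero)
    then show "x \<in> carrier S\<^sub>f" using up by (auto simp: S\<^sub>f_simps deg_below_def)
  qed
qed

lemma \<Lambda>_carrier: "carrier \<Lambda> = {x \<in> carrier S\<^sub>f. \<forall>j i. nv (x j i) \<le> 1}"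
proof (intro equalityI subsetI)
  fix x assume "x \<in> carrier \<Lambda>"
  then have x: "\<And>j. x j \<in> carrier \<D>" "\<And>j. m \<le> j \<Longrightarrow> x j = \<zero>\<^bsub>D\<^esub>"
    by (auto simp: \<Lambda>_simps deg_below_def mem_upD order_simps)
  then show "x \<in> {x \<in> carrier S\<^sub>f. \<forall>j i. nv (x j i) \<le> 1}"
    unfolding S\<^sub>f_carrier by (auto simp: order_carrier D_carrier D_zero)
next
  fix x assume "x \<in> {x \<in> carrier S\<^sub>f. \<forall>j i. nv (x j i) \<le> 1}"
  then have x: "\<And>j. x j \<in> carrier \<D>" "\<And>j. m \<le> j \<Longrightarrow> x j = \<zero>\<^bsub>\<D>\<^esub>"
    unfolding S\<^sub>f_carrier by (auto simp: order_carrier D_carrier D_zero order_simps)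
  then have "x \<in> up \<D>" by (rule upI)
  then show "x \<in> carrier \<Lambda>" using x by (simp add: \<Lambda>_simps deg_below_def)
qed

text \<open>The law for a product of two scalars does not come from associativity, which may fail;
  it is verified entrywise.\<close>

lemma coordinate_space: "coordinate_space K nv (as_module \<kappa> S\<^sub>f) ({..<m} \<times> {..<n}) (\<lambda>(j, i) x. x j i)"
proof (intro coordinate_space.intro valued_field_axioms vector_module.intro field_axioms moduleI
    coordinate_space_axioms.intro)
  let ?V = "as_module \<kappa> S\<^sub>f"
  note V = V_add V_zero V_carrier0 V_smult
  show "abelian_group ?V"
  proof (rule abelian_groupI)
    fix x assume x: "x \<in> carrier ?V"
    then show "\<exists>y \<in> carrier ?V. y \<oplus>\<^bsub>?V\<^esub> x = \<zero>\<^bsub>?V\<^esub>"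
      by (intro bexI[of _ "\<lambda>j i. \<ominus> x j i"]) (auto simp: V S\<^sub>f_carrier l_neg)
  qed (auto simp: V S\<^sub>f_carrier a_ac)
  show "a \<odot>\<^bsub>?V\<^esub> x \<in> carrier ?V" if "a \<in> carrier K" "x \<in> carrier ?V" for a x
    using that by (simp add: V) (simp add: S\<^sub>f_carrier)
  show "(a \<oplus> b) \<odot>\<^bsub>?V\<^esub> x = a \<odot>\<^bsub>?V\<^esub> x \<oplus>\<^bsub>?V\<^esub> b \<odot>\<^bsub>?V\<^esub> x"
    if "a \<in> carrier K" "b \<in> carrier K" "x \<in> carrier ?V" for a b x
    using that by (simp add: V) (simp add: S\<^sub>f_carrier l_distr)
  show "a \<odot>\<^bsub>?V\<^esub> (x \<oplus>\<^bsub>?V\<^esub> y) = a \<odot>\<^bsub>?V\<^esub> x \<oplus>\<^bsub>?V\<^esub> a \<odot>\<^bsub>?V\<^esub> y"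
    if "a \<in> carrier K" "x \<in> carrier ?V" "y \<in> carrier ?V" for a x y
  proof -
    have xy: "x \<in> carrier S\<^sub>f" "y \<in> carrier S\<^sub>f" using that by (simp_all add: V)
    then have "(\<lambda>j i. x j i \<oplus> y j i) \<in> carrier S\<^sub>f" by (simp add: S\<^sub>f_carrier)
    then have "a \<odot>\<^bsub>?V\<^esub> (x \<oplus>\<^bsub>?V\<^esub> y) = (\<lambda>j i. a \<otimes> (x j i \<oplus> y j i))"
      using that(1) by (simp add: V)
    then show ?thesis
      using that(1) xy by (simp add: V) (simp add: S\<^sub>f_carrier r_distr)
  qed
  show "(a \<otimes> b) \<odot>\<^bsub>?V\<^esub> x = a \<odot>\<^bsub>?V\<^esub> (b \<odot>\<^bsub>?V\<^esub> x)"
    if "a \<in> carrier K" "b \<in> carrier K" "x \<in> carrier ?V" for a b x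
  proof -
    have x: "x \<in> carrier S\<^sub>f" using that by (simp add: V)
    then have "(\<lambda>j i. b \<otimes> x j i) \<in> carrier S\<^sub>f" using that(2) by (simp add: S\<^sub>f_carrier)
    then have "a \<odot>\<^bsub>?V\<^esub> (b \<odot>\<^bsub>?V\<^esub> x) = (\<lambda>j i. a \<otimes> (b \<otimes> x j i))"
      using that(1,2) x by (simp add: V)
    then show ?thesis
      using that(1,2) x by (simp add: V) (simp add: S\<^sub>f_carrier m_assoc)
  qed
  show "\<one> \<odot>\<^bsub>?V\<^esub> x = x" if "x \<in> carrier ?V" for x
    using that by (simp add: V) (simp add: S\<^sub>f_carrier)
  fix \<xi> :: "nat \<times> nat" assume "\<xi> \<in> {..<m} \<times> {..<n}"
  fix x assume x: "x \<in> carrier ?V"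
  then show "(case \<xi> of (j, i) \<Rightarrow> \<lambda>x. x j i) x \<in> carrier K" by (auto simp: V S\<^sub>f_carrier split: prod.splits)
  show "(case \<xi> of (j, i) \<Rightarrow> \<lambda>x. x j i) (a \<odot>\<^bsub>?V\<^esub> x) = a \<otimes> (case \<xi> of (j, i) \<Rightarrow> \<lambda>x. x j i) x"
    if "a \<in> carrier K" for a
    using that x by (simp add: V split: prod.splits)
next
  fix x assume x: "x \<in> carrier (as_module \<kappa> S\<^sub>f)"
    and z: "\<And>\<xi>. \<xi> \<in> {..<m} \<times> {..<n} \<Longrightarrow> (case \<xi> of (j, i) \<Rightarrow> \<lambda>x. x j i) x = \<zero>"
  have "x j i = \<zero>" for j i
    using z[of "(j, i)"] x by (cases "j < m \<and> i < n") (auto simp: V_carrier0 S\<^sub>f_carrier)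
  then show "x = \<zero>\<^bsub>as_module \<kappa> S\<^sub>f\<^esub>" by (intro ext) (simp add: V_zero)
qed (simp_all add: V_add is_cring split: prod.splits)

abbreviation \<Psi> :: "(nat \<Rightarrow> nat \<Rightarrow> 'a) \<Rightarrow> nat \<Rightarrow> (nat \<Rightarrow> 'a) set" where
  "\<Psi> \<equiv> reduce \<D> J"

abbreviation \<pp>\<Lambda> :: "(nat \<Rightarrow> nat \<Rightarrow> 'a) set" where
  "\<pp>\<Lambda> \<equiv> (\<kappa> ` \<pp>) \<cdot>\<^bsub>\<Lambda>\<^esub> carrier \<Lambda>"

section \<open>The reduction map and the image of the ideal\<close>

lemma \<Lambda>_add_closed: "x \<in> carrier \<Lambda> \<Longrightarrow> y \<in> carrier \<Lambda> \<Longrightarrow> x \<oplus>\<^bsub>\<Lambda>\<^esub> y \<in> carrier \<Lambda>"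
  unfolding \<Lambda>_def by (rule abelian_monoid.a_closed[OF abelian_group.axioms(1)[OF OS.abelian_group_petit]])

lemma \<Lambda>_mult_closed: "x \<in> carrier \<Lambda> \<Longrightarrow> y \<in> carrier \<Lambda> \<Longrightarrow> x \<otimes>\<^bsub>\<Lambda>\<^esub> y \<in> carrier \<Lambda>"
  using RH.map_petit_mult(2)[OF f_monic(1) order_nontriv quot_nontriv, of x y]
  by (simp only: \<Lambda>_simps(1)) (simp only: \<Lambda>_def)

text \<open>The inclusion of \<open>\<pp>\<Lambda>\<close> in the kernel of \<open>\<Psi>\<close>,
  which makes \<open>\<Psi>\<close> constant on cosets.\<close>

lemma \<pp>\<Lambda>_coeffs: "s \<in> \<pp>\<Lambda> \<Longrightarrow> s \<in> carrier \<Lambda> \<and> (\<forall>j. s j \<in> J)"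
proof (induction s rule: ideal_prod.induct)
  case (prod s x)
  then obtain a where a: "a \<in> \<pp>" "s = \<kappa> a" by blast
  have a': "a \<in> carrier K" "nv a \<le> 1" using \<pp>D(3,4)[OF a(1)] by auto
  have "const_seq K a \<otimes>\<^bsub>\<D>\<^esub> x j \<in> J" for j
    unfolding order_simps by (rule J_const_mult[OF a(1) \<Lambda>_coeff[OF prod(2)]])
  then show ?case
    using \<Lambda>_mult_closed[OF \<kappa>_in_\<Lambda>[OF a'] prod(2)] \<kappa>_mult_\<Lambda>[OF a' prod(2)] a(2) by simp
next
  case (sum s t)
  have "s j \<oplus>\<^bsub>\<D>\<^esub> t j \<in> J" for j
    unfolding order_simps using sum.IH by (intro J_add) simp_all
  then show ?case using sum.IH \<Lambda>_add_closed by (simp add: \<Lambda>_simps(3))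
qed

text \<open>Guarantees that cosets are nonempty, so that the image of a coset under
  \<open>\<Psi>\<close> is a singleton and not empty.\<close>

lemma \<pp>\<Lambda>_zero: "\<zero>\<^bsub>\<Lambda>\<^esub> \<in> \<pp>\<Lambda>"
proof -
  have z: "\<zero>\<^bsub>\<Lambda>\<^esub> \<in> carrier \<Lambda>"
    unfolding \<Lambda>_def by (rule abelian_monoid.zero_closed[OF abelian_group.axioms(1)[OF OS.abelian_group_petit]])
  have zc: "const_seq K \<zero> \<in> carrier \<D>" by (rule order_const_in[OF zero_in_\<pp>])
  have "\<kappa> \<zero> \<otimes>\<^bsub>\<Lambda>\<^esub> \<zero>\<^bsub>\<Lambda>\<^esub> = \<zero>\<^bsub>\<Lambda>\<^esub>"
    using \<kappa>_mult_\<Lambda>[of \<zero>, OF _ _ z] order.r_null[OF zc] by (simp add: \<Lambda>_simps(4))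
  moreover have "\<kappa> \<zero> \<otimes>\<^bsub>\<Lambda>\<^esub> \<zero>\<^bsub>\<Lambda>\<^esub> \<in> \<pp>\<Lambda>"
    using zero_in_\<pp> z by (intro ideal_prod.prod) blast+
  ultimately show ?thesis by (simp only:)
qed

lemma \<Psi>_add: "x \<in> carrier \<Lambda> \<Longrightarrow> y \<in> carrier \<Lambda> \<Longrightarrow> \<Psi> (x \<oplus>\<^bsub>\<Lambda>\<^esub> y) = \<Psi> x \<oplus>\<^bsub>S\<^sub>f_bar\<^esub> \<Psi> y"
  using redh.hom_add[OF \<Lambda>_coeff \<Lambda>_coeff]
  unfolding \<Lambda>_simps(3) S\<^sub>f_bar_simps(3) unfolding reduce_eq by (intro ext) blast

lemma \<Psi>_closed: "x \<in> carrier \<Lambda> \<Longrightarrow> \<Psi> x \<in> carrier S\<^sub>f_bar"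
  unfolding \<Lambda>_simps(1) S\<^sub>f_bar_simps(1) unfolding reduce_eq by (rule RH.map_deg_below)

lemma \<Psi>_mult:
  assumes "x \<in> carrier \<Lambda>" "y \<in> carrier \<Lambda>"
  shows "\<Psi> (x \<otimes>\<^bsub>\<Lambda>\<^esub> y) = \<Psi> x \<otimes>\<^bsub>S\<^sub>f_bar\<^esub> \<Psi> y"
proof -
  have "x \<in> deg_below \<D> m" "y \<in> deg_below \<D> m" using assms by (simp_all only: \<Lambda>_simps(1))
  from RH.map_petit_mult(1)[OF f_monic(1) order_nontriv quot_nontriv this]
  show ?thesis unfolding reduce_eq \<Lambda>_def .
qed

lemma \<Psi>_surj:
  assumes "Y \<in> carrier S\<^sub>f_bar"
  shows "\<exists>x \<in> carrier \<Lambda>. Y = \<Psi> x"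
proof -
  have Y: "Y j \<in> carrier (\<D> Quot J)" "m \<le> j \<Longrightarrow> Y j = \<zero>\<^bsub>\<D> Quot J\<^esub>" for j
    using assms by (auto simp: S\<^sub>f_bar_simps(1) deg_below_def mem_upD)
  \<comment> \<open>From degree m on the lift is chosen to be zero, so that the lifted coefficients
    form an element of the order.\<close>
  have "\<exists>y. y \<in> carrier \<D> \<and> (m \<le> j \<longrightarrow> y = \<zero>\<^bsub>\<D>\<^esub>) \<and> Y j = red y" for j
  proof (cases "m \<le> j")
    case True
    then show ?thesis
      using Y(2) redh.hom_zero order.zero_closed by (intro exI[of _ "\<zero>\<^bsub>\<D>\<^esub>"]) simp
  next
    case False
    then show ?thesis using Y(1)[of j] unfolding quot_carrier by blast
  qed
  then obtain x where x: "\<And>j. x j \<in> carrier \<D>" "\<And>j. m \<le> j \<Longrightarrow> x j = \<zero>\<^bsub>\<D>\<^esub>" "\<And>j. Y j = red (x j)"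
    by metis
  have "x \<in> up \<D>" using x(1,2) by (rule upI)
  then have "x \<in> carrier \<Lambda>" using x(2) by (simp add: \<Lambda>_simps(1) deg_below_def)
  moreover have "Y = \<Psi> x" unfolding reduce_eq using x(3) by (intro ext)
  ultimately show ?thesis by blast
qed

lemma \<Psi>_on_coset:
  assumes x: "x \<in> carrier \<Lambda>"
  shows "on_coset \<Psi> (\<pp>\<Lambda> +>\<^bsub>\<Lambda>\<^esub> x) = \<Psi> x"
proof -
  have "\<Psi> (s \<oplus>\<^bsub>\<Lambda>\<^esub> x) = \<Psi> x" if s: "s \<in> \<pp>\<Lambda>" for s
  proof -
    have s': "s \<in> carrier \<Lambda>" "s j \<in> J" for j using \<pp>\<Lambda>_coeffs[OF s] by blast+
    have "red (s j \<oplus>\<^bsub>\<D>\<^esub> x j) = red (x j)" for j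
      by (simp only: redh.hom_add[OF \<Lambda>_coeff[OF s'(1)] \<Lambda>_coeff[OF x]] red_zero[OF s'(2)]
        redh.S.l_zero[OF redh.hom_closed[OF \<Lambda>_coeff[OF x]]])
    then show ?thesis unfolding reduce_eq \<Lambda>_simps(3) by (intro ext)
  qed
  note shift = this
  have "\<Psi> ` (\<pp>\<Lambda> +>\<^bsub>\<Lambda>\<^esub> x) = (\<lambda>s. \<Psi> (s \<oplus>\<^bsub>\<Lambda>\<^esub> x)) ` \<pp>\<Lambda>"
    by (simp only: a_r_coset_def' image_UN image_insert image_empty UNION_singleton_eq_range image_image)
  also have "\<dots> = (\<lambda>s. \<Psi> x) ` \<pp>\<Lambda>"
    by (rule image_cong[OF refl shift])
  also have "\<dots> = {\<Psi> x}"
    by (rule image_constant[OF \<pp>\<Lambda>_zero])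
  finally have "\<Psi> ` (\<pp>\<Lambda> +>\<^bsub>\<Lambda>\<^esub> x) = {\<Psi> x}" .
  then show ?thesis by (simp only: on_coset_def the_elem_eq)
qed

text \<open>\<open>\<Psi>\<close> is additive, multiplicative and surjective, so it carries left
  ideals to left ideals and multiples of \<open>g\<close> onto multiples of its image. The leading
  coefficient one survives because the quotient is nontrivial.\<close>

lemma reduced_ideal:
  assumes g: "g \<in> carrier \<Lambda>" "monic \<D> g" and I: "I = principal_left \<Lambda> g" "left_ideal \<Lambda> I"
  shows "left_ideal S\<^sub>f_bar (\<Psi> ` I)" "\<Psi> ` I = principal_left S\<^sub>f_bar (\<Psi> g)"
    "\<Psi> g \<in> carrier S\<^sub>f_bar" "monic (\<D> Quot J) (\<Psi> g)"
proof -
  interpret G: group "add_monoid \<Lambda>"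
    unfolding \<Lambda>_def by (rule abelian_group.a_group[OF OS.abelian_group_petit])
  interpret H: group "add_monoid S\<^sub>f_bar"
    by (rule abelian_group.a_group[OF QS.abelian_group_petit])
  have "\<Psi> \<in> Group.hom (add_monoid \<Lambda>) (add_monoid S\<^sub>f_bar)"
    unfolding Group.hom_def using \<Psi>_closed \<Psi>_add by auto
  then interpret GH: group_hom "add_monoid \<Lambda>" "add_monoid S\<^sub>f_bar" \<Psi>
    by (intro group_hom.intro group_hom_axioms.intro G.group_axioms H.group_axioms)
  have sub: "subgroup I (add_monoid \<Lambda>)"
    using I(2) unfolding left_ideal_def by (rule additive_subgroup.a_subgroup[OF conjunct1])
  have left: "h \<otimes>\<^bsub>\<Lambda>\<^esub> x \<in> I" if "h \<in> carrier \<Lambda>" "x \<in> I" for h x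
    using I(2) that unfolding left_ideal_def by blast
  have I\<Lambda>: "x \<in> carrier \<Lambda>" if "x \<in> I" for x using subgroup.subset[OF sub] that by auto
  have addsub: "additive_subgroup (\<Psi> ` I) S\<^sub>f_bar"
    using GH.subgroup_img_is_subgroup[OF sub] by (rule additive_subgroup.intro)
  show "left_ideal S\<^sub>f_bar (\<Psi> ` I)"
    unfolding left_ideal_def
  proof (intro conjI ballI addsub)
    fix Y Z assume Y: "Y \<in> carrier S\<^sub>f_bar" and Z: "Z \<in> \<Psi> ` I"
    obtain h where h: "h \<in> carrier \<Lambda>" "Y = \<Psi> h" using \<Psi>_surj[OF Y] by blast
    obtain x where x: "x \<in> I" "Z = \<Psi> x" using Z by blast
    have "Y \<otimes>\<^bsub>S\<^sub>f_bar\<^esub> Z = \<Psi> (h \<otimes>\<^bsub>\<Lambda>\<^esub> x)"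
      unfolding h(2) x(2) by (rule \<Psi>_mult[OF h(1) I\<Lambda>[OF x(1)], symmetric])
    then show "Y \<otimes>\<^bsub>S\<^sub>f_bar\<^esub> Z \<in> \<Psi> ` I" using left[OF h(1) x(1)] by (rule image_eqI)
  qed
  show "\<Psi> ` I = principal_left S\<^sub>f_bar (\<Psi> g)"
  proof (intro equalityI subsetI)
    fix Y assume "Y \<in> \<Psi> ` I"
    then obtain h where h: "h \<in> carrier \<Lambda>" "Y = \<Psi> (h \<otimes>\<^bsub>\<Lambda>\<^esub> g)" unfolding I(1) principal_left_def by blast
    have "Y = \<Psi> h \<otimes>\<^bsub>S\<^sub>f_bar\<^esub> \<Psi> g" unfolding h(2) by (rule \<Psi>_mult[OF h(1) g(1)])
    then show "Y \<in> principal_left S\<^sub>f_bar (\<Psi> g)"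
      unfolding principal_left_def using \<Psi>_closed[OF h(1)] by blast
  next
    fix Y assume "Y \<in> principal_left S\<^sub>f_bar (\<Psi> g)"
    then obtain Z where Z: "Z \<in> carrier S\<^sub>f_bar" "Y = Z \<otimes>\<^bsub>S\<^sub>f_bar\<^esub> \<Psi> g" unfolding principal_left_def by blast
    obtain h where h: "h \<in> carrier \<Lambda>" "Z = \<Psi> h" using \<Psi>_surj[OF Z(1)] by blast
    have "Y = \<Psi> (h \<otimes>\<^bsub>\<Lambda>\<^esub> g)" unfolding Z(2) h(2) by (rule \<Psi>_mult[OF h(1) g(1), symmetric])
    moreover have "h \<otimes>\<^bsub>\<Lambda>\<^esub> g \<in> I" unfolding I(1) principal_left_def using h(1) by blast
    ultimately show "Y \<in> \<Psi> ` I" by (rule image_eqI)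
  qed
  show "\<Psi> g \<in> carrier S\<^sub>f_bar" by (rule \<Psi>_closed[OF g(1)])
  have gup: "g \<in> up \<D>" "g (deg \<D> g) = \<one>\<^bsub>\<D>\<^esub>" using g(2) by (simp_all add: monic_def)
  have lead: "\<Psi> g (deg \<D> g) = \<one>\<^bsub>\<D> Quot J\<^esub>"
    unfolding reduce_eq gup(2) by (rule redh.hom_one)
  have "\<Psi> g \<in> up (\<D> Quot J)" unfolding reduce_eq by (rule RH.map_up[OF gup(1)])
  moreover have "deg (\<D> Quot J) (\<Psi> g) = deg \<D> g"
  proof (rule deg_eq[OF calculation])
    show "\<Psi> g (deg \<D> g) \<noteq> \<zero>\<^bsub>\<D> Quot J\<^esub>" unfolding lead by (rule quot_nontriv)
    show "\<Psi> g i = \<zero>\<^bsub>\<D> Quot J\<^esub>" if "deg \<D> g < i" for i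
      unfolding reduce_eq coeff_above_deg[OF gup(1) that] by (rule redh.hom_zero)
  qed
  ultimately show "monic (\<D> Quot J) (\<Psi> g)" using lead by (simp add: monic_def)
qed

section \<open>The preimage of the code\<close>

definition code_preimage :: "(nat \<Rightarrow> nat \<Rightarrow> 'a) set \<Rightarrow> (nat \<Rightarrow> nat \<Rightarrow> 'a) set" where
  "code_preimage I = {x \<in> carrier \<Lambda>. \<exists>y \<in> I. \<Psi> x = \<Psi> y}"

text \<open>A coefficient vector records the first m coefficients; the remaining ones are reductions
  of zero.\<close>

lemma coeff_vector_inject:
  assumes "x \<in> carrier \<Lambda>" "y \<in> carrier \<Lambda>" "coeff_vector m (\<Psi> x) = coeff_vector m (\<Psi> y)"
  shows "\<Psi> x = \<Psi> y"
proof
  fix j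
  show "\<Psi> x j = \<Psi> y j"
  proof (cases "j < m")
    case True
    then show ?thesis using assms(3) by (simp add: coeff_vector_def)
  next
    case False
    then have "x j = \<zero>\<^bsub>\<D>\<^esub>" "y j = \<zero>\<^bsub>\<D>\<^esub>" using assms(1,2) by (simp_all add: \<Lambda>_simps(1) deg_below_def)
    then show ?thesis unfolding reduce_eq by simp
  qed
qed

lemma code_preimage_eq:
  assumes "I \<subseteq> carrier \<Lambda>"
  shows "{x \<in> carrier \<Lambda>. coeff_vector m (\<Psi> x) \<in> coeff_vector m ` \<Psi> ` I} = code_preimage I"
  unfolding code_preimage_def
proof (intro Collect_cong conj_cong refl)
  fix x assume x: "x \<in> carrier \<Lambda>"
  show "coeff_vector m (\<Psi> x) \<in> coeff_vector m ` \<Psi> ` I \<longleftrightarrow> (\<exists>y \<in> I. \<Psi> x = \<Psi> y)"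
    using coeff_vector_inject[OF x] assms by (auto simp del: reduce_eq)
qed

text \<open>\<open>lattice_basis\<close> is applied twice. The preimage of the code absorbs the ball
  of radius |\<pi>|, since \<pi> lies in \<open>\<pp>\<close>; the integers of \<open>F\<close>
  absorb the ball of radius one. In both cases one family is a basis over the valuation ring and
  over \<open>E\<close>, so ranks can be computed as dimensions.\<close>

lemma code_preimage_lattice:
  assumes I: "left_ideal \<Lambda> I" "\<kappa> ` \<pp> \<subseteq> I"
    and E: "subfield E K" "E \<subseteq> F0" "complete_valued (K\<lparr>carrier := E\<rparr>) nv"
    and \<pi>: "\<pi> \<in> E" "0 < nv \<pi>" "nv \<pi> < 1"
    and tb: "\<And>\<delta>. 0 < \<delta> \<Longrightarrow> \<exists>T. finite T \<and> T \<subseteq> carrier K \<and>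
      (\<forall>x \<in> carrier K. nv x \<le> 1 \<longrightarrow> (\<exists>t \<in> T. nv (x \<ominus> t) < \<delta>))"
    and dim: "dimension n F (carrier K)"
  defines "R \<equiv> K\<lparr>carrier := {x \<in> E. nv x \<le> 1}\<rparr>" and "A \<equiv> as_module \<kappa> S\<^sub>f"
  defines "N \<equiv> n\<^sup>2 * m * module_rank R (as_module id (K\<lparr>carrier := {x \<in> F. nv x \<le> 1}\<rparr>))"
  shows "is_lattice R (K\<lparr>carrier := E\<rparr>) A (code_preimage I)"
    "free_of_rank (K\<lparr>carrier := E\<rparr>) A N"
    "free_of_rank R (A\<lparr>carrier := code_preimage I\<rparr>) N"
proof -
  let ?S = "{x \<in> E. nv x \<le> 1}" and ?L = "code_preimage I"
  interpret A: coordinate_space K nv A "{..<m} \<times> {..<n}" "\<lambda>(j, i) x. x j i"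
    unfolding A_def by (rule coordinate_space)
  interpret U: vector_module K "as_module id K" by (rule vector_module_self) (rule field_axioms)
  \<comment> \<open>\<open>K\<close> with the identity as its only coordinate, the setting for the
    rank of the integers of \<open>F\<close>.\<close>
  interpret U: coordinate_space K nv "as_module id K" "{()}" "\<lambda>_ x. x"
    by unfold_locales (auto simp: as_module_def)
  have Er: "subring E K" using subfieldE(1)[OF E(1)] .
  have Fr: "subring F K" using subfieldE(1)[OF F] .
  have Sr: "subring ?S K" by (rule integers_subring[OF Er])
  have EF: "E \<subseteq> F" using E(2) F0(2) by blast
  have EK: "E \<subseteq> carrier K" using subringE(1)[OF Er] .
  note V = V_add V_zero V_carrier0 V_smult
  have sub: "subgroup I (add_monoid \<Lambda>)"
    using I(1) unfolding left_ideal_def by (rule additive_subgroup.a_subgroup[OF conjunct1])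
  have left: "h \<otimes>\<^bsub>\<Lambda>\<^esub> x \<in> I" if "h \<in> carrier \<Lambda>" "x \<in> I" for h x
    using I(1) that unfolding left_ideal_def by blast
  have I\<Lambda>: "x \<in> carrier \<Lambda>" if "x \<in> I" for x using subgroup.subset[OF sub] that by auto
  have L\<Lambda>: "x \<in> carrier \<Lambda>" if "x \<in> ?L" for x using that by (simp add: code_preimage_def)
  have \<Lambda>A: "x \<in> carrier A" if "x \<in> carrier \<Lambda>" for x
    using that by (simp add: \<Lambda>_carrier A_def V_carrier0)
  have IL: "x \<in> ?L" if "x \<in> I" for x using that I\<Lambda> by (auto simp: code_preimage_def)
  have L: "A.subspace ?S ?L"
    unfolding A.subspace_def
  proof (intro conjI ballI)
    show "?L \<subseteq> carrier A" using L\<Lambda> \<Lambda>A by blast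
    have "\<zero>\<^bsub>\<Lambda>\<^esub> \<in> I" using subgroup.one_closed[OF sub] by simp
    then have "\<zero>\<^bsub>\<Lambda>\<^esub> \<in> ?L" by (rule IL)
    then show "\<zero>\<^bsub>A\<^esub> \<in> ?L" by (simp add: \<Lambda>_simps(4) A_def V_zero order_simps D_zero)
    fix x assume x: "x \<in> ?L"
    obtain x' where x': "x' \<in> I" "\<Psi> x = \<Psi> x'" using x by (auto simp: code_preimage_def)
    show "x \<oplus>\<^bsub>A\<^esub> y \<in> ?L" if y: "y \<in> ?L" for y
    proof -
      obtain y' where y': "y' \<in> I" "\<Psi> y = \<Psi> y'" using y by (auto simp: code_preimage_def)
      have "\<Psi> (x \<oplus>\<^bsub>\<Lambda>\<^esub> y) = \<Psi> (x' \<oplus>\<^bsub>\<Lambda>\<^esub> y')"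
        using \<Psi>_add[OF L\<Lambda>[OF x] L\<Lambda>[OF y]] \<Psi>_add[OF I\<Lambda>[OF x'(1)] I\<Lambda>[OF y'(1)]] x'(2) y'(2) by simp
      moreover have "x' \<oplus>\<^bsub>\<Lambda>\<^esub> y' \<in> I" using subgroup.m_closed[OF sub x'(1) y'(1)] by simp
      moreover have "x \<oplus>\<^bsub>\<Lambda>\<^esub> y \<in> carrier \<Lambda>" using \<Lambda>_add_closed L\<Lambda> x y by blast
      moreover have "x \<oplus>\<^bsub>A\<^esub> y = x \<oplus>\<^bsub>\<Lambda>\<^esub> y" by (simp add: A_def V_add \<Lambda>_simps(3) order_simps D_add)
      ultimately show ?thesis unfolding code_preimage_def by auto
    qed
    show "s \<odot>\<^bsub>A\<^esub> x \<in> ?L" if s: "s \<in> ?S" for s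
    proof -
      have sK: "s \<in> carrier K" "nv s \<le> 1" using s EK by auto
      note k = \<kappa>_in_\<Lambda>[OF sK]
      have "\<Psi> (\<kappa> s \<otimes>\<^bsub>\<Lambda>\<^esub> x) = \<Psi> (\<kappa> s \<otimes>\<^bsub>\<Lambda>\<^esub> x')"
        using \<Psi>_mult[OF k L\<Lambda>[OF x]] \<Psi>_mult[OF k I\<Lambda>[OF x'(1)]] x'(2) by simp
      moreover have "\<kappa> s \<otimes>\<^bsub>\<Lambda>\<^esub> x' \<in> I" by (rule left[OF k x'(1)])
      moreover have "\<kappa> s \<otimes>\<^bsub>\<Lambda>\<^esub> x \<in> carrier \<Lambda>" by (rule \<Lambda>_mult_closed[OF k L\<Lambda>[OF x]])
      moreover have "s \<odot>\<^bsub>A\<^esub> x = \<kappa> s \<otimes>\<^bsub>\<Lambda>\<^esub> x"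
      proof -
        have "x j \<in> carrier D" for j using \<Lambda>_coeff[OF L\<Lambda>[OF x]] by (rule orderD)
        then have "\<kappa> s \<otimes>\<^bsub>\<Lambda>\<^esub> x = (\<lambda>j i. s \<otimes> x j i)"
          using \<kappa>_mult_\<Lambda>[OF sK L\<Lambda>[OF x]] const_mult_D[OF sK(1)] by (simp add: order_simps)
        moreover have "s \<odot>\<^bsub>A\<^esub> x = (\<lambda>j i. s \<otimes> x j i)"
          using \<Lambda>A[OF L\<Lambda>[OF x]] unfolding A_def V_carrier0 by (rule V_smult[OF sK(1)])
        ultimately show ?thesis by simp
      qed
      ultimately show ?thesis unfolding code_preimage_def by auto
    qed
  qed
  have WA: "A.subspace E (carrier A)"
    using EK by (auto simp: A.subspace_def)
  have absorb: "x \<in> ?L" if x: "x \<in> carrier A" "\<And>\<xi>. \<xi> \<in> {..<m} \<times> {..<n} \<Longrightarrow> nv ((case \<xi> of (j, i) \<Rightarrow> \<lambda>x. x j i) x) \<le> nv \<pi>" for x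
  proof (rule IL)
    have pF0: "\<pi> \<in> F0" "\<pi> \<in> \<pp>" "\<pi> \<in> carrier K" using \<pi> E(2) F0K by (auto simp: \<pp>_def)
    have p0: "\<pi> \<noteq> \<zero>" using \<pi>(2) by auto
    note inv = nonzero_inv[OF pF0(3) p0]
    \<comment> \<open>After division by \<pi> the coefficients are integral, so \<open>x\<close> is
      an element of the order times \<open>\<kappa> \<pi>\<close> on the right and lies in the ideal
      itself, not only in the preimage of the code.\<close>
    define y where "y = (\<lambda>j i. inv \<pi> \<otimes> x j i)"
    have xc: "x j i \<in> carrier K" "m \<le> j \<or> n \<le> i \<Longrightarrow> x j i = \<zero>" for j i
      using x(1) by (auto simp: A_def V_carrier0 S\<^sub>f_carrier)
    have small: "nv (x j i) \<le> nv \<pi>" for j i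
      using x(2)[of "(j, i)"] xc(2)[of j i] \<pi>(2) by (cases "j < m \<and> i < n") auto
    have "nv (y j i) \<le> 1" for j i
    proof -
      have "nv (y j i) = inverse (nv \<pi>) * nv (x j i)"
        using inv(1) xc(1) nv_inv[OF pF0(3) p0] by (simp add: y_def nv_mult)
      also have "\<dots> \<le> inverse (nv \<pi>) * nv \<pi>" using small \<pi>(2) by (intro mult_left_mono) auto
      finally show ?thesis using \<pi>(2) by simp
    qed
    moreover have "y \<in> carrier S\<^sub>f" using xc inv(1) by (simp add: S\<^sub>f_carrier y_def)
    ultimately have y: "y \<in> carrier \<Lambda>" by (simp add: \<Lambda>_carrier)
    have "y \<otimes>\<^bsub>\<Lambda>\<^esub> \<kappa> \<pi> = (\<lambda>j i. \<pi> \<otimes> y j i)"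
      using \<pi>(3) by (intro mult_\<kappa>_\<Lambda>[OF pF0(1) _ y]) simp
    also have "\<dots> = x"
      using inv pF0(3) xc(1) by (intro ext) (simp add: y_def flip: m_assoc)
    finally have "x = y \<otimes>\<^bsub>\<Lambda>\<^esub> \<kappa> \<pi>" by simp
    then show "x \<in> I" using left[OF y, of "\<kappa> \<pi>"] I(2) pF0(2) by blast
  qed
  have "\<exists>B b. A.basis_on ?S ?L B (b :: (nat \<Rightarrow> nat \<Rightarrow> 'a) \<Rightarrow> _) \<and> A.basis_on E (carrier A) B b"
  proof (rule A.lattice_basis[OF E(1,3) \<pi> tb WA L])
    show "?L \<subseteq> carrier A" using L\<Lambda> \<Lambda>A by blast
    show "nv ((case \<xi> of (j, i) \<Rightarrow> \<lambda>x. x j i) x) \<le> 1" if "x \<in> ?L" for \<xi> x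
      using L\<Lambda>[OF that] by (simp add: \<Lambda>_carrier split: prod.splits)
    show "0 < nv \<pi>" by (rule \<pi>(2))
    show "x \<in> ?L" if "x \<in> carrier A"
      "\<And>\<xi>. \<xi> \<in> {..<m} \<times> {..<n} \<Longrightarrow> nv ((case \<xi> of (j, i) \<Rightarrow> \<lambda>x. x j i) x) \<le> nv \<pi>" for x
      using that by (rule absorb)
  qed
  then obtain B b where b: "A.basis_on ?S ?L B (b :: (nat \<Rightarrow> nat \<Rightarrow> 'a) \<Rightarrow> _)"
      "A.basis_on E (carrier A) B b" by blast
  have "\<exists>C c. U.basis_on ?S {x \<in> F. nv x \<le> 1} C (c :: 'a \<Rightarrow> 'a) \<and> U.basis_on E F C c"
  proof (rule U.lattice_basis[OF E(1,3) \<pi> tb])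
    show "U.subspace E F"
      unfolding U.subspace_def using subringE(1,2,6,7)[OF Fr] EF by (simp add: as_module_def subset_iff)
    note O = subringE[OF integers_subring[OF Fr]]
    have SO: "?S \<subseteq> {x \<in> F. nv x \<le> 1}" using EF by blast
    show "U.subspace ?S {x \<in> F. nv x \<le> 1}"
      unfolding U.subspace_def
    proof (intro conjI ballI)
      fix x assume x: "x \<in> {x \<in> F. nv x \<le> 1}"
      show "x \<oplus>\<^bsub>as_module id K\<^esub> y \<in> {x \<in> F. nv x \<le> 1}" if "y \<in> {x \<in> F. nv x \<le> 1}" for y
        using O(7)[OF x that] by (simp add: as_module_def)
      show "s \<odot>\<^bsub>as_module id K\<^esub> x \<in> {x \<in> F. nv x \<le> 1}" if "s \<in> ?S" for s
        using O(6)[OF subsetD[OF SO that] x] by (simp add: as_module_def)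
    qed (use O(1,2) in \<open>simp_all add: as_module_def\<close>)
    \<comment> \<open>The integers of \<open>F\<close> are its whole unit ball, so the absorbed
      radius is one.\<close>
    show "0 < (1 :: real)" by simp
  qed auto
  then obtain C c where c: "U.basis_on ?S {x \<in> F. nv x \<le> 1} C (c :: 'a \<Rightarrow> 'a)"
      "U.basis_on E F C c" by blast
  obtain e where e: "U.basis_on F (carrier K) {..<n} e"
    using basis_on_of_dimension[OF field_axioms F dim] by blast
  have "\<exists>u. A.basis_on (carrier K) (carrier A) ({..<m} \<times> {..<n}) u"
  proof (rule A.standard_basis)
    fix v :: "nat \<times> nat \<Rightarrow> 'a" assume v: "v \<in> {..<m} \<times> {..<n} \<rightarrow> carrier K"
    let ?x = "\<lambda>j i. if j < m \<and> i < n then v (j, i) else \<zero>"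
    have "?x \<in> carrier A" using v by (auto simp: A_def V_carrier0 S\<^sub>f_carrier)
    moreover have "\<forall>\<xi> \<in> {..<m} \<times> {..<n}. (case \<xi> of (j, i) \<Rightarrow> \<lambda>x. x j i) ?x = v \<xi>" by auto
    ultimately show "\<exists>x \<in> carrier A. \<forall>\<xi> \<in> {..<m} \<times> {..<n}. (case \<xi> of (j, i) \<Rightarrow> \<lambda>x. x j i) x = v \<xi>"
      by blast
  qed
  then obtain u where u: "A.basis_on (carrier K) (carrier A) ({..<m} \<times> {..<n}) u" by blast
  \<comment> \<open>The coordinates contribute m n, the extension \<open>K\<close> over
    \<open>F\<close> contributes n, and \<open>F\<close> over \<open>E\<close> contributes the
    number of elements of \<open>C\<close>.\<close>
  note tower = A.basis_on_tower[OF A.basis_on_tower[OF u e Fr carrier_is_subring] c(2) Er Fr]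
  have "card B = card ((({..<m} \<times> {..<n}) \<times> {..<n}) \<times> C)"
    using A.basis_card_le[OF b(2) tower Er] A.basis_card_le[OF tower b(2) Er] by (rule order_antisym)
  moreover have "card C = module_rank R (as_module id (K\<lparr>carrier := {x \<in> F. nv x \<le> 1}\<rparr>))"
    using U.module_rank_eq[OF c(1) Sr] by (simp add: R_def as_module_def)
  ultimately have cB: "card B = N"
    by (simp add: N_def card_cartesian_product power2_eq_square mult.assoc mult.commute mult.left_commute)
  show "free_of_rank (K\<lparr>carrier := E\<rparr>) A N"
    using A.basis_on_free[OF b(2) Er] cB by simp
  show "free_of_rank R (A\<lparr>carrier := ?L\<rparr>) N"
    using A.basis_on_free[OF b(1) Sr] cB by (simp add: R_def)
  note spanL = A.basis_on_span_indep[OF b(1) Sr] and spanA = A.basis_on_span_indep[OF b(2) Er]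
  have "module_basis (K\<lparr>carrier := E\<rparr>) A (b ` B)"
    unfolding module_basis_def using spanA by blast
  moreover have "submodule ?L R A" using A.subspace_submodule[OF L Sr] by (simp only: R_def)
  moreover have "?L \<subseteq> carrier A" using L\<Lambda> \<Lambda>A by blast
  ultimately show "is_lattice R (K\<lparr>carrier := E\<rparr>) A ?L"
    unfolding is_lattice_def using spanL unfolding R_def by blast
qed

end

section \<open>The theorem\<close>

theorem mainTheorem2:
  fixes K :: "'a ring" and nv :: "'a \<Rightarrow> real" and F F0 :: "'a set"
    and n m :: nat and \<tau> :: "'a \<Rightarrow> 'a" and c :: 'a
    and D \<D> :: "(nat \<Rightarrow> 'a) ring" and \<sigma> :: "(nat \<Rightarrow> 'a) \<Rightarrow> nat \<Rightarrow> 'a"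
    and \<pp> :: "'a set" and d :: "nat \<Rightarrow> 'a" and f g :: "nat \<Rightarrow> nat \<Rightarrow> 'a"
    and S\<^sub>f \<Lambda> :: "(nat \<Rightarrow> nat \<Rightarrow> 'a) ring" and \<kappa> :: "'a \<Rightarrow> nat \<Rightarrow> nat \<Rightarrow> 'a"
    and \<pp>\<D> :: "(nat \<Rightarrow> 'a) set" and \<pp>\<Lambda> :: "(nat \<Rightarrow> nat \<Rightarrow> 'a) set"
    and S\<^sub>f_bar :: "(nat \<Rightarrow> (nat \<Rightarrow> 'a) set) ring"
    and \<Psi> :: "(nat \<Rightarrow> nat \<Rightarrow> 'a) \<Rightarrow> nat \<Rightarrow> (nat \<Rightarrow> 'a) set"
    and \<Psi>' :: "(nat \<Rightarrow> nat \<Rightarrow> 'a) set \<Rightarrow> nat \<Rightarrow> (nat \<Rightarrow> 'a) set"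
    and \<rho> :: "(nat \<Rightarrow> nat \<Rightarrow> 'a) \<Rightarrow> nat \<Rightarrow> (nat \<Rightarrow> 'a) set"
    and \<I> L :: "(nat \<Rightarrow> nat \<Rightarrow> 'a) set"
    and \<Psi>\<I> :: "(nat \<Rightarrow> (nat \<Rightarrow> 'a) set) set" and \<C> :: "(nat \<Rightarrow> 'a) set list set"
  \<comment> \<open>the cyclic extension, the cyclic division algebra and its natural order\<close>
  assumes "local_nonarch_field K nv"
    and "subfield F K"
    and "local_nonarch_field (K\<lparr>carrier := F\<rparr>) nv"
    and "galois_extension F K"
    and "ring.dimension K n F (carrier K)"
    and "\<tau> \<in> carrier (gal_group F K)"
    and "carrier (gal_group F K) = generate (gal_group F K) {\<tau>}"
    and "c \<in> integers_of (K\<lparr>carrier := F\<rparr>) nv" and "c \<noteq> \<zero>\<^bsub>K\<^esub>"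
    and D: "D = cyclic_algebra K n \<tau> c"
    and "division_ring D"
    and \<D>: "\<D> = natural_order (integers_of K nv) D"
  \<comment> \<open>the automorphism\<close>
    and "\<sigma> \<in> ring_iso D D"
    and "0 < m"
    and "\<forall>x \<in> F. (\<sigma> ^^ m) (const_seq K x) = const_seq K x"
    and "\<forall>k. 0 < k \<and> k < m \<longrightarrow> (\<exists>x \<in> F. (\<sigma> ^^ k) (const_seq K x) \<noteq> const_seq K x)"
    and "\<sigma> ` carrier \<D> \<subseteq> carrier \<D>"
    and F0: "F0 = {x \<in> F. \<sigma> (const_seq K x) = const_seq K x}"
    and "local_nonarch_field (K\<lparr>carrier := F0\<rparr>) nv"
    and "galois_extension F0 (K\<lparr>carrier := F\<rparr>)"
    and "unramified F0 (K\<lparr>carrier := F\<rparr>) nv"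
    and \<pp>: "\<pp> = max_ideal_of (K\<lparr>carrier := F0\<rparr>) nv"
  \<comment> \<open>the Petit algebra and its natural order\<close>
    and "d \<in> carrier \<D>"
    and f: "f = binomial_poly D m d"
    and "skew_irreducible D \<sigma> f"
    and S\<^sub>f: "S\<^sub>f = petit D \<sigma> f"
    and \<Lambda>: "\<Lambda> = petit \<D> \<sigma> f"
    and \<kappa>: "\<kappa> = (\<lambda>a. const_seq D (const_seq K a))"
  \<comment> \<open>the reduction maps\<close>
    and \<pp>\<D>: "\<pp>\<D> = (const_seq K ` \<pp>) \<cdot>\<^bsub>\<D>\<^esub> carrier \<D>"
    and \<pp>\<Lambda>: "\<pp>\<Lambda> = (\<kappa> ` \<pp>) \<cdot>\<^bsub>\<Lambda>\<^esub> carrier \<Lambda>"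
    and S\<^sub>f_bar: "S\<^sub>f_bar = petit (\<D> Quot \<pp>\<D>) (coset_map \<D> \<pp>\<D> \<sigma>) (reduce \<D> \<pp>\<D> f)"
    and \<Psi>: "\<Psi> = reduce \<D> \<pp>\<D>"
    and \<Psi>': "\<Psi>' = on_coset \<Psi>"
    and \<rho>: "\<rho> = (\<lambda>x. \<Psi>' (\<pp>\<Lambda> +>\<^bsub>\<Lambda>\<^esub> x))"
  \<comment> \<open>the ideal, the code and the preimage of the code\<close>
    and "g \<in> carrier \<Lambda>" and "monic \<D> g"
    and \<I>: "\<I> = principal_left \<Lambda> g" and "left_ideal \<Lambda> \<I>"
    and "\<kappa> ` \<pp> \<subseteq> \<I> \<inter> \<kappa> ` integers_of (K\<lparr>carrier := F0\<rparr>) nv"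
    and \<Psi>\<I>: "\<Psi>\<I> = \<Psi>' ` ((\<lambda>x. \<pp>\<Lambda> +>\<^bsub>\<Lambda>\<^esub> x) ` \<I>)"
    and \<C>: "\<C> = coeff_vector m ` \<Psi>\<I>"
    and L: "L = {x \<in> carrier \<Lambda>. coeff_vector m (\<rho> x) \<in> \<C>}"
  shows "(left_ideal S\<^sub>f_bar \<Psi>\<I> \<and> \<Psi>\<I> = principal_left S\<^sub>f_bar (\<Psi> g) \<and>
          \<Psi> g \<in> carrier S\<^sub>f_bar \<and> monic (\<D> Quot \<pp>\<D>) (\<Psi> g)) \<and>
    (\<forall>p Qp. Factorial_Ring.prime (p :: nat) \<and>
        subfield Qp (K\<lparr>carrier := F0\<rparr>) \<and> padic_numbers p (K\<lparr>carrier := Qp\<rparr>) nv \<and>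
        ring.finite_dimension K Qp F0 \<and> ring.finite_dimension K Qp F \<and>
        ring.finite_dimension K Qp (carrier K) \<longrightarrow>
      (let E = K\<lparr>carrier := Qp\<rparr>;
           Zp = K\<lparr>carrier := integers_of E nv\<rparr>;
           A = as_module \<kappa> S\<^sub>f;
           O\<^sub>F = K\<lparr>carrier := integers_of (K\<lparr>carrier := F\<rparr>) nv\<rparr>;
           N = n\<^sup>2 * m * module_rank Zp (as_module id O\<^sub>F)
       in is_lattice Zp E A L \<and> free_of_rank E A N \<and>
          free_of_rank Zp (A\<lparr>carrier := L\<rparr>) N)) \<and>
    (\<forall>\<phi> :: 'a \<Rightarrow> ('q::{field,finite}) fls. laurent_iso (K\<lparr>carrier := F0\<rparr>) \<phi> \<longrightarrow>
      (let E = K\<lparr>carrier := F0\<rparr>;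
           R = K\<lparr>carrier := power_series_in E \<phi>\<rparr>;
           A = as_module \<kappa> S\<^sub>f;
           O\<^sub>F = K\<lparr>carrier := integers_of (K\<lparr>carrier := F\<rparr>) nv\<rparr>;
           N = n\<^sup>2 * m * module_rank R (as_module id O\<^sub>F)
       in is_lattice R E A L \<and> free_of_rank R (A\<lparr>carrier := L\<rparr>) N))"
proof -
  interpret KL: local_nonarch_field K nv by fact
  interpret FL: local_nonarch_field "K\<lparr>carrier := F0\<rparr>" nv by fact
  have KV: "valued_field K nv" by (rule KL.valued_field_axioms)
  \<comment> \<open>A uniformizer of \<open>K\<close>; in the transfer along \<tau> it is both the
    small element of the source and the generator of the value group of the target.\<close>
  obtain t where t: "t \<in> carrier K" "0 < nv t" "nv t < 1"
      "\<And>x. x \<in> carrier K \<Longrightarrow> x \<noteq> \<zero>\<^bsub>K\<^esub> \<Longrightarrow> \<exists>k::int. nv x = nv t powi k"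
    using KL.discrete by blast
  have \<tau>: "\<tau> \<in> ring_hom K K" "\<tau> ` carrier K = carrier K" "\<And>x. x \<in> F \<Longrightarrow> \<tau> x = x"
    using \<open>\<tau> \<in> carrier (gal_group F K)\<close>
    by (auto simp: gal_group_def Bij_def bij_betw_def)
  have F0F: "F0 \<subseteq> F" by (auto simp: F0)
  have FK: "F \<subseteq> carrier K" using subfieldE(3)[OF \<open>subfield F K\<close>] .
  have F0K: "F0 \<subseteq> carrier K" using F0F FK by blast
  \<comment> \<open>\<open>F0\<close> is given as a set of fixed elements; that it is a subfield is
    read off from its being a local field under the restricted operations.\<close>
  have F0sub: "subfield F0 K"
    by (rule KL.subfield_iff(1)[OF FL.field_axioms F0K])
  have int_eq: "integers_of (K\<lparr>carrier := S\<rparr>) nv = {x \<in> S. nv x \<le> 1}" for S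
    by (simp add: integers_of_def)
  have D_ring: "ring D" "\<one>\<^bsub>D\<^esub> \<noteq> \<zero>\<^bsub>D\<^esub>"
    using \<open>division_ring D\<close> by (simp_all add: division_ring_def)
  note \<sigma> = ring_isoD(1)[OF \<open>\<sigma> \<in> ring_iso D D\<close>]
  have cO: "c \<in> F" "nv c \<le> 1" using \<open>c \<in> integers_of _ nv\<close> unfolding int_eq by auto
  interpret P: petit_order K nv F n \<tau> c D \<D> F0 \<sigma> m d f S\<^sub>f \<Lambda> \<kappa> \<pp> \<pp>\<D>
  proof (intro petit_order.intro cyclic_order.intro cyclic_order_axioms.intro petit_order_axioms.intro)
    show "nv (\<tau> x) \<le> 1" if "x \<in> carrier K" "nv x \<le> 1" for x
      by (rule iso_maps_integers_to_integers[OF KV KL.complete t(1-3) KV t \<tau>(1,2) that])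
    show "\<sigma> (const_seq K x) = const_seq K x" if "x \<in> F0" for x using that by (simp add: F0)
    show "\<pp> = {x \<in> F0. nv x < 1}" by (simp add: \<pp> max_ideal_of_def)
  qed fact+
  have sub: "additive_subgroup \<I> \<Lambda>" using \<open>left_ideal \<Lambda> \<I>\<close> by (simp add: left_ideal_def)
  have I\<Lambda>: "\<I> \<subseteq> carrier \<Lambda>" using additive_subgroup.a_subset[OF sub] .
  \<comment> \<open>The passage through cosets disappears, as \<open>\<Psi>\<close> is constant on
    them.\<close>
  have on_coset: "\<Psi>' (\<pp>\<Lambda> +>\<^bsub>\<Lambda>\<^esub> x) = \<Psi> x" if "x \<in> carrier \<Lambda>" for x
    unfolding \<Psi>' \<Psi> \<pp>\<Lambda> by (rule P.\<Psi>_on_coset[OF that])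
  have \<Psi>\<I>_eq: "\<Psi>\<I> = \<Psi> ` \<I>"
    unfolding \<Psi>\<I> image_image using on_coset I\<Lambda> by (intro image_cong) auto
  have "L = {x \<in> carrier \<Lambda>. coeff_vector m (\<Psi> x) \<in> coeff_vector m ` \<Psi> ` \<I>}"
    unfolding L \<C> \<Psi>\<I>_eq \<rho> using on_coset by (intro Collect_cong conj_cong refl) simp
  then have L_eq: "L = P.code_preimage \<I>"
    unfolding \<Psi> P.code_preimage_eq[OF I\<Lambda>] .
  have tb: "\<exists>T. finite T \<and> T \<subseteq> carrier K \<and>
      (\<forall>x \<in> carrier K. nv x \<le> 1 \<longrightarrow> (\<exists>t \<in> T. nv (x \<ominus>\<^bsub>K\<^esub> t) < \<delta>))" if "0 < \<delta>" for \<delta>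
    by (rule KL.integers_totally_bounded[OF that])
  have pI: "\<kappa> ` \<pp> \<subseteq> \<I>" using \<open>\<kappa> ` \<pp> \<subseteq> \<I> \<inter> _\<close> by blast
  \<comment> \<open>The base field is still free at this point: it becomes Q_p in (i) and F_0 in
    (ii).\<close>
  note lattice = P.code_preimage_lattice[OF \<open>left_ideal \<Lambda> \<I>\<close> pI _ _ _ _ _ _ tb
      \<open>ring.dimension K n F (carrier K)\<close>, folded L_eq]
  note ideal = P.reduced_ideal[OF \<open>g \<in> carrier \<Lambda>\<close> \<open>monic \<D> g\<close> \<I> \<open>left_ideal \<Lambda> \<I>\<close>,
      folded \<Psi>, folded \<Psi>\<I>_eq]
  have Sbar: "S\<^sub>f_bar = petit (\<D> Quot \<pp>\<D>) (coset_map \<D> \<pp>\<D> \<sigma>) (\<Psi> f)"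
    unfolding S\<^sub>f_bar \<Psi> ..
  show ?thesis
  proof (intro conjI allI impI)
    show "left_ideal S\<^sub>f_bar \<Psi>\<I>" "\<Psi>\<I> = principal_left S\<^sub>f_bar (\<Psi> g)"
      "\<Psi> g \<in> carrier S\<^sub>f_bar" "monic (\<D> Quot \<pp>\<D>) (\<Psi> g)"
      unfolding Sbar by (fact ideal)+
  next
    fix p Qp
    assume "Factorial_Ring.prime (p :: nat) \<and>
        subfield Qp (K\<lparr>carrier := F0\<rparr>) \<and> padic_numbers p (K\<lparr>carrier := Qp\<rparr>) nv \<and>
        ring.finite_dimension K Qp F0 \<and> ring.finite_dimension K Qp F \<and>
        ring.finite_dimension K Qp (carrier K)"
    then have p: "Factorial_Ring.prime p" and Qp: "subfield Qp (K\<lparr>carrier := F0\<rparr>)"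
      and pad: "padic_numbers p (K\<lparr>carrier := Qp\<rparr>) nv" by blast+
    have QF0: "Qp \<subseteq> F0" using subfieldE(3)[OF Qp] by simp
    have "field (K\<lparr>carrier := Qp\<rparr>)" using FL.subfield_iff(2)[OF Qp] by simp
    then have QK: "subfield Qp K" using KL.subfield_iff(1) QF0 F0K by blast
    have comp: "complete_valued (K\<lparr>carrier := Qp\<rparr>) nv" using pad by (simp add: padic_numbers_def)
    \<comment> \<open>Any element of absolute value strictly between 0 and 1 serves as \<pi>; here
      it comes from the image of the prime p.\<close>
    obtain \<pi> where pi: "\<pi> \<in> Qp" "0 < nv \<pi>" "nv \<pi> < 1"
      using padic_numbers_nontrivial[OF p pad] by auto
    show "let E = K\<lparr>carrier := Qp\<rparr>;
           Zp = K\<lparr>carrier := integers_of E nv\<rparr>;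
           A = as_module \<kappa> S\<^sub>f;
           O\<^sub>F = K\<lparr>carrier := integers_of (K\<lparr>carrier := F\<rparr>) nv\<rparr>;
           N = n\<^sup>2 * m * module_rank Zp (as_module id O\<^sub>F)
       in is_lattice Zp E A L \<and> free_of_rank E A N \<and>
          free_of_rank Zp (A\<lparr>carrier := L\<rparr>) N"
      unfolding Let_def int_eq using lattice[OF QK QF0 comp pi] by (intro conjI)
  next
    fix \<phi> :: "'a \<Rightarrow> 'q fls"
    assume \<phi>: "laurent_iso (K\<lparr>carrier := F0\<rparr>) \<phi>"
    obtain \<pi> where pi: "\<pi> \<in> F0" "0 < nv \<pi>" "nv \<pi> < 1"
      using FL.discrete by auto
    have ps: "power_series_in (K\<lparr>carrier := F0\<rparr>) \<phi> = {x \<in> F0. nv x \<le> 1}"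
      using power_series_in_eq_integers[OF FL.valued_field_axioms FL.complete _ pi(2,3) \<phi>] pi(1)
      by (simp add: int_eq)
    show "let E = K\<lparr>carrier := F0\<rparr>;
           R = K\<lparr>carrier := power_series_in E \<phi>\<rparr>;
           A = as_module \<kappa> S\<^sub>f;
           O\<^sub>F = K\<lparr>carrier := integers_of (K\<lparr>carrier := F\<rparr>) nv\<rparr>;
           N = n\<^sup>2 * m * module_rank R (as_module id O\<^sub>F)
       in is_lattice R E A L \<and> free_of_rank R (A\<lparr>carrier := L\<rparr>) N"
      unfolding Let_def int_eq ps using lattice[OF F0sub order_refl FL.complete pi] by (intro conjI)
  qed
qed

end
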